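(* Let $m>1$, let $b\in C^1(\overline\Omega;\mathbb R^d)$ with $\operatorname{div}b=0$, let $s$ be a real-valued source function, and assume $u$ is a smooth nonnegative solution of $$\partial_tu+\operatorname{div}\bigl(ub-\nabla(u^m)\bigr)=s(u),\qquad u\ge0,$$ in $\Omega\times(0,T)$. Put $\mu=\frac{m}{m-1}u^{m-1}$. Then $$\frac{d}{dt}\int_\Omega\frac{u^m}{m-1}\,dx=-\int_\Omega\frac{m-1}{m}u|\nabla\mu|^2\,dx+\mathcal B_{\mathrm{pm}}[u]+\int_\Omega\mu\,s(u)\,dx,$$ where $$\mathcal B_{\mathrm{pm}}[u]=-\int_{\partial\Omega}\left(\frac{u^m}{m-1}b-\mu\frac{m-1}{m}u\nabla\mu\right)\cdot n\,dS.$$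
   Context: $\Omega\subset\mathbb R^d$ is a bounded Lipschitz domain with outward unit normal $n$. "Smooth solution" means sufficiently regular in space and time for all terms in the equation and in the balance (including $\nabla\mu$ and the boundary integrals) to be meaningful, satisfying the equation almost everywhere. Here $\nabla(u^m)=\frac{m-1}{m}u\nabla\mu$.
   Formalization: The factor (m-1)/m is a slip, since this μ gives ∇(u^m)=u∇μ. What is proved: the balance with factor 1 in the dissipation and boundary terms; and the printed balance under the explicit assumption ∇(u^m)=((m-1)/m)u∇μ. *)

theory Defs
  imports "HOL-Analysis.Analysis"
begin

section \<open>Differential operators\<close>

text \<open>
  Partial derivatives are classical, two-sided ones, so \<^term>\<open>grad\<close> and \<^term>\<open>divg\<close> below are
  meaningful at interior points of the domain of the function only.
\<close>

definition pderiv_at :: "'a::euclidean_space \<Rightarrow> ('a \<Rightarrow> real) \<Rightarrow> 'a \<Rightarrow> real" where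
  "pderiv_at i f x = deriv (\<lambda>h. f (x + h *\<^sub>R i)) 0"

definition grad :: "('a::euclidean_space \<Rightarrow> real) \<Rightarrow> 'a \<Rightarrow> 'a" where
  "grad f x = (\<Sum>i\<in>Basis. pderiv_at i f x *\<^sub>R i)"

definition divg :: "('a::euclidean_space \<Rightarrow> 'a) \<Rightarrow> 'a \<Rightarrow> real" where
  "divg F x = (\<Sum>i\<in>Basis. pderiv_at i (\<lambda>y. F y \<bullet> i) x)"

text \<open>
  The continuous extension of the gradient from an open set to its closure; it provides the
  boundary values of the gradient. If the gradient has such an extension, it coincides with
  \<^term>\<open>grad f\<close> on the open set itself.
\<close>

definition grad_closure :: "'a::euclidean_space set \<Rightarrow> ('a \<Rightarrow> real) \<Rightarrow> 'a \<Rightarrow> 'a" where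
  "grad_closure \<Omega> f x = Lim (at x within \<Omega>) (grad f)"

text \<open>
  The class of continuously differentiable functions up to the boundary: the function is
  continuous on the closure, and its derivative exists in the open set and extends continuously
  to the closure.
\<close>

definition C1_closure ::
    "'a::euclidean_space set \<Rightarrow> ('a \<Rightarrow> 'b::euclidean_space) \<Rightarrow> bool" where
  "C1_closure \<Omega> f \<longleftrightarrow>
     continuous_on (closure \<Omega>) f \<and>
     (\<exists>D :: 'a \<Rightarrow> 'a \<Rightarrow>\<^sub>L 'b. continuous_on (closure \<Omega>) D \<and>
        (\<forall>x\<in>\<Omega>. (f has_derivative blinfun_apply (D x)) (at x)))"

section \<open>Lipschitz domains, surface measure and outward normal\<close>

text \<open>
  In the open set \<^term>\<open>U\<close>, the set \<^term>\<open>\<Omega>\<close> is the region below the graph of a Lipschitz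
  function over the hyperplane orthogonal to the unit vector \<^term>\<open>e\<close>. That function is represented
  by its extension \<^term>\<open>\<Gamma>\<close> to the whole space which is constant along \<^term>\<open>e\<close>; this avoids choosing
  coordinates on the hyperplane. It follows that the frontier of \<^term>\<open>\<Omega>\<close> in \<^term>\<open>U\<close> is the graph
  \<open>x \<bullet> e = \<Gamma> x\<close>.
\<close>

definition boundary_chart ::
    "'a::euclidean_space set \<Rightarrow> 'a set \<Rightarrow> 'a \<Rightarrow> ('a \<Rightarrow> real) \<Rightarrow> bool" where
  "boundary_chart \<Omega> U e \<Gamma> \<longleftrightarrow>
     open U \<and> norm e = 1 \<and> (\<exists>L. L-lipschitz_on UNIV \<Gamma>) \<and>
     (\<forall>x h. \<Gamma> (x + h *\<^sub>R e) = \<Gamma> x) \<and>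
     \<Omega> \<inter> U = {x \<in> U. x \<bullet> e < \<Gamma> x}"

definition bounded_lipschitz_domain :: "'a::euclidean_space set \<Rightarrow> bool" where
  "bounded_lipschitz_domain \<Omega> \<longleftrightarrow>
     open \<Omega> \<and> connected \<Omega> \<and> \<Omega> \<noteq> {} \<and> bounded \<Omega> \<and>
     (\<forall>p\<in>frontier \<Omega>. \<exists>U e \<Gamma>. p \<in> U \<and> boundary_chart \<Omega> U e \<Gamma>)"

text \<open>The point of the graph lying over (or under) \<^term>\<open>x\<close> in direction \<^term>\<open>e\<close>.\<close>

definition graph_point :: "'a::euclidean_space \<Rightarrow> ('a \<Rightarrow> real) \<Rightarrow> 'a \<Rightarrow> 'a" where
  "graph_point e \<Gamma> x = x + (\<Gamma> x - x \<bullet> e) *\<^sub>R e"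

text \<open>
  The surface measure \<open>dS\<close> on the boundary of a Lipschitz domain: in every chart it is given by the
  usual formula \<open>dS = sqrt (1 + |\<nabla>\<Gamma>|\<^sup>2) dy\<close>, where \<open>y\<close> ranges over the hyperplane orthogonal
  to \<^term>\<open>e\<close>. The integral over this hyperplane is written as an integral over the slab
  \<open>0 \<le> x \<bullet> e \<le> 1\<close> of thickness one: the remaining factors of the integrand are constant along
  \<^term>\<open>e\<close>, so by Fubini the two integrals agree (also in dimension one, where the hyperplane is a
  single point of mass one). The gradient of \<^term>\<open>\<Gamma>\<close> exists almost everywhere by Rademacher's
  theorem. The measure is uniquely determined by these conditions; it is the
  \<open>(d - 1)\<close>-dimensional Hausdorff measure restricted to the boundary.
\<close>

definition is_surface_measure :: "'a::euclidean_space set \<Rightarrow> 'a measure \<Rightarrow> bool" where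
  "is_surface_measure \<Omega> \<sigma> \<longleftrightarrow>
     sets \<sigma> = sets borel \<and> emeasure \<sigma> (- frontier \<Omega>) = 0 \<and>
     (\<forall>U e \<Gamma> A. boundary_chart \<Omega> U e \<Gamma> \<longrightarrow> A \<in> sets borel \<longrightarrow> A \<subseteq> U \<inter> frontier \<Omega> \<longrightarrow>
        emeasure \<sigma> A =
          (\<integral>\<^sup>+x. ennreal (indicator {0..1} (x \<bullet> e) * indicator A (graph_point e \<Gamma> x) *
                   sqrt (1 + (norm (grad \<Gamma> x))\<^sup>2)) \<partial>lborel))"

text \<open>
  The outward unit normal is \<open>(e - \<nabla>\<Gamma>) / sqrt (1 + |\<nabla>\<Gamma>|\<^sup>2)\<close> at almost every boundary point of every
  chart. The gradient may be evaluated at the boundary point itself since \<^term>\<open>\<Gamma>\<close> is constant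
  along \<^term>\<open>e\<close>.
\<close>

definition is_outward_normal ::
    "'a::euclidean_space set \<Rightarrow> 'a measure \<Rightarrow> ('a \<Rightarrow> 'a) \<Rightarrow> bool" where
  "is_outward_normal \<Omega> \<sigma> n \<longleftrightarrow>
     n \<in> borel_measurable borel \<and>
     (\<forall>U e \<Gamma>. boundary_chart \<Omega> U e \<Gamma> \<longrightarrow>
        (AE x in \<sigma>. x \<in> U \<inter> frontier \<Omega> \<longrightarrow>
           n x = (1 / sqrt (1 + (norm (grad \<Gamma> x))\<^sup>2)) *\<^sub>R (e - grad \<Gamma> x)))"

section \<open>The porous medium equation with drift and source\<close>

definition pressure :: "real \<Rightarrow> ('a \<Rightarrow> real) \<Rightarrow> 'a \<Rightarrow> real" where
  "pressure m v x = m / (m - 1) * v x powr (m - 1)"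

definition pm_flux ::
    "'a::euclidean_space set \<Rightarrow> real \<Rightarrow> ('a \<Rightarrow> 'a) \<Rightarrow> ('a \<Rightarrow> real) \<Rightarrow> 'a \<Rightarrow> 'a" where
  "pm_flux \<Omega> m b v x = v x *\<^sub>R b x - grad_closure \<Omega> (\<lambda>y. v y powr m) x"

text \<open>
  Smooth nonnegative solutions on \<open>\<Omega> \<times> (0,T)\<close>. The required regularity is that of the quantities
  occurring in the equation and in the energy balance; \<^term>\<open>u\<close> itself need not be differentiable in
  space where it vanishes, as long as the pressure, the power \<open>u\<^sup>m\<close> and the flux are regular.
  The source function \<^term>\<open>s\<close> is arbitrary.
\<close>

definition pm_smooth_solution ::
    "'a::euclidean_space set \<Rightarrow> real \<Rightarrow> real \<Rightarrow> ('a \<Rightarrow> 'a) \<Rightarrow> (real \<Rightarrow> real) \<Rightarrow>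
     (real \<Rightarrow> 'a \<Rightarrow> real) \<Rightarrow> bool" where
  "pm_smooth_solution \<Omega> T m b s u \<longleftrightarrow>
     (\<forall>t\<in>{0<..<T}. \<forall>x\<in>\<Omega>. 0 \<le> u t x) \<and>
     continuous_on ({0<..<T} \<times> closure \<Omega>) (\<lambda>(t, x). u t x) \<and>
     (\<forall>t\<in>{0<..<T}. \<forall>x\<in>closure \<Omega>. (\<lambda>\<tau>. u \<tau> x) differentiable (at t)) \<and>
     continuous_on ({0<..<T} \<times> closure \<Omega>) (\<lambda>(t, x). deriv (\<lambda>\<tau>. u \<tau> x) t) \<and>
     (\<forall>t\<in>{0<..<T}.
        C1_closure \<Omega> (\<lambda>x. u t x powr m) \<and>
        C1_closure \<Omega> (pressure m (u t)) \<and>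
        C1_closure \<Omega> (pm_flux \<Omega> m b (u t)) \<and>
        (AE x in lebesgue. x \<in> \<Omega> \<longrightarrow>
           deriv (\<lambda>\<tau>. u \<tau> x) t + divg (pm_flux \<Omega> m b (u t)) x = s (u t x)))"

text \<open>
  The dissipation and the boundary term, with a parameter \<^term>\<open>c\<close> for the constant in the relation
  \<open>\<nabla>(u\<^sup>m) = c u \<nabla>\<mu>\<close>. For \<open>\<mu> = m / (m - 1) u\<^sup>m\<^sup>-\<^sup>1\<close> the chain rule gives \<open>c = 1\<close>; the value
  \<open>c = (m - 1) / m\<close> is the one used in the source.
\<close>

definition pm_dissipation ::
    "'a::euclidean_space set \<Rightarrow> real \<Rightarrow> real \<Rightarrow> ('a \<Rightarrow> real) \<Rightarrow> real" where
  "pm_dissipation \<Omega> c m v =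
     (LINT x:\<Omega>|lebesgue. c * v x * (norm (grad (pressure m v) x))\<^sup>2)"

definition pm_boundary ::
    "'a::euclidean_space set \<Rightarrow> 'a measure \<Rightarrow> ('a \<Rightarrow> 'a) \<Rightarrow> real \<Rightarrow> real \<Rightarrow> ('a \<Rightarrow> 'a) \<Rightarrow>
     ('a \<Rightarrow> real) \<Rightarrow> real" where
  "pm_boundary \<Omega> \<sigma> n c m b v =
     - (LINT x:frontier \<Omega>|\<sigma>.
          ((v x powr m / (m - 1)) *\<^sub>R b x
             - (pressure m v x * c * v x) *\<^sub>R grad_closure \<Omega> (pressure m v) x) \<bullet> n x)"

end

theory Submission
  imports Defs
begin

text \<open>
  Multiply the equation by the pressure. In time, the chain rule gives
  \<open>\<partial>\<^sub>t (u\<^sup>m / (m - 1)) = \<mu> \<partial>\<^sub>t u\<close>; it holds at the zeros of \<open>u\<close> too, because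
  \<open>m > 1\<close>. In space, write \<open>F\<close> for the flux. Since \<open>\<nabla>(u\<^sup>m) = u \<nabla>\<mu>\<close> and \<open>div b = 0\<close>, the
  field \<open>V = \<mu> F - u\<^sup>m b\<close> satisfies \<open>div V = \<mu> div F - u |\<nabla>\<mu>|\<^sup>2\<close>, and it equals
  \<open>u\<^sup>m / (m - 1) b - \<mu> u \<nabla>\<mu>\<close>, the field in the boundary term. So the divergence theorem
  for \<open>V\<close> is the balance with the constant one in the dissipation and in the boundary term. The field
  \<open>V\<close> is continuously differentiable up to the boundary because it is built by products from
  quantities that are, namely \<open>\<mu>\<close>, \<open>u\<^sup>m\<close>, \<open>b\<close> and the whole flux.

  If also \<open>\<nabla>(u\<^sup>m) = (m - 1) / m u \<nabla>\<mu>\<close>, then comparison with \<open>\<nabla>(u\<^sup>m) = u \<nabla>\<mu>\<close> shows \<open>u \<nabla>\<mu> = 0\<close> on the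
  closure of the domain. Dissipation and the \<open>\<nabla>\<mu>\<close> part of the boundary term then vanish, whatever
  constant stands in front of them, so the balance with the constant \<open>(m - 1) / m\<close> is the same
  equation.

  Most of the work is the divergence theorem on a Lipschitz domain, with surface measure and normal
  given by the pointwise gradient of the charts (\<open>gauss_green\<close>, \<open>divergence_theorem\<close>). A partition of
  unity reduces it to one chart, where the domain is a subgraph \<open>{x \<bullet> e < \<Gamma> x}\<close>. There the volume
  integral of \<open>\<partial>\<^sub>v f\<close> is the limit of integrals of difference quotients, translation moves the
  difference quotient onto the indicator function of the subgraph, and integration along the lines
  parallel to \<open>e\<close> turns the result into an integral of \<open>f (e \<bullet> v - \<partial>\<^sub>v \<Gamma>)\<close> over the graph
  (\<open>subgraph_integral_directional_derivative\<close>). The density \<open>sqrt (1 + |\<nabla>\<Gamma>|\<^sup>2)\<close> of the surface measure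
  cancels against the denominator of the normal. Only the partial derivatives of \<open>\<Gamma>\<close> almost
  everywhere enter, and these come from the one-dimensional theorem of Lebesgue on the
  differentiability of Lipschitz functions, proved by Vitali covering
  (\<open>lipschitz_AE_directionally_differentiable\<close>).
\<close>

section \<open>Slopes of Lipschitz functions\<close>

text \<open>
  Cover almost all of \<open>E\<close> by disjoint short intervals on which the slope is below \<open>p\<close>, inside an
  open set only slightly larger than \<open>E\<close> (Vitali). The images of these intervals have total length at
  most \<open>p\<close> times the measure of that open set, and the uncovered part of \<open>E\<close> has a null image since
  \<open>F\<close> is Lipschitz.
\<close>

lemma measure_image_le_of_small_slopes:
  fixes F :: "real \<Rightarrow> real"
  assumes mono: "strict_mono F" and lip: "L-lipschitz_on UNIV F"
    and E: "E \<in> lmeasurable" and FE: "F ` E \<in> lmeasurable" and "0 < p"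
    and slopes: "\<And>x d. x \<in> E \<Longrightarrow> 0 < d \<Longrightarrow>
       \<exists>a b. a < b \<and> a \<le> x \<and> x \<le> b \<and> b - a < d \<and> F b - F a < p * (b - a)"
  shows "measure lebesgue (F ` E) \<le> p * measure lebesgue E"
proof (rule field_le_epsilon)
  fix \<epsilon> :: real assume "0 < \<epsilon>"
  have contF: "continuous_on S F" for S
    using lip lipschitz_on_continuous_on continuous_on_subset by blast
  obtain G where G: "open G" "E \<subseteq> G" "G - E \<in> lmeasurable" "emeasure lebesgue (G - E) < ennreal (\<epsilon> / p)"
    using sets_lebesgue_outer_open[of E "\<epsilon> / p"] E \<open>0 < \<epsilon>\<close> \<open>0 < p\<close> by (auto dest: fmeasurableD)
  have "G = E \<union> (G - E)" using G by auto
  then have G_meas: "G \<in> lmeasurable" using E G(3) by (metis fmeasurable.Un)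
  have "measure lebesgue (G - E) < \<epsilon> / p"
    using G(3,4) \<open>0 < \<epsilon>\<close> \<open>0 < p\<close> by (simp add: emeasure_eq_measure2 ennreal_less_iff)
  moreover have "measure lebesgue (G - E) = measure lebesgue G - measure lebesgue E"
    using E G G_meas by (simp add: measurable_measure_Diff fmeasurableD)
  ultimately have G_small: "measure lebesgue G < measure lebesgue E + \<epsilon> / p" by simp
  define K where "K = {z. fst z < snd z \<and> {fst z..snd z} \<subseteq> G \<and> F (snd z) - F (fst z) < p * (snd z - fst z)}"
  define mid where "mid z = (fst z + snd z) / 2" for z :: "real \<times> real"
  define rad where "rad z = (snd z - fst z) / 2" for z :: "real \<times> real"
  have ball_eq: "cball (mid z) (rad z) = {fst z..snd z}" for z
    by (auto simp: mid_def rad_def cball_def dist_real_def abs_le_iff field_simps)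
  have cover: "\<exists>z. z \<in> K \<and> x \<in> cball (mid z) (rad z) \<and> rad z < d"
    if xE: "x \<in> E" and d: "0 < d" for x d
  proof -
    have "\<exists>\<delta>>0. cball x \<delta> \<subseteq> G"
      using G(1) subsetD[OF G(2) xE] unfolding open_contains_cball by blast
    then obtain \<delta> where \<delta>: "0 < \<delta>" "cball x \<delta> \<subseteq> G" by blast
    obtain a b where ab: "a < b" "a \<le> x" "x \<le> b" "b - a < min d \<delta>" "F b - F a < p * (b - a)"
      using slopes[OF xE, of "min d \<delta>"] d \<delta> by auto
    have "{a..b} \<subseteq> cball x \<delta>" using ab by (auto simp: dist_real_def)
    then have "(a, b) \<in> K" using ab \<delta> by (auto simp: K_def)
    moreover have "x \<in> cball (mid (a, b)) (rad (a, b))" using ab by (simp add: ball_eq)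
    moreover have "rad (a, b) < d" using ab by (simp add: rad_def)
    ultimately show ?thesis by blast
  qed
  obtain C where C: "countable C" "C \<subseteq> K"
     "pairwise (\<lambda>i j. disjnt (cball (mid i) (rad i)) (cball (mid j) (rad j))) C"
     "negligible (E - (\<Union>i\<in>C. cball (mid i) (rad i)))"
    by (rule Vitali_covering_theorem_cballs[of K rad E mid, OF _ cover]) (auto simp: K_def rad_def)
  let ?I = "\<lambda>z. {fst z..snd z}"
  let ?J = "\<lambda>z. {F (fst z)..F (snd z)}"
  have image_I: "F ` ?I z = ?J z" if "z \<in> K" for z
  proof -
    have "fst z \<le> snd z" using that by (simp add: K_def)
    show ?thesis
    proof (intro equalityI subsetI)
      fix y assume "y \<in> ?J z"
      then obtain x where "fst z \<le> x" "x \<le> snd z" "F x = y"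
        using IVT'[of F "fst z" y "snd z"] \<open>fst z \<le> snd z\<close> contF by auto
      then show "y \<in> F ` ?I z" by auto
    qed (use mono in \<open>auto simp: strict_mono_less_eq\<close>)
  qed
  have disj: "disjoint_family_on ?I C"
    using C(3) by (auto simp: disjoint_family_on_def pairwise_def disjnt_def ball_eq)
  have disjJ: "disjoint_family_on ?J C"
    unfolding disjoint_family_on_def
  proof (intro ballI impI)
    fix y z assume yz: "y \<in> C" "z \<in> C" "y \<noteq> z"
    then have "?I y \<inter> ?I z = {}" using disj by (auto simp: disjoint_family_on_def)
    then have "F ` ?I y \<inter> F ` ?I z = {}"
      using image_Int[OF strict_mono_imp_inj_on[OF mono]] by (metis image_empty)
    then show "?J y \<inter> ?J z = {}" using image_I[of y] image_I[of z] yz C(2) by (metis subsetD)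
  qed
  have null: "negligible (F ` (E - (\<Union>z\<in>C. ?I z)))"
  proof (rule negligible_locally_Lipschitz_image)
    show "negligible (E - (\<Union>z\<in>C. ?I z))" using C(4) by (simp add: ball_eq)
    fix x
    show "\<exists>T B. open T \<and> x \<in> T \<and> (\<forall>y\<in>(E - (\<Union>z\<in>C. ?I z)) \<inter> T. norm (F y - F x) \<le> B * norm (y - x))"
      using lipschitz_onD[OF lip] by (intro exI[of _ UNIV] exI[of _ L]) (auto simp: dist_norm)
  qed simp
  have sub: "F ` E \<subseteq> F ` (E - (\<Union>z\<in>C. ?I z)) \<union> (\<Union>z\<in>C. ?J z)"
    using image_I C(2) by blast
  have "emeasure lebesgue (F ` E) \<le> emeasure lebesgue (F ` (E - (\<Union>z\<in>C. ?I z)) \<union> (\<Union>z\<in>C. ?J z))"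
    using sub null C(1) by (intro emeasure_mono sets.Un sets.countable_UN' negligible_imp_sets) auto
  also have "\<dots> \<le> emeasure lebesgue (F ` (E - (\<Union>z\<in>C. ?I z))) + emeasure lebesgue (\<Union>z\<in>C. ?J z)"
    using null C(1) by (intro emeasure_subadditive sets.countable_UN' negligible_imp_sets) auto
  also have "\<dots> = emeasure lebesgue (\<Union>z\<in>C. ?J z)"
    using null by (simp add: negligible_iff_null_sets null_setsD1)
  also have "\<dots> = (\<integral>\<^sup>+z. emeasure lebesgue (?J z) \<partial>count_space C)"
    using C(1) disjJ by (intro emeasure_UN_countable) auto
  also have "\<dots> \<le> (\<integral>\<^sup>+z. ennreal p * emeasure lebesgue (?I z) \<partial>count_space C)"
  proof (rule nn_integral_mono)
    fix z assume "z \<in> space (count_space C)"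
    then have z: "fst z < snd z" "F (snd z) - F (fst z) < p * (snd z - fst z)" using C(2) by (auto simp: K_def)
    then show "emeasure lebesgue (?J z) \<le> ennreal p * emeasure lebesgue (?I z)"
      using \<open>0 < p\<close> mono by (auto simp: strict_mono_def less_imp_le ennreal_mult[symmetric] intro!: ennreal_leI)
  qed
  also have "\<dots> = ennreal p * (\<integral>\<^sup>+z. emeasure lebesgue (?I z) \<partial>count_space C)"
    by (rule nn_integral_cmult) simp
  also have "(\<integral>\<^sup>+z. emeasure lebesgue (?I z) \<partial>count_space C) = emeasure lebesgue (\<Union>z\<in>C. ?I z)"
    using C(1) disj by (intro emeasure_UN_countable[symmetric]) auto
  also have "\<dots> \<le> emeasure lebesgue G"
    using C(2) G_meas by (intro emeasure_mono) (auto simp: K_def)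
  finally have "ennreal (measure lebesgue (F ` E)) \<le> ennreal (p * measure lebesgue G)"
    using G_meas FE \<open>0 < p\<close> by (simp add: emeasure_eq_measure2 ennreal_mult mult_left_mono)
  then have "measure lebesgue (F ` E) \<le> p * measure lebesgue G"
    using \<open>0 < p\<close> by (simp add: ennreal_le_iff)
  also have "\<dots> \<le> p * (measure lebesgue E + \<epsilon> / p)"
    using G_small \<open>0 < p\<close> by (intro mult_left_mono) auto
  also have "\<dots> = p * measure lebesgue E + \<epsilon>"
    using \<open>0 < p\<close> by (simp add: distrib_left)
  finally show "measure lebesgue (F ` E) \<le> p * measure lebesgue E + \<epsilon>" .
qed


text \<open>
  The condition that the lower derivative of \<open>f\<close> at \<open>x\<close> in the direction \<open>v\<close> is below \<open>p\<close>, up to the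
  boundary case. The upper derivative is treated by passing to \<open>- f\<close>.
\<close>

definition slope_below :: "('a::real_normed_vector \<Rightarrow> real) \<Rightarrow> 'a \<Rightarrow> real \<Rightarrow> 'a set" where
  "slope_below f v p = {x. \<forall>d>0. \<exists>h. h \<noteq> 0 \<and> \<bar>h\<bar> < d \<and> (f (x + h *\<^sub>R v) - f x) / h < p}"

text \<open>
  Each \<open>d\<close> contributes a union of open sets over all admissible step sizes \<open>h\<close>; this union is open
  although it is uncountable.
\<close>

lemma borel_slope_below:
  assumes "continuous_on UNIV f"
  shows "slope_below f v p \<in> sets borel"
proof -
  define O' where "O' d = (\<Union>h\<in>{h. h \<noteq> 0 \<and> \<bar>h\<bar> < d}. {x. (f (x + h *\<^sub>R v) - f x) / h < p})" for d :: real
  have "open (O' d)" for d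
    unfolding O'_def using assms
    by (intro open_UN ballI open_Collect_less continuous_intros continuous_on_compose2[OF assms]) auto
  then have "(\<Inter>n::nat. O' (inverse (Suc n))) \<in> sets borel"
    by (intro sets.countable_INT) auto
  moreover have "slope_below f v p = (\<Inter>n::nat. O' (inverse (Suc n)))"
  proof (intro equalityI subsetI)
    fix x assume "x \<in> slope_below f v p"
    then show "x \<in> (\<Inter>n::nat. O' (inverse (Suc n)))"
      unfolding slope_below_def O'_def by (auto dest: spec[where x="inverse (Suc _)"])
  next
    fix x assume x: "x \<in> (\<Inter>n::nat. O' (inverse (Suc n)))"
    show "x \<in> slope_below f v p"
      unfolding slope_below_def
    proof (intro CollectI allI impI)
      fix d :: real assume "0 < d"
      then obtain n where n: "inverse (real (Suc n)) < d" using reals_Archimedean by auto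
      from x have "x \<in> O' (inverse (Suc n))" by blast
      then obtain h where "h \<noteq> 0" "\<bar>h\<bar> < inverse (Suc n)" "(f (x + h *\<^sub>R v) - f x) / h < p"
        by (auto simp: O'_def)
      with n show "\<exists>h. h \<noteq> 0 \<and> \<bar>h\<bar> < d \<and> (f (x + h *\<^sub>R v) - f x) / h < p"
        by (intro exI[of _ h]) auto
    qed
  qed
  ultimately show ?thesis by simp
qed

lemma slope_belowE_interval:
  fixes f :: "real \<Rightarrow> real"
  assumes "x \<in> slope_below f 1 p" "0 < d"
  obtains a b where "a < b" "a \<le> x" "x \<le> b" "b - a < d" "f b - f a < p * (b - a)"
proof -
  obtain h where h: "h \<noteq> 0" "\<bar>h\<bar> < d" "(f (x + h) - f x) / h < p"
    using assms by (auto simp: slope_below_def)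
  show thesis
  proof (cases "0 < h")
    case True
    then show ?thesis using h that[of x "x + h"] by (auto simp: field_simps)
  next
    case False
    then have "h < 0" using h by simp
    then show ?thesis using h that[of "x + h" x] by (auto simp: field_simps)
  qed
qed

text \<open>
  Adding a linear function makes \<open>f\<close> a bi-Lipschitz increasing bijection \<open>F\<close>. On the set \<open>E\<close> of points
  with lower derivative below \<open>p\<close> and upper derivative above \<open>q\<close>, the covering estimate for \<open>F\<close> bounds the
  measure of \<open>F ` E\<close> by \<open>p + L + 1\<close> times that of \<open>E\<close>. The same estimate for the inverse of \<open>F\<close>, whose
  slopes are reciprocal, bounds it from below by \<open>q + L + 1\<close> times that of \<open>E\<close>. So \<open>E\<close> is null.
\<close>

lemma negligible_slope_gap:
  fixes f :: "real \<Rightarrow> real"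
  assumes lip: "L-lipschitz_on UNIV f" and "p < q"
  shows "negligible (slope_below f 1 p \<inter> slope_below (\<lambda>x. - f x) 1 (- q))"
proof (subst negligible_on_intervals, intro allI)
  fix l r :: real
  define E where "E = slope_below f 1 p \<inter> slope_below (\<lambda>x. - f x) 1 (- q) \<inter> cbox l r"
  \<comment> \<open>With the slope \<open>L + 1\<close> added, all difference quotients of \<open>F\<close> lie between \<open>1\<close> and \<open>2 L + 1\<close>.\<close>
  define F where "F x = f x + (L + 1) * x" for x
  have L: "0 \<le> L" using lip lipschitz_on_nonneg by blast
  have fL: "\<bar>f y - f x\<bar> \<le> L * \<bar>y - x\<bar>" for x y
    using lipschitz_onD[OF lip, of y x] by (simp add: dist_real_def)
  have F_ge: "y - x \<le> F y - F x" if "x \<le> y" for x y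
    using fL[of y x] that by (simp add: F_def algebra_simps abs_le_iff)
  have F_le: "\<bar>F y - F x\<bar> \<le> (2 * L + 1) * \<bar>y - x\<bar>" for x y
  proof -
    have "F y - F x = (f y - f x) + (L + 1) * (y - x)" by (simp add: F_def algebra_simps)
    then have "\<bar>F y - F x\<bar> \<le> \<bar>f y - f x\<bar> + \<bar>(L + 1) * (y - x)\<bar>" by linarith
    also have "\<bar>(L + 1) * (y - x)\<bar> = (L + 1) * \<bar>y - x\<bar>" using L by (simp add: abs_mult)
    finally show ?thesis using fL[of y x] by (simp add: algebra_simps)
  qed
  have mono: "strict_mono F"
    by (rule strict_monoI) (use F_ge in \<open>smt (verit)\<close>)
  have lipF: "(2 * L + 1)-lipschitz_on UNIV F"
    using F_le L by (intro lipschitz_onI) (auto simp: dist_real_def)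
  have contf: "continuous_on UNIV f" using lip lipschitz_on_continuous_on by blast
  have contF: "continuous_on UNIV F" using lipF lipschitz_on_continuous_on by blast
  have surjF: "\<exists>x. F x = y" for y
  proof -
    define B where "B = \<bar>y\<bar> + \<bar>F 0\<bar>"
    have "F (- B) \<le> y" using F_ge[of "-B" 0] unfolding B_def by linarith
    moreover have "y \<le> F B" using F_ge[of 0 B] unfolding B_def by linarith
    moreover have "- B \<le> B" by (simp add: B_def)
    ultimately show ?thesis
      using IVT'[of F "-B" y B] contF continuous_on_subset by blast
  qed
  define H where "H = the_inv F"
  have injF: "inj F" using mono strict_mono_imp_inj_on by blast
  have HF: "H (F x) = x" for x unfolding H_def by (rule the_inv_f_f[OF injF])
  have FH: "F (H y) = y" for y using surjF[of y] HF by auto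
  have H_mono: "strict_mono H"
  proof (rule strict_monoI)
    fix x y :: real assume "x < y"
    then show "H x < H y" using FH mono by (metis linorder_not_less strict_mono_less_eq)
  qed
  have H_le: "H y - H x \<le> y - x" if "x \<le> y" for x y
    using F_ge[of "H x" "H y"] that FH H_mono by (simp add: strict_mono_less_eq)
  have lipH: "1-lipschitz_on UNIV H"
    by (rule lipschitz_onI)
      (use H_le H_mono in \<open>auto simp: dist_real_def abs_le_iff strict_mono_less_eq\<close>, 
       (smt (verit) H_le H_mono strict_mono_less_eq)+)
  have E_borel: "E \<in> sets borel"
    unfolding E_def using contf by (intro sets.Int borel_slope_below continuous_intros) auto
  have FE_eq: "F ` E = H -` E" using FH HF by (auto simp: image_iff) metis
  have FE_borel: "F ` E \<in> sets borel"
    unfolding FE_eq using E_borel lipschitz_on_continuous_on[OF lipH]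
    by (metis borel_measurable_continuous_onI measurable_sets_borel)
  have "bounded E" by (rule bounded_subset[OF bounded_cbox[of l r]]) (auto simp: E_def)
  then have E_meas: "E \<in> lmeasurable" using E_borel
    by (intro bounded_set_imp_lmeasurable) auto
  have "bounded (F ` E)"
    using \<open>bounded E\<close> lipF bounded_uniformly_continuous_image lipschitz_on_uniformly_continuous
      lipschitz_on_subset by (metis subset_UNIV)
  then have FE_meas: "F ` E \<in> lmeasurable" using FE_borel
    by (intro bounded_set_imp_lmeasurable) auto
  show "negligible (slope_below f 1 p \<inter> slope_below (\<lambda>x. - f x) 1 (- q) \<inter> cbox l r)"
  proof (cases "E = {}")
    case True then show ?thesis by (simp add: E_def)
  next
    case False
    have slopes_p: "\<exists>a b. a < b \<and> a \<le> x \<and> x \<le> b \<and> b - a < d \<and> F b - F a < (p + L + 1) * (b - a)"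
      if "x \<in> E" "0 < d" for x d
    proof -
      from that(1) have "x \<in> slope_below f 1 p" by (simp add: E_def)
      from slope_belowE_interval[OF this that(2)] obtain a b where
        "a < b" "a \<le> x" "x \<le> b" "b - a < d" "f b - f a < p * (b - a)" by metis
      then show ?thesis by (intro exI[of _ a] exI[of _ b]) (simp add: F_def algebra_simps)
    qed
    have slopes_q: "\<exists>a b. a < b \<and> a \<le> y \<and> y \<le> b \<and> b - a < d \<and> H b - H a < inverse (q + L + 1) * (b - a)"
      if "y \<in> F ` E" "0 < d" "0 < q + L + 1" for y d
    proof -
      from that(1) obtain x where x: "x \<in> slope_below (\<lambda>x. - f x) 1 (- q)" "y = F x" by (auto simp: E_def)
      from that L have "0 < d / (2 * L + 1)" by simp
      from slope_belowE_interval[OF x(1) this] obtain a b where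
        ab: "a < b" "a \<le> x" "x \<le> b" "b - a < d / (2 * L + 1)" "- f b - - f a < - q * (b - a)" by metis
      have "F b - F a \<le> (2 * L + 1) * (b - a)" using F_le[of b a] ab by simp
      also have "\<dots> < d" using ab L by (simp add: field_simps)
      finally have "F b - F a < d" .
      moreover have "(q + L + 1) * (b - a) < F b - F a" using ab by (simp add: F_def algebra_simps)
      then have "b - a < inverse (q + L + 1) * (F b - F a)" using that(3) by (simp add: field_simps)
      moreover have "F a < F b" "F a \<le> y" "y \<le> F b"
        using ab x mono by (auto simp: strict_mono_less strict_mono_less_eq)
      ultimately show ?thesis by (intro exI[of _ "F a"] exI[of _ "F b"]) (simp add: HF)
    qed
    obtain x0 where "x0 \<in> E" using False by blast
    obtain a b where ab: "a < b" "F b - F a < (p + L + 1) * (b - a)"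
      using slopes_p[OF \<open>x0 \<in> E\<close> zero_less_one] by blast
    \<comment> \<open>Some slope of \<open>F\<close> is below \<open>p + L + 1\<close>, while all of them are at least one.\<close>
    have "\<not> p + L + 1 \<le> 1"
    proof
      assume "p + L + 1 \<le> 1"
      then have "(p + L + 1) * (b - a) \<le> 1 * (b - a)" using ab(1) by (intro mult_right_mono) auto
      also have "\<dots> \<le> F b - F a" using F_ge[OF less_imp_le[OF ab(1)]] by (simp only: mult_1)
      finally show False using ab(2) by (simp only: linorder_not_less)
    qed
    then have pos: "0 < p + L + 1" by simp
    then have posq: "0 < q + L + 1" using \<open>p < q\<close> by simp
    have le1: "measure lebesgue (F ` E) \<le> (p + L + 1) * measure lebesgue E"
      by (rule measure_image_le_of_small_slopes[OF mono lipF E_meas FE_meas pos slopes_p])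
    have HFE: "H ` F ` E = E" using HF by (simp add: image_image)
    have "measure lebesgue (H ` F ` E) \<le> inverse (q + L + 1) * measure lebesgue (F ` E)"
      by (rule measure_image_le_of_small_slopes[OF H_mono lipH FE_meas])
        (use HFE E_meas posq slopes_q in auto)
    then have "(q + L + 1) * measure lebesgue E \<le> measure lebesgue (F ` E)"
      using posq by (simp add: HFE field_simps)
    with le1 have "(q - p) * measure lebesgue E \<le> 0" by (simp add: algebra_simps)
    then have "measure lebesgue E = 0"
      using \<open>p < q\<close> measure_nonneg[of lebesgue E] by (smt (verit) mult_pos_pos)
    then show ?thesis
      using E_meas unfolding E_def by (simp only: negligible_iff_measure simp_thms)
  qed
qed

text \<open>
  The derivative is the infimum of all \<open>p\<close> that are undercut by slopes over arbitrarily short steps. Rational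
  \<open>p\<close> and \<open>q\<close> suffice, which later leaves only countably many null sets.
\<close>

lemma differentiable_line_of_no_slope_gap:
  fixes f :: "'a::real_normed_vector \<Rightarrow> real"
  assumes lip: "L-lipschitz_on UNIV f"
    and gap: "\<And>p q. p \<in> \<rat> \<Longrightarrow> q \<in> \<rat> \<Longrightarrow> p < q \<Longrightarrow> x \<notin> slope_below f v p \<inter> slope_below (\<lambda>x. - f x) v (- q)"
  shows "(\<lambda>h. f (x + h *\<^sub>R v)) differentiable (at 0)"
proof -
  define Q where "Q h = (f (x + h *\<^sub>R v) - f x) / h" for h
  have L: "0 \<le> L" using lip lipschitz_on_nonneg by blast
  have bound: "\<bar>Q h\<bar> \<le> L * norm v" if "h \<noteq> 0" for h
    using lipschitz_onD[OF lip, of "x + h *\<^sub>R v" x] that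
    by (simp add: Q_def dist_norm field_simps)
  define P where "P = {p. x \<in> slope_below f v p}"
  have not_P: "\<exists>d>0. \<forall>h. h \<noteq> 0 \<longrightarrow> \<bar>h\<bar> < d \<longrightarrow> p \<le> Q h" if "p \<notin> P" for p
    using that unfolding P_def slope_below_def Q_def by (auto simp: not_less) (meson not_less)
  have not_A: "\<exists>d>0. \<forall>h. h \<noteq> 0 \<longrightarrow> \<bar>h\<bar> < d \<longrightarrow> Q h \<le> q" if "x \<notin> slope_below (\<lambda>x. - f x) v (- q)" for q
  proof -
    have "(- f (x + h *\<^sub>R v) - - f x) / h = - Q h" for h by (simp add: Q_def diff_divide_distrib)
    then show ?thesis using that by (auto simp: slope_below_def not_less) (meson not_less)
  qed
  have up: "L * norm v + 1 \<in> P"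
    unfolding P_def slope_below_def
  proof (intro CollectI allI impI)
    fix d :: real assume "0 < d"
    then have "Q (d / 2) < L * norm v + 1" using bound[of "d / 2"] by linarith
    then show "\<exists>h. h \<noteq> 0 \<and> \<bar>h\<bar> < d \<and> (f (x + h *\<^sub>R v) - f x) / h < L * norm v + 1"
      using \<open>0 < d\<close> by (intro exI[of _ "d / 2"]) (simp add: Q_def)
  qed
  have lo: "- (L * norm v) \<le> p" if "p \<in> P" for p
  proof -
    from that obtain h where "h \<noteq> 0" "Q h < p"
      by (auto simp: P_def slope_below_def Q_def dest: spec[where x=1])
    then show ?thesis using bound[of h] by simp
  qed
  then have bdd: "bdd_below P" by (intro bdd_belowI) auto
  have upward: "q \<in> P" if "p \<in> P" "p \<le> q" for p q
    using that unfolding P_def slope_below_def by (smt (verit) mem_Collect_eq)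
  define s where "s = Inf P"
  have "(Q \<longlongrightarrow> s) (at 0)"
  proof (rule order_tendstoI)
    fix a assume "a < s"
    then obtain p where p: "a < p" "p < s" using dense by blast
    then have "p \<notin> P" using bdd cInf_lower[of p P] by (auto simp: s_def)
    then obtain d where "0 < d" "\<forall>h. h \<noteq> 0 \<longrightarrow> \<bar>h\<bar> < d \<longrightarrow> p \<le> Q h" using not_P by blast
    then show "\<forall>\<^sub>F h in at 0. a < Q h"
      unfolding eventually_at using p by (intro exI[of _ d]) force
  next
    fix a assume "s < a"
    then obtain p where p: "p \<in> P" "p < a" using up cInf_lessD[of P a] by (auto simp: s_def)
    obtain p' where p': "p' \<in> \<rat>" "p < p'" "p' < a" using Rats_dense_in_real p by blast
    obtain q where q: "q \<in> \<rat>" "p' < q" "q < a" using Rats_dense_in_real p' by blast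
    have "p' \<in> P" using upward p p' by auto
    then have "x \<notin> slope_below (\<lambda>x. - f x) v (- q)" using gap[of p' q] p' q by (auto simp: P_def)
    then obtain d where "0 < d" "\<forall>h. h \<noteq> 0 \<longrightarrow> \<bar>h\<bar> < d \<longrightarrow> Q h \<le> q" using not_A by blast
    then show "\<forall>\<^sub>F h in at 0. Q h < a"
      unfolding eventually_at using q by (intro exI[of _ d]) force
  qed
  then have "((\<lambda>h. f (x + h *\<^sub>R v)) has_real_derivative s) (at 0)"
    unfolding DERIV_def Q_def by simp
  then show ?thesis using real_differentiable_def by blast
qed

section \<open>Integration along parallel lines\<close>

lemma nn_integral_lborel_translate:
  fixes f :: "'a::euclidean_space \<Rightarrow> ennreal"
  assumes [measurable]: "f \<in> borel_measurable borel"
  shows "(\<integral>\<^sup>+x. f (x + c) \<partial>lborel) = (\<integral>\<^sup>+x. f x \<partial>lborel)"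
proof -
  have "(\<integral>\<^sup>+x. f x \<partial>lborel) = (\<integral>\<^sup>+x. f x \<partial>distr lborel borel ((+) c))"
    by (simp add: lborel_distr_plus)
  also have "\<dots> = (\<integral>\<^sup>+x. f (c + x) \<partial>lborel)"
    by (rule nn_integral_distr) auto
  finally show ?thesis by (simp add: add.commute)
qed

lemma integral_lborel_translate:
  fixes f :: "'a::euclidean_space \<Rightarrow> real"
  assumes [measurable]: "f \<in> borel_measurable borel"
  shows "(\<integral>x. f (x + c) \<partial>lborel) = (\<integral>x. f x \<partial>lborel)"
proof -
  have "(\<integral>x. f x \<partial>lborel) = (\<integral>x. f x \<partial>distr lborel borel ((+) c))"
    by (simp add: lborel_distr_plus)
  also have "\<dots> = (\<integral>x. f (c + x) \<partial>lborel)"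
    by (rule integral_distr) auto
  finally show ?thesis by (simp add: add.commute)
qed

lemma nn_integral_unit_window:
  "(\<integral>\<^sup>+t. indicator {0..1} (r - t) \<partial>lborel) = (1 :: ennreal)" for r :: real
proof -
  have "indicator {0..1} (r - t) = (indicator {r - 1..r} t :: ennreal)" for t
    by (auto simp: indicator_def)
  then show ?thesis by simp
qed

text \<open>
  Fubini for the foliation by lines parallel to \<open>e\<close>, without a choice of coordinates: a slab of
  thickness one meets each such line in a unit segment, so that integrating over the slab counts each
  line once. After exchanging the integrals and translating, the claim is that the unit window has
  integral one.
\<close>

lemma nn_integral_slab:
  fixes f :: "'a::euclidean_space \<Rightarrow> ennreal"
  assumes e: "norm e = 1" and [measurable]: "f \<in> borel_measurable borel"
  shows "(\<integral>\<^sup>+x. indicator {0..1} (x \<bullet> e) * (\<integral>\<^sup>+t. f (x + t *\<^sub>R e) \<partial>lborel) \<partial>lborel) = (\<integral>\<^sup>+x. f x \<partial>lborel)"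
proof -
  have ee: "e \<bullet> e = 1" using e by (simp add: norm_eq_1)
  have "(\<integral>\<^sup>+x. indicator {0..1} (x \<bullet> e) * (\<integral>\<^sup>+t. f (x + t *\<^sub>R e) \<partial>lborel) \<partial>lborel)
      = (\<integral>\<^sup>+x. (\<integral>\<^sup>+t. indicator {0..1} (x \<bullet> e) * f (x + t *\<^sub>R e) \<partial>lborel) \<partial>lborel)"
    by (intro nn_integral_cong) (simp add: nn_integral_cmult)
  also have "\<dots> = (\<integral>\<^sup>+t. (\<integral>\<^sup>+x. indicator {0..1} (x \<bullet> e) * f (x + t *\<^sub>R e) \<partial>lborel) \<partial>lborel)"
    by (intro lborel_pair.Fubini'[symmetric]) simp
  also have "\<dots> = (\<integral>\<^sup>+t. (\<integral>\<^sup>+x. indicator {0..1} (x \<bullet> e - t) * f x \<partial>lborel) \<partial>lborel)"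
  proof (rule nn_integral_cong)
    fix t :: real
    show "(\<integral>\<^sup>+x. indicator {0..1} (x \<bullet> e) * f (x + t *\<^sub>R e) \<partial>lborel)
        = (\<integral>\<^sup>+x. indicator {0..1} (x \<bullet> e - t) * f x \<partial>lborel)"
      by (subst nn_integral_lborel_translate[symmetric, where c="t *\<^sub>R e"])
        (simp_all add: inner_add_left ee)
  qed
  also have "\<dots> = (\<integral>\<^sup>+x. (\<integral>\<^sup>+t. f x * indicator {0..1} (x \<bullet> e - t) \<partial>lborel) \<partial>lborel)"
    by (subst lborel_pair.Fubini') (simp_all add: mult.commute)
  also have "\<dots> = (\<integral>\<^sup>+x. f x \<partial>lborel)"
    by (intro nn_integral_cong) (simp add: nn_integral_cmult nn_integral_unit_window)
  finally show ?thesis .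
qed

lemma integral_slab:
  fixes f :: "'a::euclidean_space \<Rightarrow> real"
  assumes e: "norm e = 1" and f: "integrable lborel f"
  shows "(\<integral>x. f x \<partial>lborel) = (\<integral>x. indicator {0..1} (x \<bullet> e) * (\<integral>t. f (x + t *\<^sub>R e) \<partial>lborel) \<partial>lborel)"
    and "(\<lambda>x. indicator {0..1} (x \<bullet> e) * (\<integral>t. f (x + t *\<^sub>R e) \<partial>lborel)) \<in> borel_measurable lborel"
proof -
  have [measurable]: "f \<in> borel_measurable borel" using borel_measurable_integrable[OF f] by simp
  have ee: "e \<bullet> e = 1" using e by (simp add: norm_eq_1)
  show "(\<lambda>x. indicator {0..1} (x \<bullet> e) * (\<integral>t. f (x + t *\<^sub>R e) \<partial>lborel)) \<in> borel_measurable lborel"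
    by measurable
  have fin: "(\<integral>\<^sup>+x. ennreal (norm (f x)) \<partial>lborel) < \<infinity>"
    using f by (simp add: integrable_iff_bounded)
  have int1: "integrable (lborel \<Otimes>\<^sub>M lborel) (\<lambda>(x, t). indicator {0..1} (x \<bullet> e) * f (x + t *\<^sub>R e))"
  proof (rule integrableI_bounded)
    have "(\<integral>\<^sup>+z. ennreal (norm (case z of (x, t) \<Rightarrow> indicator {0..1} (x \<bullet> e) * f (x + t *\<^sub>R e))) \<partial>(lborel \<Otimes>\<^sub>M lborel))
      = (\<integral>\<^sup>+x. (\<integral>\<^sup>+t. indicator {0..1} (x \<bullet> e) * ennreal (norm (f (x + t *\<^sub>R e))) \<partial>lborel) \<partial>lborel)"
      by (subst lborel.nn_integral_fst[symmetric])
        (auto simp: indicator_def intro!: nn_integral_cong)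
    also have "\<dots> = (\<integral>\<^sup>+x. indicator {0..1} (x \<bullet> e) * (\<integral>\<^sup>+t. ennreal (norm (f (x + t *\<^sub>R e))) \<partial>lborel) \<partial>lborel)"
      by (intro nn_integral_cong) (simp add: nn_integral_cmult)
    also have "\<dots> = (\<integral>\<^sup>+x. ennreal (norm (f x)) \<partial>lborel)"
      using e by (intro nn_integral_slab) auto
    finally show "(\<integral>\<^sup>+z. ennreal (norm (case z of (x, t) \<Rightarrow> indicator {0..1} (x \<bullet> e) * f (x + t *\<^sub>R e))) \<partial>(lborel \<Otimes>\<^sub>M lborel)) < \<infinity>"
      using fin by simp
  qed measurable
  have int2: "integrable (lborel \<Otimes>\<^sub>M lborel) (\<lambda>(x, t). indicator {0..1} (x \<bullet> e - t) * f x)"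
  proof (rule integrableI_bounded)
    have "(\<integral>\<^sup>+z. ennreal (norm (case z of (x, t) \<Rightarrow> indicator {0..1} (x \<bullet> e - t) * f x)) \<partial>(lborel \<Otimes>\<^sub>M lborel))
      = (\<integral>\<^sup>+x. (\<integral>\<^sup>+t. ennreal (norm (f x)) * indicator {0..1} (x \<bullet> e - t) \<partial>lborel) \<partial>lborel)"
      by (subst lborel.nn_integral_fst[symmetric])
        (auto simp: indicator_def intro!: nn_integral_cong)
    also have "\<dots> = (\<integral>\<^sup>+x. ennreal (norm (f x)) \<partial>lborel)"
      by (intro nn_integral_cong) (simp add: nn_integral_cmult nn_integral_unit_window)
    finally show "(\<integral>\<^sup>+z. ennreal (norm (case z of (x, t) \<Rightarrow> indicator {0..1} (x \<bullet> e - t) * f x)) \<partial>(lborel \<Otimes>\<^sub>M lborel)) < \<infinity>"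
      using fin by simp
  qed measurable
  have window: "(\<integral>t. indicator {0..1} (r - t) \<partial>lborel) = (1 :: real)" for r :: real
  proof -
    have "indicator {0..1} (r - t) = (indicator {r - 1..r} t :: real)" for t
      by (auto simp: indicator_def)
    then show ?thesis by simp
  qed
  have "(\<integral>x. indicator {0..1} (x \<bullet> e) * (\<integral>t. f (x + t *\<^sub>R e) \<partial>lborel) \<partial>lborel)
      = (\<integral>x. (\<integral>t. indicator {0..1} (x \<bullet> e) * f (x + t *\<^sub>R e) \<partial>lborel) \<partial>lborel)"
    by simp
  also have "\<dots> = (\<integral>t. (\<integral>x. indicator {0..1} (x \<bullet> e) * f (x + t *\<^sub>R e) \<partial>lborel) \<partial>lborel)"
    by (rule lborel_pair.Fubini_integral[symmetric]) (rule int1)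
  also have "\<dots> = (\<integral>t. (\<integral>x. indicator {0..1} (x \<bullet> e - t) * f x \<partial>lborel) \<partial>lborel)"
  proof (rule Bochner_Integration.integral_cong)
    fix t :: real
    show "(\<integral>x. indicator {0..1} (x \<bullet> e) * f (x + t *\<^sub>R e) \<partial>lborel)
        = (\<integral>x. indicator {0..1} (x \<bullet> e - t) * f x \<partial>lborel)"
      by (subst integral_lborel_translate[symmetric, where c="t *\<^sub>R e"])
        (simp_all add: inner_add_left ee)
  qed simp
  also have "\<dots> = (\<integral>x. (\<integral>t. indicator {0..1} (x \<bullet> e - t) * f x \<partial>lborel) \<partial>lborel)"
    by (rule lborel_pair.Fubini_integral) (rule int2)
  also have "\<dots> = (\<integral>x. f x \<partial>lborel)"
    by (simp add: window)
  finally show "(\<integral>x. f x \<partial>lborel) = (\<integral>x. indicator {0..1} (x \<bullet> e) * (\<integral>t. f (x + t *\<^sub>R e) \<partial>lborel) \<partial>lborel)" ..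
qed

section \<open>Directional derivatives of Lipschitz functions\<close>

text \<open>
  On every line the exceptional set is a countable union of the null sets of \<open>negligible_slope_gap\<close>;
  integration along the lines parallel to \<open>v\<close> makes it null in the whole space.
\<close>

lemma lipschitz_AE_directionally_differentiable:
  fixes f :: "'a::euclidean_space \<Rightarrow> real"
  assumes lip: "L-lipschitz_on UNIV f" and v: "norm v = 1"
  shows "AE x in lborel. (\<lambda>h. f (x + h *\<^sub>R v)) differentiable (at 0)"
proof -
  define S where "S p q = slope_below f v p \<inter> slope_below (\<lambda>x. - f x) v (- q)" for p q
  have contf: "continuous_on UNIV f" using lip lipschitz_on_continuous_on by blast
  have S_borel: "S p q \<in> sets borel" for p q
    unfolding S_def using contf by (intro sets.Int borel_slope_below continuous_intros)
  have S_null: "S p q \<in> null_sets lborel" if "p < q" for p q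
  proof -
    have "emeasure lborel (S p q) = (\<integral>\<^sup>+x. indicator (S p q) x \<partial>lborel)"
      using S_borel by simp
    also have "\<dots> = (\<integral>\<^sup>+x. indicator {0..1} (x \<bullet> v) *
        (\<integral>\<^sup>+t. indicator (S p q) (x + t *\<^sub>R v) \<partial>lborel) \<partial>lborel)"
      using S_borel by (intro nn_integral_slab[OF v, symmetric]) auto
    also have "\<dots> = (\<integral>\<^sup>+x. 0 \<partial>(lborel :: 'a measure))"
    proof (rule nn_integral_cong)
      fix x :: 'a
      define g where "g t = f (x + t *\<^sub>R v)" for t
      have lipg: "L-lipschitz_on UNIV g"
      proof (rule lipschitz_onI)
        fix s t :: real
        show "dist (g s) (g t) \<le> L * dist s t"
          using lipschitz_onD[OF lip, of "x + s *\<^sub>R v" "x + t *\<^sub>R v"] v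
          by (simp add: g_def dist_norm scaleR_left_diff_distrib[symmetric])
      qed (use lip lipschitz_on_nonneg in blast)
      have line: "x + t *\<^sub>R v \<in> S p q \<longleftrightarrow> t \<in> slope_below g 1 p \<inter> slope_below (\<lambda>x. - g x) 1 (- q)" for t
        unfolding S_def slope_below_def g_def by (simp add: algebra_simps)
      have "negligible {t. x + t *\<^sub>R v \<in> S p q}"
        using negligible_slope_gap[OF lipg \<open>p < q\<close>] unfolding line by (simp add: Int_def)
      moreover have "{t. x + t *\<^sub>R v \<in> S p q} \<in> sets borel"
      proof -
        have "{t. x + t *\<^sub>R v \<in> S p q} = (\<lambda>t. x + t *\<^sub>R v) -` S p q" by auto
        moreover have "(\<lambda>t::real. x + t *\<^sub>R v) \<in> borel_measurable borel" by simp
        ultimately show ?thesis using S_borel by (metis measurable_sets_borel)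
      qed
      ultimately have "emeasure lborel {t. x + t *\<^sub>R v \<in> S p q} = 0"
        by (simp add: negligible_iff_null_sets null_sets_completion_iff null_setsD1)
      moreover have "(\<integral>\<^sup>+t. indicator (S p q) (x + t *\<^sub>R v) \<partial>lborel)
          = (\<integral>\<^sup>+t. indicator {t. x + t *\<^sub>R v \<in> S p q} t \<partial>lborel)"
        by (intro nn_integral_cong) (simp add: indicator_def)
      ultimately have "(\<integral>\<^sup>+t. indicator (S p q) (x + t *\<^sub>R v) \<partial>lborel) = 0"
        using \<open>{t. x + t *\<^sub>R v \<in> S p q} \<in> sets borel\<close> by simp
      then show "indicator {0..1} (x \<bullet> v) * (\<integral>\<^sup>+t. indicator (S p q) (x + t *\<^sub>R v) \<partial>lborel) = 0"
        by simp
    qed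
    finally show ?thesis using S_borel by (auto intro: null_setsI)
  qed
  define Q where "Q = {z \<in> \<rat> \<times> \<rat>. fst z < (snd z :: real)}"
  have "countable Q" unfolding Q_def using countable_rat by (auto intro: countable_subset[of _ "\<rat> \<times> \<rat>"])
  moreover have "AE x in lborel. x \<notin> S (fst z) (snd z)" if "z \<in> Q" for z
    using S_null[of "fst z" "snd z"] that by (auto simp: Q_def intro: AE_not_in)
  ultimately have "AE x in lborel. \<forall>z\<in>Q. x \<notin> S (fst z) (snd z)"
    by (simp add: AE_ball_countable)
  then show ?thesis
  proof eventually_elim
    fix x assume x: "\<forall>z\<in>Q. x \<notin> S (fst z) (snd z)"
    show "(\<lambda>h. f (x + h *\<^sub>R v)) differentiable (at 0)"
    proof (rule differentiable_line_of_no_slope_gap[OF lip])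
      fix p q :: real assume "p \<in> \<rat>" "q \<in> \<rat>" "p < q"
      then have "(p, q) \<in> Q" by (auto simp: Q_def)
      with x show "x \<notin> slope_below f v p \<inter> slope_below (\<lambda>x. - f x) v (- q)"
        by (force simp: S_def)
    qed
  qed
qed

text \<open>
  A Borel version of the derivative, needed as the pointwise \<^const>\<open>deriv\<close> is arbitrary where the
  function is not differentiable.
\<close>

lemma lipschitz_directional_derivative_borel:
  fixes f :: "'a::euclidean_space \<Rightarrow> real"
  assumes lip: "L-lipschitz_on UNIV f" and v: "norm v = 1"
  obtains g where "g \<in> borel_measurable borel"
    "AE x in lborel. ((\<lambda>h. f (x + h *\<^sub>R v)) has_real_derivative g x) (at 0)"
    "AE x in lborel. \<bar>g x\<bar> \<le> L"
proof
  define h where "h k = inverse (real (Suc k))" for k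
  define g where "g x = lim (\<lambda>k. (f (x + h k *\<^sub>R v) - f x) / h k)" for x
  have contf: "continuous_on UNIV f" using lip lipschitz_on_continuous_on by blast
  have [measurable]: "f \<in> borel_measurable borel"
    using contf by (rule borel_measurable_continuous_onI)
  show "g \<in> borel_measurable borel"
    unfolding g_def by measurable
  have h_lim: "filterlim h (at 0) sequentially"
    unfolding filterlim_at h_def using LIMSEQ_inverse_real_of_nat by auto
  have *: "((\<lambda>h. f (x + h *\<^sub>R v)) has_real_derivative g x) (at 0) \<and> \<bar>g x\<bar> \<le> L"
    if diff: "(\<lambda>h. f (x + h *\<^sub>R v)) differentiable (at 0)" for x
  proof -
    obtain D where D: "((\<lambda>h. f (x + h *\<^sub>R v)) has_real_derivative D) (at 0)"
      using diff real_differentiable_def by blast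
    then have "((\<lambda>h. (f (x + h *\<^sub>R v) - f x) / h) \<longlongrightarrow> D) (at 0)"
      unfolding DERIV_def by simp
    then have lim: "(\<lambda>k. (f (x + h k *\<^sub>R v) - f x) / h k) \<longlonglongrightarrow> D"
      using h_lim by (rule filterlim_compose)
    then have "g x = D" unfolding g_def by (rule limI)
    moreover have "\<bar>(f (x + h k *\<^sub>R v) - f x) / h k\<bar> \<le> L" for k
      using lipschitz_onD[OF lip, of "x + h k *\<^sub>R v" x] v
      by (simp add: dist_norm h_def abs_mult divide_inverse mult.commute) (simp add: field_simps)
    then have "\<bar>D\<bar> \<le> L"
      using tendsto_rabs[OF lim] by (intro LIMSEQ_le_const2[of _ "\<bar>D\<bar>"]) auto
    ultimately show ?thesis using D by simp
  qed
  show "AE x in lborel. ((\<lambda>h. f (x + h *\<^sub>R v)) has_real_derivative g x) (at 0)"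
    using lipschitz_AE_directionally_differentiable[OF lip v] by eventually_elim (use * in blast)
  show "AE x in lborel. \<bar>g x\<bar> \<le> L"
    using lipschitz_AE_directionally_differentiable[OF lip v] by eventually_elim (use * in blast)
qed

section \<open>The difference quotient in a subgraph\<close>

text \<open>
  The difference of the indicator functions is a signed indicator of the layer between \<open>\<alpha>\<close> and \<open>\<beta>\<close>. On
  the layer \<open>g\<close> differs from \<open>g \<alpha>\<close> by at most \<open>C\<close> times its thickness. The quadratic error is what
  makes the estimate useful after division by a step size proportional to \<open>\<beta> - \<alpha>\<close>.
\<close>

lemma integral_layer_approx:
  fixes g :: "real \<Rightarrow> real"
  assumes lip: "C-lipschitz_on UNIV g"
  shows "\<bar>(\<integral>t. g t * (indicator {..<\<beta>} t - indicator {..<\<alpha>} t) \<partial>lborel) - g \<alpha> * (\<beta> - \<alpha>)\<bar> \<le> C * (\<beta> - \<alpha>)\<^sup>2"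
proof -
  have contg: "continuous_on S g" for S
    using lip lipschitz_on_continuous_on continuous_on_subset by blast
  then have [measurable]: "g \<in> borel_measurable borel" by (intro borel_measurable_continuous_onI)
  have C: "0 \<le> C" using lip lipschitz_on_nonneg by blast
  have *: "\<bar>(\<integral>t. g t * indicator {a..<b} t \<partial>lborel) - g c * (b - a)\<bar> \<le> C * (b - a)\<^sup>2"
    if "a \<le> b" "c \<in> {a..b}" for a b c
  proof -
    have bnd: "\<bar>g t - g c\<bar> \<le> C * (b - a)" if "t \<in> {a..<b}" for t
    proof -
      have "\<bar>g t - g c\<bar> \<le> C * \<bar>t - c\<bar>" using lipschitz_onD[OF lip, of t c] by (simp add: dist_real_def)
      also have "\<dots> \<le> C * (b - a)" using that \<open>c \<in> {a..b}\<close> C by (intro mult_left_mono) auto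
      finally show ?thesis .
    qed
    have "integrable lborel (indicat_real {a..<b})" using that by (intro integrable_real_indicator) auto
    then have int_c: "integrable lborel (\<lambda>t. k * indicat_real {a..<b} t)" for k
      by (rule integrable_mult_right)
    have int_d: "integrable lborel (\<lambda>t. (g t - g c) * indicator {a..<b} t)"
      by (rule Bochner_Integration.integrable_bound[OF int_c[of "C * (b - a)"]])
        (use bnd in \<open>auto simp: indicator_def abs_le_iff C split: if_splits\<close>)

    have "(\<integral>t. g t * indicator {a..<b} t \<partial>lborel)
        = (\<integral>t. (g t - g c) * indicator {a..<b} t + g c * indicator {a..<b} t \<partial>lborel)"
      by (intro Bochner_Integration.integral_cong) (auto simp: algebra_simps)
    also have "\<dots> = (\<integral>t. (g t - g c) * indicator {a..<b} t \<partial>lborel) + g c * (b - a)"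
      using int_d int_c[of "g c"] that by simp
    finally have "\<bar>(\<integral>t. g t * indicator {a..<b} t \<partial>lborel) - g c * (b - a)\<bar>
        = \<bar>\<integral>t. (g t - g c) * indicator {a..<b} t \<partial>lborel\<bar>" by simp
    also have "\<dots> \<le> (\<integral>t. \<bar>(g t - g c) * indicator {a..<b} t\<bar> \<partial>lborel)"
      by (rule integral_abs_bound)
    also have "\<dots> \<le> (\<integral>t. C * (b - a) * indicator {a..<b} t \<partial>lborel)"
      using int_d int_c[of "C * (b - a)"] bnd by (intro integral_mono integrable_abs) (auto simp: indicator_def)
    also have "\<dots> = C * (b - a)\<^sup>2" using that by (simp add: power2_eq_square)
    finally show ?thesis .
  qed
  show ?thesis
  proof (cases "\<alpha> \<le> \<beta>")
    case True
    then have "indicator {..<\<beta>} t - indicator {..<\<alpha>} t = (indicator {\<alpha>..<\<beta>} t :: real)" for t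
      by (auto simp: indicator_def)
    then show ?thesis using *[OF True, of \<alpha>] True by simp
  next
    case False
    then have "indicator {..<\<beta>} t - indicator {..<\<alpha>} t = - (indicator {\<beta>..<\<alpha>} t :: real)" for t
      by (auto simp: indicator_def)
    then have "(\<integral>t. g t * (indicator {..<\<beta>} t - indicator {..<\<alpha>} t) \<partial>lborel)
        = - (\<integral>t. g t * indicator {\<beta>..<\<alpha>} t \<partial>lborel)"
      by (simp only: mult_minus_right Bochner_Integration.integral_minus)
    moreover have "- (\<integral>t. g t * indicator {\<beta>..<\<alpha>} t \<partial>lborel) - g \<alpha> * (\<beta> - \<alpha>)
        = - ((\<integral>t. g t * indicator {\<beta>..<\<alpha>} t \<partial>lborel) - g \<alpha> * (\<alpha> - \<beta>))"
      by (simp add: algebra_simps)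
    ultimately show ?thesis
      using *[of \<beta> \<alpha> \<alpha>] False by (simp only: abs_minus_cancel power2_commute[of \<beta>]) simp
  qed
qed

lemma bounded_of_lipschitz_bounded_support:
  fixes F :: "'a::real_normed_vector \<Rightarrow> real"
  assumes lip: "C-lipschitz_on UNIV F" and supp: "\<And>x. R < norm x \<Longrightarrow> F x = 0"
  shows "\<bar>F x\<bar> \<le> \<bar>F 0\<bar> + C * \<bar>R\<bar>"
proof (cases "R < norm x")
  case True
  then show ?thesis using supp[OF True] lipschitz_on_nonneg[OF lip] by simp
next
  case False
  have "\<bar>F x - F 0\<bar> \<le> C * norm x" using lipschitz_onD[OF lip, of x 0] by (simp add: dist_norm)
  also have "\<dots> \<le> C * \<bar>R\<bar>" using False lipschitz_on_nonneg[OF lip] by (intro mult_left_mono) auto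
  finally show ?thesis by linarith
qed

lemma integrable_indicator_cball:
  "integrable lborel (\<lambda>x. B * indicat_real (cball (0::'a::euclidean_space) R) x)"
proof -
  have "integrable lborel (indicat_real (cball (0::'a) R))"
    using emeasure_lborel_cball_finite[of "0::'a" R] by (intro integrable_real_indicator) auto
  then show ?thesis by (rule integrable_mult_right)
qed

lemma integrable_of_bounded_support:
  fixes f :: "'a::euclidean_space \<Rightarrow> real"
  assumes "f \<in> borel_measurable borel" and "\<And>x. \<bar>f x\<bar> \<le> B * indicator (cball 0 R) x"
  shows "integrable lborel f"
proof (rule Bochner_Integration.integrable_bound)
  show "integrable lborel (\<lambda>x. B * indicat_real (cball (0::'a) R) x)"
    by (rule integrable_indicator_cball)
  show "AE x in lborel. norm (f x) \<le> norm (B * indicat_real (cball 0 R) x)"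
    using assms(2) by (auto intro: order_trans[OF _ abs_ge_self])
qed (use assms(1) in simp)

lemma difference_quotient_line:
  fixes f :: "'a::real_normed_vector \<Rightarrow> real"
  assumes "((\<lambda>h. f (x + h *\<^sub>R v)) has_real_derivative D) (at 0)" and "filterlim h (at 0) sequentially"
  shows "(\<lambda>k. (f (x + h k *\<^sub>R v) - f x) / h k) \<longlonglongrightarrow> D"
proof -
  have "((\<lambda>h. (f (x + h *\<^sub>R v) - f x) / h) \<longlongrightarrow> D) (at 0)"
    using assms(1) unfolding DERIV_def by simp
  then show ?thesis using assms(2) by (rule filterlim_compose)
qed

text \<open>
  Within the slab, a point is at most one further from the origin than any point of its line.
\<close>

lemma norm_slab_line:
  fixes x e :: "'a::euclidean_space"
  assumes e: "norm e = 1" and x: "0 \<le> x \<bullet> e" "x \<bullet> e \<le> 1"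
  shows "norm x \<le> norm (x + t *\<^sub>R e) + 1"
proof -
  have ee: "e \<bullet> e = 1" using e by (simp add: norm_eq_1)
  define r where "r = x \<bullet> e"
  define y where "y = x - r *\<^sub>R e"
  have x_eq: "x = y + r *\<^sub>R e" by (simp add: y_def)
  have orth: "y \<bullet> e = 0" "e \<bullet> y = 0" by (simp_all add: y_def r_def inner_diff_left inner_diff_right ee inner_commute)
  have "x + t *\<^sub>R e = y + (r + t) *\<^sub>R e" unfolding x_eq by (simp add: scaleR_left_distrib)
  then have "(norm (x + t *\<^sub>R e))\<^sup>2 = (y + (r + t) *\<^sub>R e) \<bullet> (y + (r + t) *\<^sub>R e)"
    by (simp only: power2_norm_eq_inner)
  also have "\<dots> = (norm y)\<^sup>2 + (r + t)\<^sup>2"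
    unfolding inner_add_left inner_add_right
    by (simp add: orth e dot_square_norm abs_mult_self_eq)
  finally have "(norm y)\<^sup>2 \<le> (norm (x + t *\<^sub>R e))\<^sup>2" by simp
  then have "norm y \<le> norm (x + t *\<^sub>R e)" by (rule power2_le_imp_le) simp
  moreover have "norm x \<le> norm y + norm ((x \<bullet> e) *\<^sub>R e)"
    unfolding r_def[symmetric] by (subst x_eq) (rule norm_triangle_ineq)
  moreover have "norm ((x \<bullet> e) *\<^sub>R e) \<le> 1" using x e by simp
  ultimately show ?thesis by linarith
qed

text \<open>
  The divergence theorem below the graph of \<open>\<Gamma>\<close>, for a field with the single component \<open>F\<close> in the
  direction \<open>v\<close>. With step size \<open>h\<close>, translation invariance gives
  \<open>\<integral>\<^sub>A (F (x + h v) - F x) / h dx = \<integral> F x (1\<^sub>A (x - h v) - 1\<^sub>A x) / h dx\<close>. On the line through \<open>x\<close> in the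
  direction \<open>e\<close>, the second integrand lives in the layer between the graphs of \<open>\<Gamma>\<close> and of
  \<open>x \<mapsto> \<Gamma> (x - h v) + h (v \<bullet> e)\<close>, whose thickness divided by \<open>h\<close> tends to \<open>e \<bullet> v - \<partial>\<^sub>v \<Gamma>\<close>. Both limits are
  taken by dominated convergence; no total derivative of \<open>\<Gamma>\<close> is involved.
\<close>

theorem subgraph_integral_directional_derivative:
  fixes F \<Gamma> :: "'a::euclidean_space \<Rightarrow> real"
  assumes e: "norm e = 1" and lip\<Gamma>: "L-lipschitz_on UNIV \<Gamma>"
    and const: "\<And>x h. \<Gamma> (x + h *\<^sub>R e) = \<Gamma> x"
    and lipF: "C-lipschitz_on UNIV F" and supp: "\<And>x. R < norm x \<Longrightarrow> F x = 0"
    and v: "norm v = 1"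
    and diff: "\<And>x. x \<bullet> e < \<Gamma> x \<Longrightarrow> ((\<lambda>h. F (x + h *\<^sub>R v)) has_real_derivative D x) (at 0)"
    and g: "g \<in> borel_measurable borel"
      "AE x in lborel. ((\<lambda>h. \<Gamma> (x + h *\<^sub>R v)) has_real_derivative g x) (at 0)"
  shows "(\<integral>x. indicator {x. x \<bullet> e < \<Gamma> x} x * D x \<partial>lborel)
       = (\<integral>x. indicator {0..1} (x \<bullet> e) * (F (graph_point e \<Gamma> x) * (e \<bullet> v - g x)) \<partial>lborel)"
proof -
  define h where "h k = inverse (real (Suc k))" for k
  have h0: "0 < h k" and h1: "h k \<le> 1" for k
    by (auto simp: h_def inverse_eq_divide)
  have h_lim0: "h \<longlonglongrightarrow> 0" unfolding h_def by (rule LIMSEQ_inverse_real_of_nat)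
  have h_lim: "filterlim h (at 0) sequentially"
    unfolding filterlim_at using h_lim0 h0 by (auto simp: less_imp_neq[symmetric])
  have mh_lim: "filterlim (\<lambda>k. - h k) (at 0) sequentially"
    unfolding filterlim_at using tendsto_minus[OF h_lim0] h0 by (auto simp: less_imp_neq[symmetric])
  have ee: "e \<bullet> e = 1" using e by (simp add: norm_eq_1)
  have L: "0 \<le> L" using lip\<Gamma> lipschitz_on_nonneg by blast
  have C: "0 \<le> C" using lipF lipschitz_on_nonneg by blast
  have cont\<Gamma>: "continuous_on UNIV \<Gamma>" using lip\<Gamma> lipschitz_on_continuous_on by blast
  have contF: "continuous_on UNIV F" using lipF lipschitz_on_continuous_on by blast
  have [measurable]: "\<Gamma> \<in> borel_measurable borel" "F \<in> borel_measurable borel"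
    using cont\<Gamma> contF by (auto intro: borel_measurable_continuous_onI)
  define A where "A = {x. x \<bullet> e < \<Gamma> x}"
  have [measurable]: "A \<in> sets borel" unfolding A_def by measurable
  define M where "M = \<bar>F 0\<bar> + C * \<bar>R\<bar>"
  have F_le: "\<bar>F x\<bar> \<le> M" for x
    unfolding M_def by (rule bounded_of_lipschitz_bounded_support[OF lipF supp])
  have M: "0 \<le> M" using F_le[of 0] by linarith
  have FC: "\<bar>F y - F x\<bar> \<le> C * norm (y - x)" for x y
    using lipschitz_onD[OF lipF, of y x] by (simp add: dist_norm)
  \<comment> \<open>The difference quotient of \<open>F\<close> on \<open>A\<close> and, after translation, that of the indicator function.\<close>
  define q where "q k x = indicator A x * ((F (x + h k *\<^sub>R v) - F x) / h k)" for k x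
  define p where "p k x = F x * ((indicator A (x - h k *\<^sub>R v) - indicator A x) / h k)" for k x
  have [measurable]: "q k \<in> borel_measurable borel" "p k \<in> borel_measurable borel" for k
    unfolding q_def p_def by measurable
  have q_bound: "\<bar>q k x\<bar> \<le> C * indicator (cball 0 (\<bar>R\<bar> + 1)) x" for k x
  proof (cases "norm x \<le> \<bar>R\<bar> + 1")
    case True
    have "\<bar>F (x + h k *\<^sub>R v) - F x\<bar> \<le> C * h k"
      using FC[of "x + h k *\<^sub>R v" x] v h0[of k] by simp
    then have "\<bar>(F (x + h k *\<^sub>R v) - F x) / h k\<bar> \<le> C"
      using h0[of k] by (simp add: divide_le_eq)
    then show ?thesis using True C by (auto simp: q_def indicator_def)
  next
    case False
    have "norm x \<le> norm (x + h k *\<^sub>R v) + norm (h k *\<^sub>R v)"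
      by (metis add_diff_cancel_right' norm_triangle_ineq4)
    then have "R < norm (x + h k *\<^sub>R v)" "R < norm x" using False v h0[of k] h1[of k] by auto
    then show ?thesis using supp C by (simp add: q_def)
  qed
  have q_int: "integrable lborel (q k)" for k
    by (rule integrable_of_bounded_support[OF _ q_bound]) measurable
  have q_lim: "(\<lambda>k. q k x) \<longlonglongrightarrow> indicator A x * D x" for x
  proof (cases "x \<in> A")
    case True
    then show ?thesis
      using difference_quotient_line[OF diff h_lim, of x] by (simp add: A_def q_def)
  qed (simp add: q_def)
  have vol: "(\<lambda>k. \<integral>x. q k x \<partial>lborel) \<longlonglongrightarrow> (\<integral>x. indicator A x * D x \<partial>lborel)"
  proof (rule integral_dominated_convergence)
    show "(\<lambda>x. indicator A x * D x) \<in> borel_measurable lborel"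
      by (rule borel_measurable_LIMSEQ_metric[OF _ q_lim]) measurable
    show "integrable lborel (\<lambda>x. C * indicat_real (cball (0::'a) (\<bar>R\<bar> + 1)) x)"
      by (rule integrable_indicator_cball)
  qed (use q_lim q_bound in auto)
  have Fint: "integrable lborel (\<lambda>x. F x * indicator A (x + c))" for c
  proof (rule integrable_of_bounded_support)
    show "\<bar>F x * indicator A (x + c)\<bar> \<le> M * indicator (cball 0 R) x" for x
      using F_le[of x] supp[of x] M by (cases "norm x \<le> R") (auto simp: indicator_def)
  qed measurable
  have Fint2: "integrable lborel (\<lambda>x. F (x + c) * indicator A x)" for c
  proof (rule integrable_of_bounded_support)
    show "\<bar>F (x + c) * indicator A x\<bar> \<le> M * indicator (cball 0 (R + norm c)) x" for x
    proof (cases "norm x \<le> R + norm c")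
      case False
      moreover have "norm x \<le> norm (x + c) + norm c"
        by (metis add_diff_cancel_right' norm_triangle_ineq4)
      ultimately show ?thesis using supp[of "x + c"] by simp
    qed (use F_le[of "x + c"] M in \<open>auto simp: indicator_def\<close>)
  qed measurable
  have p_int: "integrable lborel (p k)" for k
  proof -
    have "p k = (\<lambda>x. (F x * indicator A (x + (- h k *\<^sub>R v)) - F x * indicator A (x + 0)) / h k)"
      by (auto simp: p_def fun_eq_iff field_simps)
    then show ?thesis using Fint by (simp only:) (intro Bochner_Integration.integrable_diff integrable_divide)
  qed
  have qp: "(\<integral>x. q k x \<partial>lborel) = (\<integral>x. p k x \<partial>lborel)" for k
  proof -
    have "(\<integral>x. q k x \<partial>lborel) = (\<integral>x. (F (x + h k *\<^sub>R v) * indicator A x - F (x + 0) * indicator A x) / h k \<partial>lborel)"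
      by (intro Bochner_Integration.integral_cong) (auto simp: q_def field_simps)
    also have "\<dots> = ((\<integral>x. F (x + h k *\<^sub>R v) * indicator A x \<partial>lborel) - (\<integral>x. F (x + 0) * indicator A x \<partial>lborel)) / h k"
      by (simp only: integral_divide_zero Bochner_Integration.integral_diff[OF Fint2 Fint2])
    also have "(\<integral>x. F (x + h k *\<^sub>R v) * indicator A x \<partial>lborel) = (\<integral>x. F x * indicator A (x + (- h k *\<^sub>R v)) \<partial>lborel)"
      by (subst integral_lborel_translate[symmetric, where c="h k *\<^sub>R v" and f="\<lambda>x. F x * indicator A (x + (- h k *\<^sub>R v))"])
        (simp_all add: algebra_simps)
    also have "(\<integral>x. F (x + 0) * indicator A x \<partial>lborel) = (\<integral>x. F x * indicator A (x + 0) \<partial>lborel)" by simp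
    also have "((\<integral>x. F x * indicator A (x + (- h k *\<^sub>R v)) \<partial>lborel) - (\<integral>x. F x * indicator A (x + 0) \<partial>lborel)) / h k
        = (\<integral>x. (F x * indicator A (x + (- h k *\<^sub>R v)) - F x * indicator A (x + 0)) / h k \<partial>lborel)"
      by (simp only: integral_divide_zero Bochner_Integration.integral_diff[OF Fint Fint])
    also have "\<dots> = (\<integral>x. p k x \<partial>lborel)"
      by (intro Bochner_Integration.integral_cong) (auto simp: p_def field_simps)
    finally show ?thesis .
  qed
  define J where "J k x = (\<integral>t. p k (x + t *\<^sub>R e) \<partial>lborel)" for k x
  \<comment> \<open>The displacement along \<open>e\<close> of the graph translated by \<open>h k\<close> times \<open>v\<close>.\<close>
  define \<Delta> where "\<Delta> k x = (h k * (v \<bullet> e) + \<Gamma> (x - h k *\<^sub>R v) - \<Gamma> x)" for k x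
  have \<Delta>_bound: "\<bar>\<Delta> k x\<bar> \<le> (L + 1) * h k" for k x
  proof -
    have "\<bar>\<Gamma> (x - h k *\<^sub>R v) - \<Gamma> x\<bar> \<le> L * h k"
      using lipschitz_onD[OF lip\<Gamma>, of "x - h k *\<^sub>R v" x] v h0[of k] by (simp add: dist_norm)
    moreover have "\<bar>v \<bullet> e\<bar> \<le> 1" using Cauchy_Schwarz_ineq2[of v e] v e by simp
    then have "\<bar>h k * (v \<bullet> e)\<bar> \<le> h k"
      using h0[of k] by (simp add: abs_mult mult_left_le)
    ultimately show ?thesis unfolding \<Delta>_def by (simp add: algebra_simps)
  qed
  have J_approx: "\<bar>J k x - F (graph_point e \<Gamma> x) * (\<Delta> k x / h k)\<bar> \<le> C * (L + 1)\<^sup>2 * h k" for k x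
  proof -
    define \<alpha> where "\<alpha> = \<Gamma> x - x \<bullet> e"
    define \<beta> where "\<beta> = \<Gamma> (x - h k *\<^sub>R v) - x \<bullet> e + h k * (v \<bullet> e)"
    have G1: "\<Gamma> (x + t *\<^sub>R e - h k *\<^sub>R v) = \<Gamma> (x - h k *\<^sub>R v)" for t
      using const[of "x - h k *\<^sub>R v" t] by (simp add: algebra_simps)
    have i1: "indicator A (x + t *\<^sub>R e - h k *\<^sub>R v) = (indicator {..<\<beta>} t :: real)" for t
      unfolding A_def \<beta>_def indicator_def mem_Collect_eq G1
      by (auto simp: inner_add_left inner_diff_left ee)
    have i2: "indicator A (x + t *\<^sub>R e) = (indicator {..<\<alpha>} t :: real)" for t
      unfolding A_def \<alpha>_def indicator_def mem_Collect_eq const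
      by (auto simp: inner_add_left ee)
    have "J k x = (\<integral>t. F (x + t *\<^sub>R e) * (indicator {..<\<beta>} t - indicator {..<\<alpha>} t) / h k \<partial>lborel)"
      unfolding J_def p_def i1 i2 by simp
    also have "\<dots> = (\<integral>t. F (x + t *\<^sub>R e) * (indicator {..<\<beta>} t - indicator {..<\<alpha>} t) \<partial>lborel) / h k"
      by simp
    finally have J_eq: "J k x = (\<integral>t. F (x + t *\<^sub>R e) * (indicator {..<\<beta>} t - indicator {..<\<alpha>} t) \<partial>lborel) / h k" .
    have "C-lipschitz_on UNIV (\<lambda>t. F (x + t *\<^sub>R e))"
    proof (rule lipschitz_onI)
      show "dist (F (x + s *\<^sub>R e)) (F (x + t *\<^sub>R e)) \<le> C * dist s t" for s t
        using FC[of "x + s *\<^sub>R e" "x + t *\<^sub>R e"] e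
        by (simp add: dist_norm scaleR_left_diff_distrib[symmetric])
    qed (rule C)
    from integral_layer_approx[OF this, of \<beta> \<alpha>]
    have "\<bar>J k x * h k - F (graph_point e \<Gamma> x) * \<Delta> k x\<bar> \<le> C * (\<Delta> k x)\<^sup>2"
      using h0[of k] unfolding J_eq by (simp add: graph_point_def \<alpha>_def \<beta>_def \<Delta>_def algebra_simps)
    also have "\<dots> \<le> C * ((L + 1) * h k)\<^sup>2"
      using \<Delta>_bound[of k x] C by (intro mult_left_mono) (simp_all add: abs_le_square_iff[symmetric])
    finally have "\<bar>J k x * h k - F (graph_point e \<Gamma> x) * \<Delta> k x\<bar> / h k \<le> C * ((L + 1) * h k)\<^sup>2 / h k"
      using h0[of k] by (intro divide_right_mono) auto
    moreover have "\<bar>J k x * h k - F (graph_point e \<Gamma> x) * \<Delta> k x\<bar> / h k = \<bar>J k x - F (graph_point e \<Gamma> x) * (\<Delta> k x / h k)\<bar>"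
    proof -
      have "J k x - F (graph_point e \<Gamma> x) * (\<Delta> k x / h k) = (J k x * h k - F (graph_point e \<Gamma> x) * \<Delta> k x) / h k"
        using h0[of k] by (simp add: diff_divide_distrib)
      then show ?thesis using h0[of k] by (simp only: abs_divide abs_of_pos)
    qed
    moreover have "C * ((L + 1) * h k)\<^sup>2 / h k = C * (L + 1)\<^sup>2 * h k"
      using h0[of k] by (simp add: power2_eq_square)
    ultimately show ?thesis by simp
  qed
  have J_lim: "(\<lambda>k. J k x) \<longlonglongrightarrow> F (graph_point e \<Gamma> x) * (e \<bullet> v - g x)"
    if "((\<lambda>h. \<Gamma> (x + h *\<^sub>R v)) has_real_derivative g x) (at 0)" for x
  proof -
    have "(\<lambda>k. (\<Gamma> (x + (- h k) *\<^sub>R v) - \<Gamma> x) / (- h k)) \<longlonglongrightarrow> g x"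
      by (rule difference_quotient_line[OF that mh_lim])
    then have "(\<lambda>k. e \<bullet> v - (\<Gamma> (x + (- h k) *\<^sub>R v) - \<Gamma> x) / (- h k)) \<longlonglongrightarrow> e \<bullet> v - g x"
      by (intro tendsto_intros)
    moreover have "e \<bullet> v - (\<Gamma> (x + (- h k) *\<^sub>R v) - \<Gamma> x) / (- h k) = \<Delta> k x / h k" for k
      using h0[of k] by (simp add: \<Delta>_def field_simps inner_commute)
    ultimately have "(\<lambda>k. \<Delta> k x / h k) \<longlonglongrightarrow> e \<bullet> v - g x" by simp
    then have main: "(\<lambda>k. F (graph_point e \<Gamma> x) * (\<Delta> k x / h k)) \<longlonglongrightarrow> F (graph_point e \<Gamma> x) * (e \<bullet> v - g x)"
      by (rule tendsto_mult_left)
    have "(\<lambda>k. J k x - F (graph_point e \<Gamma> x) * (\<Delta> k x / h k)) \<longlonglongrightarrow> 0"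
    proof (rule tendsto_rabs_zero_cancel, rule tendsto_sandwich[OF _ _ tendsto_const])
      show "(\<lambda>k. C * (L + 1)\<^sup>2 * h k) \<longlonglongrightarrow> 0"
        using tendsto_mult_left[OF h_lim0, of "C * (L + 1)\<^sup>2"] by simp
    qed (use J_approx in auto)
    from tendsto_add[OF this main] show ?thesis by simp
  qed
  have J_bound: "\<bar>indicator {0..1} (x \<bullet> e) * J k x\<bar>
      \<le> (M * (L + 1) + C * (L + 1)\<^sup>2) * indicator (cball 0 (\<bar>R\<bar> + 1)) x" for k x
  proof (cases "x \<bullet> e \<in> {0..1}")
    case True
    show ?thesis
    proof (cases "norm x \<le> \<bar>R\<bar> + 1")
      case nx: True
      have "\<bar>\<Delta> k x / h k\<bar> \<le> L + 1"
        using \<Delta>_bound[of k x] h0[of k] by (simp add: divide_le_eq)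
      then have "\<bar>F (graph_point e \<Gamma> x) * (\<Delta> k x / h k)\<bar> \<le> M * (L + 1)"
        unfolding abs_mult using F_le M by (intro mult_mono) auto
      moreover have "C * (L + 1)\<^sup>2 * h k \<le> C * (L + 1)\<^sup>2"
        using h1[of k] h0[of k] C by (intro mult_left_le) auto
      ultimately have "\<bar>J k x\<bar> \<le> M * (L + 1) + C * (L + 1)\<^sup>2"
        using J_approx[of k x] by linarith
      then show ?thesis using True nx by (simp add: indicator_def)
    next
      case False
      have "p k (x + t *\<^sub>R e) = 0" for t
        using norm_slab_line[OF e, of x t] True False supp[of "x + t *\<^sub>R e"] by (simp add: p_def)
      then show ?thesis using False by (simp add: J_def)
    qed
  next
    case False
    then have "indicat_real {0..1} (x \<bullet> e) = 0" by (rule indicator_simps(2))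
    then show ?thesis using M C L by simp
  qed
  have "(\<lambda>k. \<integral>x. indicator {0..1} (x \<bullet> e) * J k x \<partial>lborel)
      \<longlonglongrightarrow> (\<integral>x. indicator {0..1} (x \<bullet> e) * (F (graph_point e \<Gamma> x) * (e \<bullet> v - g x)) \<partial>lborel)"
  proof (rule integral_dominated_convergence)
    show "(\<lambda>x. indicator {0..1} (x \<bullet> e) * (F (graph_point e \<Gamma> x) * (e \<bullet> v - g x))) \<in> borel_measurable lborel"
      using g(1) unfolding graph_point_def by measurable
    show "(\<lambda>x. indicator {0..1} (x \<bullet> e) * J k x) \<in> borel_measurable lborel" for k
      unfolding J_def by (rule integral_slab(2)[OF e p_int])
    show "integrable lborel (\<lambda>x. (M * (L + 1) + C * (L + 1)\<^sup>2) * indicat_real (cball (0::'a) (\<bar>R\<bar> + 1)) x)"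
      by (rule integrable_indicator_cball)
    show "AE x in lborel. (\<lambda>k. indicator {0..1} (x \<bullet> e) * J k x)
        \<longlonglongrightarrow> indicator {0..1} (x \<bullet> e) * (F (graph_point e \<Gamma> x) * (e \<bullet> v - g x))"
      using g(2) by eventually_elim (intro tendsto_mult_left J_lim)
  qed (use J_bound in auto)
  moreover have "(\<integral>x. q k x \<partial>lborel) = (\<integral>x. indicator {0..1} (x \<bullet> e) * J k x \<partial>lborel)" for k
    unfolding qp J_def by (rule integral_slab(1)[OF e p_int])
  ultimately have "(\<lambda>k. \<integral>x. q k x \<partial>lborel)
      \<longlonglongrightarrow> (\<integral>x. indicator {0..1} (x \<bullet> e) * (F (graph_point e \<Gamma> x) * (e \<bullet> v - g x)) \<partial>lborel)"
    by simp
  then show ?thesis using LIMSEQ_unique[OF vol] by (simp add: A_def)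
qed

text \<open>
  The case of the subgraph theorem in which the graph is a hyperplane beyond the support of \<open>F\<close>.
\<close>

lemma integral_directional_derivative_eq_0:
  fixes F :: "'a::euclidean_space \<Rightarrow> real"
  assumes lipF: "C-lipschitz_on UNIV F" and supp: "\<And>x. R < norm x \<Longrightarrow> F x = 0"
    and v: "norm v = 1"
    and diff: "\<And>x. ((\<lambda>h. F (x + h *\<^sub>R v)) has_real_derivative D x) (at 0)"
  shows "(\<integral>x. D x \<partial>lborel) = 0"
proof -
  define \<Gamma> where "\<Gamma> x = \<bar>R\<bar> + 1" for x :: 'a
  have "D x = 0" if "\<not> x \<bullet> v < \<Gamma> x" for x
  proof -
    have "x \<bullet> v \<le> norm x" using norm_cauchy_schwarz[of x v] v by simp
    then have "R < norm x" using that by (simp add: \<Gamma>_def)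
    then have nhds: "\<forall>\<^sub>F h in nhds 0. R < norm (x + h *\<^sub>R v)"
      by (intro order_tendstoD(1)[of _ "norm x"] tendsto_eq_intros) (auto intro!: filterlim_ident)
    have "((\<lambda>h. F (x + h *\<^sub>R v)) has_real_derivative 0) (at 0)"
    proof (subst DERIV_cong_ev[OF refl _ refl])
      show "\<forall>\<^sub>F h in nhds 0. F (x + h *\<^sub>R v) = (\<lambda>_. 0) h"
        using nhds by eventually_elim (use supp in auto)
    qed simp
    then show ?thesis using diff[of x] DERIV_unique by blast
  qed
  then have "(\<integral>x. D x \<partial>lborel) = (\<integral>x. indicator {x. x \<bullet> v < \<Gamma> x} x * D x \<partial>lborel)"
    by (intro Bochner_Integration.integral_cong) (auto simp: indicator_def)
  also have "\<dots> = (\<integral>x. indicator {0..1} (x \<bullet> v) * (F (graph_point v \<Gamma> x) * (v \<bullet> v - 0)) \<partial>lborel)"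
    by (rule subgraph_integral_directional_derivative[OF v _ _ lipF supp v diff, where L=0])
      (auto simp: \<Gamma>_def intro!: lipschitz_onI)
  also have "\<dots> = (\<integral>x. 0 \<partial>(lborel :: 'a measure))"
  proof (rule Bochner_Integration.integral_cong)
    fix x :: 'a
    have "graph_point v \<Gamma> x \<bullet> v = \<bar>R\<bar> + 1"
      using v by (simp add: graph_point_def \<Gamma>_def inner_add_left norm_eq_1)
    then have "R < norm (graph_point v \<Gamma> x)"
      using norm_cauchy_schwarz[of "graph_point v \<Gamma> x" v] v by simp
    then show "indicator {0..1} (x \<bullet> v) * (F (graph_point v \<Gamma> x) * (v \<bullet> v - 0)) = 0"
      using supp by simp
  qed simp
  finally show ?thesis by simp
qed

section \<open>Functions with a gradient that is continuous up to the boundary\<close>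

text \<open>
  The scalar form of \<^const>\<open>C1_closure\<close> with an explicit gradient, so that product and quotient rules
  can be read off as formulas for the gradient.
\<close>

definition C1_gradient :: "'a::euclidean_space set \<Rightarrow> ('a \<Rightarrow> real) \<Rightarrow> ('a \<Rightarrow> 'a) \<Rightarrow> bool" where
  "C1_gradient \<Omega> f G \<longleftrightarrow> continuous_on (closure \<Omega>) f \<and> continuous_on (closure \<Omega>) G \<and>
     (\<forall>x\<in>\<Omega>. (f has_derivative (\<lambda>h. G x \<bullet> h)) (at x))"

lemma C1_gradient_diff:
  assumes "C1_gradient \<Omega> f F" "C1_gradient \<Omega> g G"
  shows "C1_gradient \<Omega> (\<lambda>x. f x - g x) (\<lambda>x. F x - G x)"
  using assms unfolding C1_gradient_def inner_diff_left
  by (intro conjI ballI continuous_intros has_derivative_diff) auto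

lemma C1_gradient_sum:
  assumes "\<And>i. i \<in> I \<Longrightarrow> C1_gradient \<Omega> (f i) (F i)"
  shows "C1_gradient \<Omega> (\<lambda>x. \<Sum>i\<in>I. f i x) (\<lambda>x. \<Sum>i\<in>I. F i x)"
  using assms unfolding C1_gradient_def inner_sum_left
  by (intro conjI ballI continuous_intros has_derivative_sum) auto

lemma C1_gradient_mult:
  assumes "C1_gradient \<Omega> f F" "C1_gradient \<Omega> g G"
  shows "C1_gradient \<Omega> (\<lambda>x. f x * g x) (\<lambda>x. f x *\<^sub>R G x + g x *\<^sub>R F x)"
  unfolding C1_gradient_def
proof (intro conjI ballI)
  fix x assume "x \<in> \<Omega>"
  then have "((\<lambda>x. f x * g x) has_derivative (\<lambda>h. f x * (G x \<bullet> h) + (F x \<bullet> h) * g x)) (at x)"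
    using assms unfolding C1_gradient_def by (intro has_derivative_mult) auto
  then show "((\<lambda>x. f x * g x) has_derivative (\<lambda>h. (f x *\<^sub>R G x + g x *\<^sub>R F x) \<bullet> h)) (at x)"
    by (simp add: inner_add_left mult.commute)
qed (use assms in \<open>auto simp: C1_gradient_def intro!: continuous_intros\<close>)

lemma C1_gradient_inverse:
  assumes "C1_gradient \<Omega> f F" "\<And>x. x \<in> closure \<Omega> \<Longrightarrow> f x \<noteq> 0"
  shows "C1_gradient \<Omega> (\<lambda>x. inverse (f x)) (\<lambda>x. (- inverse (f x) * inverse (f x)) *\<^sub>R F x)"
  unfolding C1_gradient_def
proof (intro conjI ballI)
  fix x assume x: "x \<in> \<Omega>"
  then have "f x \<noteq> 0" using assms(2) closure_subset by blast
  moreover have "(f has_derivative (\<lambda>h. F x \<bullet> h)) (at x)" using assms(1) x by (simp add: C1_gradient_def)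
  ultimately have "((\<lambda>x. inverse (f x)) has_derivative (\<lambda>h. - (inverse (f x) * (F x \<bullet> h) * inverse (f x)))) (at x)"
    by (rule Deriv.has_derivative_inverse)
  then show "((\<lambda>x. inverse (f x)) has_derivative (\<lambda>h. ((- inverse (f x) * inverse (f x)) *\<^sub>R F x) \<bullet> h)) (at x)"
    by (simp add: algebra_simps)
qed (use assms in \<open>auto simp: C1_gradient_def intro!: continuous_intros\<close>)

lemma C1_gradient_unique:
  assumes "open \<Omega>" "C1_gradient \<Omega> f F" "C1_gradient \<Omega> g G"
    and eq: "\<And>x. x \<in> \<Omega> \<Longrightarrow> f x = g x" and x: "x \<in> \<Omega>"
  shows "F x = G x"
proof -
  have "(f has_derivative (\<lambda>h. G x \<bullet> h)) (at x)"
    by (rule has_derivative_transform_within_open[of g _ _ _ \<Omega>])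
      (use assms in \<open>auto simp: C1_gradient_def\<close>)
  moreover have "(f has_derivative (\<lambda>h. F x \<bullet> h)) (at x)" using assms by (simp add: C1_gradient_def)
  ultimately have "(\<lambda>h. G x \<bullet> h) = (\<lambda>h. F x \<bullet> h)" using has_derivative_unique by blast
  then have "(G x - F x) \<bullet> (G x - F x) = 0"
    unfolding inner_diff_left using fun_cong[of "\<lambda>h. G x \<bullet> h" "\<lambda>h. F x \<bullet> h" "G x - F x"] by simp
  then show ?thesis by simp
qed

text \<open>
  The gradient of a component is the adjoint of the derivative applied to \<open>c\<close>, written in coordinates.
  With \<open>c = 1\<close> this covers real functions as well.
\<close>

lemma C1_closure_inner:
  fixes F :: "'a::euclidean_space \<Rightarrow> 'b::euclidean_space"
  assumes "C1_closure \<Omega> F"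
  obtains G where "C1_gradient \<Omega> (\<lambda>x. F x \<bullet> c) G"
proof -
  obtain D :: "'a \<Rightarrow> 'a \<Rightarrow>\<^sub>L 'b" where D: "continuous_on (closure \<Omega>) D"
    "\<And>x. x \<in> \<Omega> \<Longrightarrow> (F has_derivative blinfun_apply (D x)) (at x)"
    using assms by (auto simp: C1_closure_def)
  define G where "G x = (\<Sum>i\<in>Basis. (D x i \<bullet> c) *\<^sub>R i)" for x
  have G: "G x \<bullet> h = D x h \<bullet> c" for x h
  proof -
    have "D x h = D x (\<Sum>i\<in>Basis. (h \<bullet> i) *\<^sub>R i)" by (simp add: euclidean_representation)
    also have "\<dots> = (\<Sum>i\<in>Basis. (h \<bullet> i) *\<^sub>R D x i)" by (simp add: blinfun.sum_right blinfun.scaleR_right)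
    finally show ?thesis
      by (simp add: G_def inner_sum_left inner_sum_right inner_commute[of h] mult.commute)
  qed
  have "C1_gradient \<Omega> (\<lambda>x. F x \<bullet> c) G"
    unfolding C1_gradient_def
  proof (intro conjI ballI)
    show "continuous_on (closure \<Omega>) (\<lambda>x. F x \<bullet> c)"
      using assms by (auto simp: C1_closure_def intro!: continuous_intros)
    show "continuous_on (closure \<Omega>) G"
      unfolding G_def using D(1) by (intro continuous_intros)
    fix x assume "x \<in> \<Omega>"
    then show "((\<lambda>x. F x \<bullet> c) has_derivative (\<lambda>h. G x \<bullet> h)) (at x)"
      unfolding G by (intro has_derivative_inner_left D(2))
  qed
  then show thesis by (rule that)
qed

lemma C1_closure_real:
  fixes f :: "'a::euclidean_space \<Rightarrow> real"
  assumes "C1_closure \<Omega> f"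
  obtains G where "C1_gradient \<Omega> f G"
  using C1_closure_inner[OF assms, of 1] by (metis (no_types, lifting) ext inner_real_def mult.right_neutral)

lemma pderiv_at_eq:
  assumes "(f has_derivative (\<lambda>h. G \<bullet> h)) (at x)"
  shows "pderiv_at i f x = G \<bullet> i"
proof -
  have "(f has_derivative (\<lambda>h. G \<bullet> h)) (at (x + 0 *\<^sub>R i))" using assms by simp
  moreover have "((\<lambda>h. x + h *\<^sub>R i) has_derivative (\<lambda>h. h *\<^sub>R i)) (at 0)"
    by (auto intro!: derivative_eq_intros)
  ultimately have "((\<lambda>h. f (x + h *\<^sub>R i)) has_derivative (\<lambda>h. G \<bullet> (h *\<^sub>R i))) (at 0)"
    by (rule has_derivative_compose[rotated])
  then have "((\<lambda>h. f (x + h *\<^sub>R i)) has_real_derivative G \<bullet> i) (at 0)"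
    by (simp add: has_field_derivative_def mult_commute_abs)
  then show ?thesis unfolding pderiv_at_def by (rule DERIV_imp_deriv)
qed

lemma grad_eq:
  assumes "C1_gradient \<Omega> f G" "x \<in> \<Omega>"
  shows "grad f x = G x"
proof -
  have "(f has_derivative (\<lambda>h. G x \<bullet> h)) (at x)" using assms by (simp add: C1_gradient_def)
  then show ?thesis unfolding grad_def by (simp add: pderiv_at_eq euclidean_representation)
qed

lemma divg_eq:
  assumes "\<And>i. i \<in> Basis \<Longrightarrow> C1_gradient \<Omega> (\<lambda>x. F x \<bullet> i) (G i)" "x \<in> \<Omega>"
  shows "divg F x = (\<Sum>i\<in>Basis. G i x \<bullet> i)"
  unfolding divg_def
proof (rule sum.cong)
  fix i :: 'a assume "i \<in> Basis"
  then have "((\<lambda>x. F x \<bullet> i) has_derivative (\<lambda>h. G i x \<bullet> h)) (at x)"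
    using assms by (simp add: C1_gradient_def)
  then show "pderiv_at i (\<lambda>y. F y \<bullet> i) x = G i x \<bullet> i" by (rule pderiv_at_eq)
qed simp

text \<open>
  Every point of the closure of an open set is a limit point of that set, so the limit in
  \<^const>\<open>grad_closure\<close> is unique.
\<close>

lemma grad_closure_eq:
  assumes "open \<Omega>" "C1_gradient \<Omega> f G" "x \<in> closure \<Omega>"
  shows "grad_closure \<Omega> f x = G x"
proof -
  have "x islimpt \<Omega>"
  proof (cases "x \<in> \<Omega>")
    case True
    then show ?thesis using \<open>open \<Omega>\<close> by (intro interior_limit_point) (simp add: interior_open)
  next
    case False
    then show ?thesis using assms(3) by (simp add: closure_def)
  qed
  then have "\<not> trivial_limit (at x within \<Omega>)" by (simp add: trivial_limit_within)
  moreover have "(G \<longlongrightarrow> G x) (at x within closure \<Omega>)"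
    using assms by (simp add: C1_gradient_def continuous_on_def)
  then have "(G \<longlongrightarrow> G x) (at x within \<Omega>)"
    by (rule tendsto_within_subset[OF _ closure_subset])
  then have "(grad f \<longlongrightarrow> G x) (at x within \<Omega>)"
    by (rule Lim_transform_within[of _ _ _ _ 1]) (use grad_eq[OF assms(2)] in auto)
  ultimately show ?thesis unfolding grad_closure_def by (rule tendsto_Lim)
qed

lemma integrable_continuous_on_closure:
  fixes k :: "'a::euclidean_space \<Rightarrow> real"
  assumes "open \<Omega>" "bounded \<Omega>" "continuous_on (closure \<Omega>) k"
  shows "integrable lborel (\<lambda>x. indicator \<Omega> x * k x)"
proof -
  have "integrable lborel (\<lambda>x. indicator (closure \<Omega>) x *\<^sub>R k x)"
    using assms by (intro borel_integrable_compact) auto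
  then have "integrable lborel (\<lambda>x. indicator \<Omega> x *\<^sub>R (indicator (closure \<Omega>) x *\<^sub>R k x))"
    by (rule integrable_mult_indicator[rotated]) (use assms(1) in simp)
  moreover have eq: "indicator \<Omega> x *\<^sub>R (indicator (closure \<Omega>) x *\<^sub>R k x) = indicator \<Omega> x * k x" for x
    using closure_subset[of \<Omega>] by (auto simp: indicator_def)
  ultimately show ?thesis by (simp only: eq)
qed

lemma set_integral_lebesgue_eq_lborel:
  fixes k :: "'a::euclidean_space \<Rightarrow> real"
  assumes "open \<Omega>" "bounded \<Omega>" "continuous_on (closure \<Omega>) k"
  shows "(LINT x:\<Omega>|lebesgue. k x) = (\<integral>x. indicator \<Omega> x * k x \<partial>lborel)"
  unfolding set_lebesgue_integral_def
  using borel_measurable_integrable[OF integrable_continuous_on_closure[OF assms]]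
  by (simp add: integral_completion)

section \<open>The volume integral in a boundary chart\<close>

text \<open>
  A subgraph need not be convex, so a bound for the gradient does not bound the slope along the segment
  from \<open>x\<close> to \<open>y\<close>. But if both points are first lowered by \<open>L |x - y|\<close>, the segment between the lowered
  points stays below the graph, because along the original segment \<open>\<Gamma>\<close> varies by no more than that. The
  path down, across and up has length \<open>(2 L + 1) |x - y|\<close>.
\<close>

lemma lipschitz_on_subgraph:
  fixes f \<Gamma> :: "'a::euclidean_space \<Rightarrow> real"
  assumes e: "norm e = 1" and lip: "L-lipschitz_on UNIV \<Gamma>"
    and const: "\<And>x h. \<Gamma> (x + h *\<^sub>R e) = \<Gamma> x"
    and der: "\<And>x. x \<bullet> e < \<Gamma> x \<Longrightarrow> (f has_derivative (\<lambda>h. G x \<bullet> h)) (at x)"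
    and bnd: "\<And>x. x \<bullet> e < \<Gamma> x \<Longrightarrow> norm (G x) \<le> B" and "0 \<le> B"
    and cont: "continuous_on {x. x \<bullet> e \<le> \<Gamma> x} f"
  shows "(B * (2 * L + 1))-lipschitz_on {x. x \<bullet> e \<le> \<Gamma> x} f"
proof -
  let ?A = "{x. x \<bullet> e < \<Gamma> x}"
  have ee: "e \<bullet> e = 1" using e by (simp add: norm_eq_1)
  have L: "0 \<le> L" using lip lipschitz_on_nonneg by blast
  have \<Gamma>L: "\<bar>\<Gamma> y - \<Gamma> x\<bar> \<le> L * norm (y - x)" for x y
    using lipschitz_onD[OF lip, of y x] by (simp add: dist_norm)
  have const': "\<Gamma> (x - h *\<^sub>R e) = \<Gamma> x" for x h
    using const[of x "- h"] by simp
  have seg: "\<bar>f x - f y\<bar> \<le> B * norm (x - y)" if "closed_segment x y \<subseteq> ?A" for x y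
  proof -
    have "norm (f x - f y) \<le> B * norm (x - y)"
    proof (rule differentiable_bound[of "closed_segment x y" f "\<lambda>z h. G z \<bullet> h"])
      fix z assume "z \<in> closed_segment x y"
      then have z: "z \<bullet> e < \<Gamma> z" using that by blast
      show "(f has_derivative (\<lambda>h. G z \<bullet> h)) (at z within closed_segment x y)"
        using der[OF z] by (rule has_derivative_at_withinI)
      show "onorm (\<lambda>h. G z \<bullet> h) \<le> B"
      proof (rule onorm_le)
        fix h
        have "norm (G z \<bullet> h) \<le> norm (G z) * norm h" by (simp add: Cauchy_Schwarz_ineq2)
        also have "\<dots> \<le> B * norm h" using bnd[OF z] by (intro mult_right_mono) auto
        finally show "norm (G z \<bullet> h) \<le> B * norm h" .
      qed
    qed auto
    then show ?thesis by simp
  qed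
  have down: "closed_segment x (x - s *\<^sub>R e) \<subseteq> ?A" if "x \<bullet> e < \<Gamma> x" "0 \<le> s" for x s
  proof
    fix z assume "z \<in> closed_segment x (x - s *\<^sub>R e)"
    then obtain \<theta> where \<theta>: "0 \<le> \<theta>" "\<theta> \<le> 1" "z = (1 - \<theta>) *\<^sub>R x + \<theta> *\<^sub>R (x - s *\<^sub>R e)"
      by (auto simp: closed_segment_def)
    then have z: "z = x - (\<theta> * s) *\<^sub>R e" by (simp add: algebra_simps)
    have "z \<bullet> e = x \<bullet> e - \<theta> * s" unfolding z by (simp add: inner_diff_left ee)
    moreover have "0 \<le> \<theta> * s" using \<theta> \<open>0 \<le> s\<close> by simp
    moreover have "\<Gamma> z = \<Gamma> x" unfolding z by (rule const')
    ultimately show "z \<in> ?A" using \<open>x \<bullet> e < \<Gamma> x\<close> by simp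
  qed
  have "(B * (2 * L + 1))-lipschitz_on ?A f"
  proof (rule lipschitz_onI)
    fix x y assume "x \<in> ?A" "y \<in> ?A"
    then have xy: "x \<bullet> e < \<Gamma> x" "y \<bullet> e < \<Gamma> y" by auto
    define s where "s = L * norm (x - y)"
    have s: "0 \<le> s" using L by (simp add: s_def)
    have across: "closed_segment (x - s *\<^sub>R e) (y - s *\<^sub>R e) \<subseteq> ?A"
    proof
      fix z assume "z \<in> closed_segment (x - s *\<^sub>R e) (y - s *\<^sub>R e)"
      then obtain \<theta> where \<theta>: "0 \<le> \<theta>" "\<theta> \<le> 1" "z = (1 - \<theta>) *\<^sub>R (x - s *\<^sub>R e) + \<theta> *\<^sub>R (y - s *\<^sub>R e)"
        by (auto simp: closed_segment_def)
      define w where "w = (1 - \<theta>) *\<^sub>R x + \<theta> *\<^sub>R y"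
      have z: "z = w - s *\<^sub>R e" using \<theta> by (simp add: w_def algebra_simps)
      have "x - w = \<theta> *\<^sub>R (x - y)"
        by (simp add: w_def scaleR_left_diff_distrib scaleR_right_diff_distrib)
      then have "norm (x - w) = \<theta> * norm (x - y)" using \<theta> by simp
      moreover have "y - w = (1 - \<theta>) *\<^sub>R (y - x)"
        by (simp add: w_def scaleR_left_diff_distrib scaleR_right_diff_distrib)
      then have "norm (y - w) = (1 - \<theta>) * norm (x - y)" using \<theta> by (simp add: norm_minus_commute)
      ultimately have "norm (x - w) \<le> norm (x - y)" "norm (y - w) \<le> norm (x - y)"
        using \<theta>(1,2) by (simp_all add: mult_left_le_one_le)
      then have "L * norm (x - w) \<le> s" "L * norm (y - w) \<le> s"
        using L by (simp_all add: s_def mult_left_mono)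
      then have "x \<bullet> e < \<Gamma> w + s" "y \<bullet> e < \<Gamma> w + s"
        using \<Gamma>L[of x w] \<Gamma>L[of y w] xy by (auto simp: abs_le_iff)
      then have "0 < \<Gamma> w + s - x \<bullet> e" "0 < \<Gamma> w + s - y \<bullet> e" by auto
      then have "0 < (1 - \<theta>) * (\<Gamma> w + s - x \<bullet> e) + \<theta> * (\<Gamma> w + s - y \<bullet> e)"
        using \<theta>(1,2) by (cases "\<theta> = 0") (auto intro!: add_nonneg_pos)
      also have "\<dots> = \<Gamma> w + s - w \<bullet> e" by (simp add: w_def inner_add_left algebra_simps)
      finally have "w \<bullet> e - s < \<Gamma> w" by simp
      then show "z \<in> ?A" unfolding z by (simp add: const' inner_diff_left ee)
    qed
    have "\<bar>f x - f (x - s *\<^sub>R e)\<bar> \<le> B * s" using seg[OF down[OF xy(1) s]] s e by simp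
    moreover have "\<bar>f y - f (y - s *\<^sub>R e)\<bar> \<le> B * s" using seg[OF down[OF xy(2) s]] s e by simp
    moreover have "\<bar>f (x - s *\<^sub>R e) - f (y - s *\<^sub>R e)\<bar> \<le> B * norm (x - y)"
      using seg[OF across] by simp
    ultimately have "\<bar>f x - f y\<bar> \<le> 2 * (B * s) + B * norm (x - y)" by linarith
    then show "dist (f x) (f y) \<le> B * (2 * L + 1) * dist x y"
      by (simp add: dist_norm s_def algebra_simps)
  qed (use L \<open>0 \<le> B\<close> in simp)
  moreover have clos: "closure ?A = {x. x \<bullet> e \<le> \<Gamma> x}"
  proof
    have "continuous_on UNIV \<Gamma>" using lip lipschitz_on_continuous_on by blast
    then have "closed {x. x \<bullet> e \<le> \<Gamma> x}" by (intro closed_Collect_le continuous_intros) auto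
    then show "closure ?A \<subseteq> {x. x \<bullet> e \<le> \<Gamma> x}" by (intro closure_minimal) auto
  next
    show "{x. x \<bullet> e \<le> \<Gamma> x} \<subseteq> closure ?A"
    proof
      fix x assume x: "x \<in> {x. x \<bullet> e \<le> \<Gamma> x}"
      show "x \<in> closure ?A"
        unfolding closure_approachable
      proof (intro allI impI)
        fix \<epsilon> :: real assume "0 < \<epsilon>"
        then show "\<exists>y\<in>?A. dist y x < \<epsilon>"
          using x e by (intro bexI[of _ "x - (\<epsilon> / 2) *\<^sub>R e"])
            (simp_all add: const' inner_diff_left ee dist_norm)
      qed
    qed
  qed
  ultimately show ?thesis
    using lipschitz_on_closure[of "B * (2 * L + 1)" ?A f] cont by (simp only: clos)
qed

text \<open>
  Extend by reflection in the graph along \<open>e\<close>. The reflection is Lipschitz and moves a point above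
  the graph by twice the distance, along \<open>e\<close>, of its image to the graph, so that bounded support is
  kept; a constant extension along \<open>e\<close> would not have bounded support.
\<close>

lemma lipschitz_extension_across_graph:
  fixes f \<Gamma> :: "'a::euclidean_space \<Rightarrow> real"
  assumes e: "norm e = 1" and lip: "L-lipschitz_on UNIV \<Gamma>"
    and const: "\<And>x h. \<Gamma> (x + h *\<^sub>R e) = \<Gamma> x"
    and lipf: "C-lipschitz_on {x. x \<bullet> e \<le> \<Gamma> x} f"
    and supp: "\<And>x. x \<bullet> e \<le> \<Gamma> x \<Longrightarrow> R < norm x \<Longrightarrow> f x = 0"
  obtains F C' R' where "C'-lipschitz_on UNIV F" "\<And>x. x \<bullet> e \<le> \<Gamma> x \<Longrightarrow> F x = f x"
    "\<And>x. R' < norm x \<Longrightarrow> F x = 0"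
proof
  have ee: "e \<bullet> e = 1" using e by (simp add: norm_eq_1)
  have L: "0 \<le> L" using lip lipschitz_on_nonneg by blast
  have C: "0 \<le> C" using lipf lipschitz_on_nonneg by blast
  have \<Gamma>L: "\<bar>\<Gamma> y - \<Gamma> x\<bar> \<le> L * norm (y - x)" for x y
    using lipschitz_onD[OF lip, of y x] by (simp add: dist_norm)
  define \<tau> where "\<tau> x = max 0 (x \<bullet> e - \<Gamma> x)" for x
  \<comment> \<open>The identity below the graph, the reflection above it.\<close>
  define \<rho> where "\<rho> x = x - (2 * \<tau> x) *\<^sub>R e" for x
  have \<tau>0: "0 \<le> \<tau> x" for x by (simp add: \<tau>_def)
  have \<Gamma>\<rho>: "\<Gamma> (\<rho> x) = \<Gamma> x" for x using const[of x "- (2 * \<tau> x)"] by (simp add: \<rho>_def)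
  have \<rho>e: "\<rho> x \<bullet> e = x \<bullet> e - 2 * \<tau> x" for x by (simp add: \<rho>_def inner_diff_left ee)
  have \<rho>_in: "\<rho> x \<bullet> e \<le> \<Gamma> (\<rho> x)" for x
    unfolding \<Gamma>\<rho> \<rho>e by (simp add: \<tau>_def max_def)
  have \<tau>L: "\<bar>\<tau> x - \<tau> y\<bar> \<le> (L + 1) * norm (x - y)" for x y
  proof -
    have "\<bar>(x - y) \<bullet> e\<bar> \<le> norm (x - y)" using Cauchy_Schwarz_ineq2[of "x - y" e] e by simp
    then have "\<bar>(x \<bullet> e - \<Gamma> x) - (y \<bullet> e - \<Gamma> y)\<bar> \<le> L * norm (x - y) + norm (x - y)"
      using \<Gamma>L[of x y] unfolding inner_diff_left by linarith
    moreover have "\<bar>\<tau> x - \<tau> y\<bar> \<le> \<bar>(x \<bullet> e - \<Gamma> x) - (y \<bullet> e - \<Gamma> y)\<bar>"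
      unfolding \<tau>_def by (auto simp: max_def)
    ultimately show ?thesis by (simp add: distrib_right)
  qed
  show "(C * (2 * L + 3))-lipschitz_on UNIV (\<lambda>x. f (\<rho> x))"
  proof (rule lipschitz_onI)
    fix x y
    have "norm (\<rho> x - \<rho> y) = norm ((x - y) - (2 * (\<tau> x - \<tau> y)) *\<^sub>R e)"
      by (simp add: \<rho>_def algebra_simps)
    also have "\<dots> \<le> norm (x - y) + norm ((2 * (\<tau> x - \<tau> y)) *\<^sub>R e)" by (rule norm_triangle_ineq4)
    also have "norm ((2 * (\<tau> x - \<tau> y)) *\<^sub>R e) = 2 * \<bar>\<tau> x - \<tau> y\<bar>"
      by (simp only: norm_scaleR e abs_mult)
    finally have \<rho>L: "norm (\<rho> x - \<rho> y) \<le> (2 * L + 3) * norm (x - y)"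
      using \<tau>L[of x y] by (simp add: algebra_simps)
    have "dist (f (\<rho> x)) (f (\<rho> y)) \<le> C * norm (\<rho> x - \<rho> y)"
      using lipschitz_onD[OF lipf, of "\<rho> x" "\<rho> y"] \<rho>_in by (simp add: dist_norm)
    also have "\<dots> \<le> C * ((2 * L + 3) * norm (x - y))" using \<rho>L C by (rule mult_left_mono)
    finally show "dist (f (\<rho> x)) (f (\<rho> y)) \<le> C * (2 * L + 3) * dist x y" by (simp add: dist_norm)
  qed (use L C in simp)
  show "f (\<rho> x) = f x" if "x \<bullet> e \<le> \<Gamma> x" for x using that by (simp add: \<rho>_def \<tau>_def)
  show "f (\<rho> x) = 0" if x: "\<bar>R\<bar> + 2 * (\<bar>\<Gamma> 0\<bar> + L * \<bar>R\<bar> + \<bar>R\<bar>) < norm x" for x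
  proof (cases "R < norm (\<rho> x)")
    case True
    then show ?thesis using supp \<rho>_in by blast
  next
    case False
    have "\<bar>\<Gamma> (\<rho> x)\<bar> \<le> \<bar>\<Gamma> 0\<bar> + L * norm (\<rho> x)" using \<Gamma>L[of "\<rho> x" 0] by simp
    also have "\<dots> \<le> \<bar>\<Gamma> 0\<bar> + L * \<bar>R\<bar>" using False L by (intro add_left_mono mult_left_mono) auto
    finally have 1: "\<bar>\<Gamma> (\<rho> x)\<bar> \<le> \<bar>\<Gamma> 0\<bar> + L * \<bar>R\<bar>" .
    have 2: "\<bar>\<rho> x \<bullet> e\<bar> \<le> \<bar>R\<bar>" using Cauchy_Schwarz_ineq2[of "\<rho> x" e] e False by simp
    have "\<tau> x \<le> \<bar>\<Gamma> (\<rho> x)\<bar> + \<bar>\<rho> x \<bullet> e\<bar>" unfolding \<Gamma>\<rho> \<rho>e by (simp add: \<tau>_def max_def abs_if)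
    also have "\<dots> \<le> \<bar>\<Gamma> 0\<bar> + L * \<bar>R\<bar> + \<bar>R\<bar>" using 1 2 by (rule add_mono)
    finally have 3: "\<tau> x \<le> \<bar>\<Gamma> 0\<bar> + L * \<bar>R\<bar> + \<bar>R\<bar>" .
    have "norm x = norm (\<rho> x + (2 * \<tau> x) *\<^sub>R e)" by (simp add: \<rho>_def)
    also have "\<dots> \<le> norm (\<rho> x) + norm ((2 * \<tau> x) *\<^sub>R e)" by (rule norm_triangle_ineq)
    also have "norm ((2 * \<tau> x) *\<^sub>R e) = 2 * \<tau> x" using \<tau>0[of x] e by simp
    also have "norm (\<rho> x) + 2 * \<tau> x \<le> \<bar>R\<bar> + 2 * (\<bar>\<Gamma> 0\<bar> + L * \<bar>R\<bar> + \<bar>R\<bar>)"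
      using False 3 by (intro add_mono mult_left_mono) auto
    finally have False using x by (rule leD[THEN notE])
    then show ?thesis ..
  qed
qed

text \<open>
  A point on the graph is approached by the points of \<open>\<Omega>\<close> below it, and the points of \<open>U\<close> above the graph
  form an open set disjoint from \<open>\<Omega>\<close>.
\<close>

lemma boundary_chart_geometry:
  assumes chart: "boundary_chart \<Omega> U e \<Gamma>" and "open \<Omega>"
  shows "{x \<in> U. x \<bullet> e \<le> \<Gamma> x} \<subseteq> closure \<Omega>"
    and "U \<inter> frontier \<Omega> = {x \<in> U. x \<bullet> e = \<Gamma> x}"
proof -
  from chart obtain L where U: "open U" and e: "norm e = 1" and lip: "L-lipschitz_on UNIV \<Gamma>"
    and const: "\<And>x h. \<Gamma> (x + h *\<^sub>R e) = \<Gamma> x" and \<Omega>U: "\<Omega> \<inter> U = {x \<in> U. x \<bullet> e < \<Gamma> x}"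
    unfolding boundary_chart_def by blast
  have ee: "e \<bullet> e = 1" using e by (simp add: norm_eq_1)
  have cont: "continuous_on UNIV \<Gamma>" using lip lipschitz_on_continuous_on by blast
  show sub: "{x \<in> U. x \<bullet> e \<le> \<Gamma> x} \<subseteq> closure \<Omega>"
  proof
    fix x assume x: "x \<in> {x \<in> U. x \<bullet> e \<le> \<Gamma> x}"
    then have "x \<in> U" by blast
    with U have "\<exists>\<delta>>0. ball x \<delta> \<subseteq> U" unfolding open_contains_ball by blast
    then obtain \<delta> where \<delta>: "0 < \<delta>" "ball x \<delta> \<subseteq> U" by blast
    show "x \<in> closure \<Omega>"
      unfolding closure_approachable
    proof (intro allI impI)
      fix \<epsilon> :: real assume "0 < \<epsilon>"
      define s where "s = min \<epsilon> \<delta> / 2"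
      have s: "0 < s" "s < \<epsilon>" "s < \<delta>" using \<open>0 < \<epsilon>\<close> \<delta> by (auto simp: s_def)
      define y where "y = x - s *\<^sub>R e"
      have d: "dist y x = s" using s e by (simp add: y_def dist_norm)
      then have "y \<in> U" using \<delta>(2) s by (auto simp: dist_commute)
      moreover have "y \<bullet> e < \<Gamma> y"
        using x s const[of x "- s"] by (simp add: y_def inner_diff_left ee)
      ultimately have "y \<in> \<Omega>" using \<Omega>U by blast
      then show "\<exists>y\<in>\<Omega>. dist y x < \<epsilon>" using d s by blast
    qed
  qed
  have "closed {x. x \<bullet> e \<le> \<Gamma> x}" using cont by (intro closed_Collect_le continuous_intros) auto
  then have "open (U \<inter> - {x. x \<bullet> e \<le> \<Gamma> x})" using U by (intro open_Int) auto
  moreover have "(U \<inter> - {x. x \<bullet> e \<le> \<Gamma> x}) \<inter> \<Omega> = {}" using \<Omega>U by force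
  ultimately have "(U \<inter> - {x. x \<bullet> e \<le> \<Gamma> x}) \<inter> closure \<Omega> = {}"
    by (simp add: open_Int_closure_eq_empty)
  then have clos: "U \<inter> closure \<Omega> = {x \<in> U. x \<bullet> e \<le> \<Gamma> x}" using sub by blast
  have "frontier \<Omega> = closure \<Omega> - \<Omega>" using \<open>open \<Omega>\<close> by (simp add: frontier_def interior_open)
  then have "U \<inter> frontier \<Omega> = (U \<inter> closure \<Omega>) - (\<Omega> \<inter> U)" by blast
  then show "U \<inter> frontier \<Omega> = {x \<in> U. x \<bullet> e = \<Gamma> x}" unfolding clos \<Omega>U by force
qed

text \<open>
  As \<open>f\<close> vanishes near the complement of \<open>U\<close>, its restriction to \<open>U\<close> extended by zero is a function on the
  whole closed subgraph with bounded gradient. It is then extended across the graph, and the subgraph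
  theorem applies.
\<close>

lemma volume_integral_in_chart:
  fixes f :: "'a::euclidean_space \<Rightarrow> real"
  assumes chart: "boundary_chart \<Omega> U e \<Gamma>" and \<Omega>: "open \<Omega>" "bounded \<Omega>"
    and f: "C1_gradient \<Omega> f G" and pr: "cball p r \<subseteq> U"
    and f0: "\<And>x. x \<notin> ball p r \<Longrightarrow> f x = 0" and G0: "\<And>x. x \<in> \<Omega> \<Longrightarrow> x \<notin> ball p r \<Longrightarrow> G x = 0"
    and v: "norm v = 1"
    and g: "g \<in> borel_measurable borel"
      "AE x in lborel. ((\<lambda>h. \<Gamma> (x + h *\<^sub>R v)) has_real_derivative g x) (at 0)"
  shows "(\<integral>x. indicator \<Omega> x * (G x \<bullet> v) \<partial>lborel) = (\<integral>x. indicator {0..1} (x \<bullet> e) *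
      (indicator (U \<inter> frontier \<Omega>) (graph_point e \<Gamma> x) * f (graph_point e \<Gamma> x) * (e \<bullet> v - g x)) \<partial>lborel)"
proof -
  from chart obtain L where U: "open U" and e: "norm e = 1" and lip: "L-lipschitz_on UNIV \<Gamma>"
    and const: "\<And>x h. \<Gamma> (x + h *\<^sub>R e) = \<Gamma> x" and \<Omega>U: "\<Omega> \<inter> U = {x \<in> U. x \<bullet> e < \<Gamma> x}"
    unfolding boundary_chart_def by blast
  note geo = boundary_chart_geometry[OF chart \<Omega>(1)]
  have ee: "e \<bullet> e = 1" using e by (simp add: norm_eq_1)
  define f0 where "f0 x = (if x \<in> closure \<Omega> \<inter> U then f x else 0)" for x
  define G0 where "G0 x = (if x \<in> \<Omega> \<inter> U then G x else 0)" for x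
  have f0_out: "f0 x = 0" if "x \<notin> ball p r" for x using f0[OF that] by (simp add: f0_def)
  have der: "(f0 has_derivative (\<lambda>h. G0 x \<bullet> h)) (at x)" if x: "x \<bullet> e < \<Gamma> x" for x
  proof (cases "x \<in> U")
    case True
    then have x\<Omega>: "x \<in> \<Omega> \<inter> U" using x \<Omega>U by blast
    have "(f has_derivative (\<lambda>h. G0 x \<bullet> h)) (at x)"
      using f x\<Omega> by (simp add: C1_gradient_def G0_def)
    then show ?thesis
      by (rule has_derivative_transform_within_open[of _ _ _ _ "\<Omega> \<inter> U"])
        (use x\<Omega> \<Omega> U closure_subset in \<open>auto simp: f0_def\<close>)
  next
    case False
    have "((\<lambda>_. 0) has_derivative (\<lambda>h. G0 x \<bullet> h)) (at x)"
      using False by (simp add: G0_def)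
    then show ?thesis
      by (rule has_derivative_transform_within_open[of _ _ _ _ "- cball p r"])
        (use False pr f0_out in auto)
  qed
  have "compact (closure \<Omega>)" using \<Omega> by simp
  then have "bounded (G ` closure \<Omega>)"
    using f by (intro compact_imp_bounded compact_continuous_image) (auto simp: C1_gradient_def)
  then obtain B where B: "0 < B" "\<And>x. x \<in> closure \<Omega> \<Longrightarrow> norm (G x) \<le> B"
    by (auto simp: bounded_pos)
  have bnd: "norm (G0 x) \<le> B" for x
    using B closure_subset[of \<Omega>] by (auto simp: G0_def)
  let ?S = "{x. x \<bullet> e \<le> \<Gamma> x}"
  have "continuous_on (?S \<inter> U \<union> ?S \<inter> - cball p r) f0"
  proof (rule continuous_on_Un_local_open)
    have S: "?S \<inter> U \<union> ?S \<inter> - cball p r = ?S" using pr by blast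
    show "openin (top_of_set (?S \<inter> U \<union> ?S \<inter> - cball p r)) (?S \<inter> U)"
      "openin (top_of_set (?S \<inter> U \<union> ?S \<inter> - cball p r)) (?S \<inter> - cball p r)"
      unfolding S using U by (auto intro: openin_open_Int)
    have "continuous_on (?S \<inter> U) f"
      using f geo(1) by (auto simp: C1_gradient_def intro: continuous_on_subset)
    then show "continuous_on (?S \<inter> U) f0"
      by (rule continuous_on_eq) (use geo(1) in \<open>auto simp: f0_def\<close>)
    show "continuous_on (?S \<inter> - cball p r) f0"
      by (rule continuous_on_eq[OF continuous_on_const[of _ 0]]) (use f0_out in auto)
  qed
  moreover have "?S \<inter> U \<union> ?S \<inter> - cball p r = ?S" using pr by blast
  ultimately have cont: "continuous_on ?S f0" by simp
  have lipf0: "(B * (2 * L + 1))-lipschitz_on ?S f0"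
    using B by (intro lipschitz_on_subgraph[OF e lip const der bnd _ cont]) auto
  have supp: "f0 x = 0" if "norm p + \<bar>r\<bar> < norm x" for x
  proof (rule f0_out)
    have "norm x \<le> norm p + dist p x" using norm_triangle_ineq[of p "x - p"]
      by (simp add: dist_norm norm_minus_commute)
    then show "x \<notin> ball p r" using that by auto
  qed
  obtain F C R where F: "C-lipschitz_on UNIV F" "\<And>x. x \<bullet> e \<le> \<Gamma> x \<Longrightarrow> F x = f0 x"
    "\<And>x. R < norm x \<Longrightarrow> F x = 0"
    using lipschitz_extension_across_graph[OF e lip const lipf0 supp] by metis
  have cont\<Gamma>: "continuous_on UNIV \<Gamma>" using lip lipschitz_on_continuous_on by blast
  have diffF: "((\<lambda>h. F (x + h *\<^sub>R v)) has_real_derivative G0 x \<bullet> v) (at 0)" if x: "x \<bullet> e < \<Gamma> x" for x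
  proof -
    have "open {x. x \<bullet> e < \<Gamma> x}" using cont\<Gamma> by (intro open_Collect_less continuous_intros) auto
    then have "(F has_derivative (\<lambda>h. G0 x \<bullet> h)) (at x)"
      by (rule has_derivative_transform_within_open[OF der[OF x]]) (use x F(2) in auto)
    then have "(F has_derivative (\<lambda>h. G0 x \<bullet> h)) (at (x + 0 *\<^sub>R v))" by simp
    moreover have "((\<lambda>h. x + h *\<^sub>R v) has_derivative (\<lambda>h. h *\<^sub>R v)) (at 0)"
      by (auto intro!: derivative_eq_intros)
    ultimately have "((\<lambda>h. F (x + h *\<^sub>R v)) has_derivative (\<lambda>h. G0 x \<bullet> (h *\<^sub>R v))) (at 0)"
      by (rule has_derivative_compose[rotated])
    then show ?thesis by (simp add: has_field_derivative_def mult_commute_abs)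
  qed
  have "(\<integral>x. indicator \<Omega> x * (G x \<bullet> v) \<partial>lborel) = (\<integral>x. indicator {x. x \<bullet> e < \<Gamma> x} x * (G0 x \<bullet> v) \<partial>lborel)"
  proof (intro Bochner_Integration.integral_cong refl)
    fix x
    show "indicator \<Omega> x * (G x \<bullet> v) = indicator {x. x \<bullet> e < \<Gamma> x} x * (G0 x \<bullet> v)"
    proof (cases "x \<in> U")
      case True
      then have "x \<in> \<Omega> \<longleftrightarrow> x \<bullet> e < \<Gamma> x" using \<Omega>U by blast
      with True show ?thesis by (simp add: indicator_def G0_def)
    next
      case False
      then have "x \<notin> ball p r" using pr ball_subset_cball by blast
      with False G0 show ?thesis by (cases "x \<in> \<Omega>") (simp_all add: G0_def)
    qed
  qed
  also have "\<dots> = (\<integral>x. indicator {0..1} (x \<bullet> e) * (F (graph_point e \<Gamma> x) * (e \<bullet> v - g x)) \<partial>lborel)"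
    by (rule subgraph_integral_directional_derivative[OF e lip const F(1,3) v diffF g])
  also have "\<dots> = (\<integral>x. indicator {0..1} (x \<bullet> e) *
      (indicator (U \<inter> frontier \<Omega>) (graph_point e \<Gamma> x) * f (graph_point e \<Gamma> x) * (e \<bullet> v - g x)) \<partial>lborel)"
  proof (intro Bochner_Integration.integral_cong refl)
    fix x
    let ?y = "graph_point e \<Gamma> x"
    have y: "?y \<bullet> e = \<Gamma> ?y" unfolding graph_point_def const by (simp add: inner_add_left ee)
    then have "F ?y = f0 ?y" using F(2) by simp
    also have "\<dots> = indicator (U \<inter> frontier \<Omega>) ?y * f ?y"
      unfolding geo(2) using y geo(1) by (auto simp: f0_def indicator_def)
    finally show "indicator {0..1} (x \<bullet> e) * (F ?y * (e \<bullet> v - g x))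
      = indicator {0..1} (x \<bullet> e) * (indicator (U \<inter> frontier \<Omega>) ?y * f ?y * (e \<bullet> v - g x))" by simp
  qed
  finally show ?thesis .
qed

section \<open>The surface integral in a boundary chart\<close>

text \<open>
  On \<open>U \<inter> frontier \<Omega>\<close> the surface measure is the image under \<^const>\<open>graph_point\<close> of the measure
  with density \<open>sqrt (1 + |\<nabla>\<Gamma>|\<^sup>2)\<close> on the slab. This density cancels against the denominator of the
  normal, and what is left of \<open>n \<bullet> v\<close> is \<open>e \<bullet> v - \<partial>\<^sub>v \<Gamma>\<close>.
\<close>

lemma surface_integral_in_chart:
  fixes \<phi> :: "'a::euclidean_space \<Rightarrow> real"
  assumes \<sigma>: "is_surface_measure \<Omega> \<sigma>" and n: "is_outward_normal \<Omega> \<sigma> n"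
    and chart: "boundary_chart \<Omega> U e \<Gamma>"
    and \<phi>: "\<phi> \<in> borel_measurable borel" and bnd: "\<And>x. \<bar>\<phi> x\<bar> \<le> M"
    and supp: "\<And>x. x \<notin> ball p r \<Longrightarrow> \<phi> x = 0" and \<phi>W: "\<And>x. x \<notin> U \<inter> frontier \<Omega> \<Longrightarrow> \<phi> x = 0"
    and v: "v \<in> Basis"
    and g: "g \<in> borel_measurable borel"
      "AE x in lborel. ((\<lambda>h. \<Gamma> (x + h *\<^sub>R v)) has_real_derivative g x) (at 0)"
      "AE x in lborel. \<bar>g x\<bar> \<le> L'"
  shows "integrable \<sigma> (\<lambda>x. \<phi> x * (n x \<bullet> v))"
    and "(\<integral>x. \<phi> x * (n x \<bullet> v) \<partial>\<sigma>)
      = (\<integral>x. indicator {0..1} (x \<bullet> e) * (\<phi> (graph_point e \<Gamma> x) * (e \<bullet> v - g x)) \<partial>lborel)"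
proof -
  from chart obtain L where U: "open U" and e: "norm e = 1" and lip: "L-lipschitz_on UNIV \<Gamma>"
    and const: "\<And>x h. \<Gamma> (x + h *\<^sub>R e) = \<Gamma> x"
    unfolding boundary_chart_def by blast
  have [measurable_cong]: "sets \<sigma> = sets borel" using \<sigma> by (simp add: is_surface_measure_def)
  have space_\<sigma>: "space \<sigma> = UNIV" using sets_eq_imp_space_eq[OF \<open>sets \<sigma> = sets borel\<close>] by simp
  have [measurable]: "n \<in> borel_measurable borel" using n by (simp add: is_outward_normal_def)
  have cont\<Gamma>: "continuous_on UNIV \<Gamma>" using lip lipschitz_on_continuous_on by blast
  have [measurable]: "\<Gamma> \<in> borel_measurable borel"
    using cont\<Gamma> by (rule borel_measurable_continuous_onI)
  note \<phi>[measurable] g(1)[measurable]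
  let ?gp = "graph_point e \<Gamma>"
  have [measurable]: "?gp \<in> borel_measurable borel"
    unfolding graph_point_def by measurable
  define W where "W = U \<inter> frontier \<Omega>"
  have [measurable]: "W \<in> sets borel" unfolding W_def using U by (intro sets.Int) auto
  have "\<forall>i\<in>Basis. \<exists>k. k \<in> borel_measurable borel \<and>
      (AE x in lborel. ((\<lambda>h. \<Gamma> (x + h *\<^sub>R i)) has_real_derivative k x) (at 0))"
  proof
    fix i :: 'a assume i: "i \<in> Basis"
    obtain k where "k \<in> borel_measurable borel"
      "AE x in lborel. ((\<lambda>h. \<Gamma> (x + h *\<^sub>R i)) has_real_derivative k x) (at 0)"
      by (rule lipschitz_directional_derivative_borel[OF lip norm_Basis[OF i]])
    then show "\<exists>k. k \<in> borel_measurable borel \<and>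
      (AE x in lborel. ((\<lambda>h. \<Gamma> (x + h *\<^sub>R i)) has_real_derivative k x) (at 0))" by blast
  qed
  from bchoice[OF this] obtain k where k: "\<And>i. i \<in> Basis \<Longrightarrow> k i \<in> borel_measurable borel"
    "\<And>i. i \<in> Basis \<Longrightarrow> AE x in lborel. ((\<lambda>h. \<Gamma> (x + h *\<^sub>R i)) has_real_derivative k i x) (at 0)"
    by blast
  define gr where "gr x = (\<Sum>i\<in>Basis. k i x *\<^sub>R i)" for x
  have [measurable]: "gr \<in> borel_measurable borel"
    unfolding gr_def using k(1) by measurable
  have AE_gr: "AE x in lborel. grad \<Gamma> x = gr x"
  proof -
    have "AE x in lborel. \<forall>i\<in>Basis. ((\<lambda>h. \<Gamma> (x + h *\<^sub>R i)) has_real_derivative k i x) (at 0)"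
      by (rule AE_finite_allI) (use k(2) in auto)
    then show ?thesis
      by eventually_elim (auto simp: grad_def gr_def pderiv_at_def DERIV_imp_deriv intro!: sum.cong)
  qed
  define w where "w x = sqrt (1 + (norm (gr x))\<^sup>2)" for x
  have [measurable]: "w \<in> borel_measurable borel" unfolding w_def by measurable
  have w: "1 \<le> w x" for x by (simp add: w_def)
  define M1 where "M1 = density lborel (\<lambda>x. ennreal (indicator {0..1} (x \<bullet> e) * w x))"
  define M2 where "M2 = distr M1 borel ?gp"
  have [measurable_cong]: "sets M1 = sets borel" "sets M2 = sets borel"
    by (simp_all add: M1_def M2_def)
  have \<sigma>M: "emeasure \<sigma> A = emeasure M2 A" if A[measurable]: "A \<in> sets borel" and "A \<subseteq> W" for A
  proof -
    have "emeasure \<sigma> A = (\<integral>\<^sup>+x. ennreal (indicator {0..1} (x \<bullet> e) * indicator A (?gp x) *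
                   sqrt (1 + (norm (grad \<Gamma> x))\<^sup>2)) \<partial>lborel)"
      using \<sigma> chart that unfolding is_surface_measure_def W_def by blast
    also have "\<dots> = (\<integral>\<^sup>+x. ennreal (indicator {0..1} (x \<bullet> e) * w x) * indicator (?gp -` A) x \<partial>lborel)"
    proof (rule nn_integral_cong_AE)
      show "AE x in lborel. ennreal (indicator {0..1} (x \<bullet> e) * indicator A (?gp x) * sqrt (1 + (norm (grad \<Gamma> x))\<^sup>2))
        = ennreal (indicator {0..1} (x \<bullet> e) * w x) * indicator (?gp -` A) x"
        using AE_gr by eventually_elim (auto simp: w_def indicator_def)
    qed
    also have "\<dots> = emeasure M1 (?gp -` A \<inter> space M1)"
    proof -
      have "?gp -` A \<in> sets borel" using measurable_sets_borel[OF \<open>?gp \<in> borel_measurable borel\<close> A] .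
      moreover have "space M1 = UNIV" by (simp add: M1_def)
      ultimately show ?thesis unfolding M1_def by (subst emeasure_density) (auto simp: M1_def)
    qed
    also have "\<dots> = emeasure M2 A"
      unfolding M2_def by (subst emeasure_distr) auto
    finally show ?thesis .
  qed
  \<comment> \<open>Restricted to \<open>W\<close> the measures \<open>\<sigma>\<close> and \<open>M2\<close> agree, so integrals over \<open>W\<close> can be moved between them.\<close>
  have dens: "density \<sigma> (\<lambda>x. ennreal (indicator W x)) = density M2 (\<lambda>x. ennreal (indicator W x))"
  proof (rule measure_eqI)
    fix X assume "X \<in> sets (density \<sigma> (\<lambda>x. ennreal (indicator W x)))"
    then have X[measurable]: "X \<in> sets borel" using \<open>sets \<sigma> = sets borel\<close> by simp
    have eq: "ennreal (indicator W x) * indicator X x = indicator (W \<inter> X) x" for x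
      by (simp add: indicator_def)
    have "emeasure \<sigma> (W \<inter> X) = emeasure M2 (W \<inter> X)" by (rule \<sigma>M) auto
    then show "emeasure (density \<sigma> (\<lambda>x. ennreal (indicator W x))) X = emeasure (density M2 (\<lambda>x. ennreal (indicator W x))) X"
      by (simp add: emeasure_density eq)
  qed (simp add: \<open>sets \<sigma> = sets borel\<close> M2_def)
  have AE_n: "AE x in lborel. x \<bullet> e \<in> {0..1} \<longrightarrow> ?gp x \<in> W \<longrightarrow>
      n (?gp x) = (1 / sqrt (1 + (norm (grad \<Gamma> (?gp x)))\<^sup>2)) *\<^sub>R (e - grad \<Gamma> (?gp x))"
  proof -
    define N where "N x = (1 / sqrt (1 + (norm (grad \<Gamma> x))\<^sup>2)) *\<^sub>R (e - grad \<Gamma> x)" for x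
    have "AE x in \<sigma>. x \<in> W \<longrightarrow> n x = N x"
      using n chart unfolding is_outward_normal_def W_def N_def by blast
    then obtain Z where Z: "{x \<in> space \<sigma>. \<not> (x \<in> W \<longrightarrow> n x = N x)} \<subseteq> Z" "emeasure \<sigma> Z = 0" "Z \<in> sets \<sigma>"
      by (rule AE_E)
    then have [measurable]: "Z \<in> sets borel" using \<open>sets \<sigma> = sets borel\<close> by simp
    have "emeasure M2 (Z \<inter> W) = emeasure \<sigma> (Z \<inter> W)" by (rule \<sigma>M[symmetric]) auto
    also have "\<dots> \<le> emeasure \<sigma> Z" using Z(3) by (intro emeasure_mono) auto
    finally have "emeasure M2 (Z \<inter> W) = 0" using Z(2) by simp
    then have "Z \<inter> W \<in> null_sets M2" by (intro null_setsI) auto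
    then have "AE y in M2. y \<notin> Z \<inter> W" by (rule AE_not_in)
    then have "AE x in M1. ?gp x \<notin> Z \<inter> W"
      unfolding M2_def by (rule AE_distrD[rotated]) simp
    then have "AE x in lborel. 0 < ennreal (indicator {0..1} (x \<bullet> e) * w x) \<longrightarrow> ?gp x \<notin> Z \<inter> W"
      unfolding M1_def by (subst (asm) AE_density) auto
    then show ?thesis
    proof eventually_elim
      fix x assume *: "0 < ennreal (indicator {0..1} (x \<bullet> e) * w x) \<longrightarrow> ?gp x \<notin> Z \<inter> W"
      show "x \<bullet> e \<in> {0..1} \<longrightarrow> ?gp x \<in> W \<longrightarrow>
        n (?gp x) = (1 / sqrt (1 + (norm (grad \<Gamma> (?gp x)))\<^sup>2)) *\<^sub>R (e - grad \<Gamma> (?gp x))"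
      proof (intro impI)
        assume "x \<bullet> e \<in> {0..1}" and W: "?gp x \<in> W"
        then have "0 < ennreal (indicator {0..1} (x \<bullet> e) * w x)"
          using w[of x] by (simp add: indicator_def)
        with * W have "?gp x \<notin> Z" by blast
        with Z(1) W have "n (?gp x) = N (?gp x)" using space_\<sigma> by blast
        then show "n (?gp x) = (1 / sqrt (1 + (norm (grad \<Gamma> (?gp x)))\<^sup>2)) *\<^sub>R (e - grad \<Gamma> (?gp x))"
          by (simp only: N_def)
      qed
    qed
  qed
  have grad_gp: "grad \<Gamma> (?gp x) = grad \<Gamma> x" for x
  proof -
    have "\<Gamma> (?gp x + h *\<^sub>R i) = \<Gamma> (x + h *\<^sub>R i)" for h i
      using const[of "x + h *\<^sub>R i" "\<Gamma> x - x \<bullet> e"] by (simp add: graph_point_def algebra_simps)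
    then show ?thesis by (simp add: grad_def pderiv_at_def)
  qed
  define h where "h x = \<phi> x * (n x \<bullet> v)" for x
  have [measurable]: "h \<in> borel_measurable borel" unfolding h_def by measurable
  have hW: "h = (\<lambda>x. indicator W x *\<^sub>R h x)"
    using \<phi>W by (auto simp: h_def W_def indicator_def fun_eq_iff)
  have hW': "(\<lambda>x. indicator W x * h x) = h"
    using hW[symmetric] by (simp only: real_scaleR_def)
  have AE_eq: "AE x in lborel. (indicator {0..1} (x \<bullet> e) * w x) *\<^sub>R h (?gp x)
      = indicator {0..1} (x \<bullet> e) * (\<phi> (?gp x) * (e \<bullet> v - g x))"
    using AE_n AE_gr g(2)
  proof eventually_elim
    fix x
    assume *: "x \<bullet> e \<in> {0..1} \<longrightarrow> ?gp x \<in> W \<longrightarrow>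
      n (?gp x) = (1 / sqrt (1 + (norm (grad \<Gamma> (?gp x)))\<^sup>2)) *\<^sub>R (e - grad \<Gamma> (?gp x))"
      "grad \<Gamma> x = gr x" "((\<lambda>h. \<Gamma> (x + h *\<^sub>R v)) has_real_derivative g x) (at 0)"
    show "(indicator {0..1} (x \<bullet> e) * w x) *\<^sub>R h (?gp x)
      = indicator {0..1} (x \<bullet> e) * (\<phi> (?gp x) * (e \<bullet> v - g x))"
    proof (cases "x \<bullet> e \<in> {0..1} \<and> ?gp x \<in> W")
      case True
      have "gr x \<bullet> v = pderiv_at v \<Gamma> x"
        unfolding *(2)[symmetric] grad_def using v
        by (simp add: inner_sum_left_Basis)
      also have "\<dots> = g x" unfolding pderiv_at_def using *(3) by (rule DERIV_imp_deriv)
      finally have "w x * (n (?gp x) \<bullet> v) = e \<bullet> v - g x"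
        using *(1) True w[of x] by (simp add: grad_gp *(2) w_def[symmetric] inner_diff_left)
      then show ?thesis by (simp add: h_def mult.left_commute mult.assoc)
    next
      case False
      then show ?thesis using \<phi>W by (auto simp: h_def W_def)
    qed
  qed
  have int: "integrable lborel (\<lambda>x. indicator {0..1} (x \<bullet> e) * (\<phi> (?gp x) * (e \<bullet> v - g x)))"
  proof (rule Bochner_Integration.integrable_bound[OF integrable_indicator_cball])
    show "AE x in lborel. norm (indicator {0..1} (x \<bullet> e) * (\<phi> (?gp x) * (e \<bullet> v - g x)))
        \<le> norm ((M * (1 + L')) * indicat_real (cball 0 (norm p + \<bar>r\<bar> + 1)) x)"
      using g(3)
    proof eventually_elim
      fix x assume gx: "\<bar>g x\<bar> \<le> L'"
      have M: "0 \<le> M" using bnd[of 0] by linarith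
      show "norm (indicator {0..1} (x \<bullet> e) * (\<phi> (?gp x) * (e \<bullet> v - g x)))
        \<le> norm ((M * (1 + L')) * indicat_real (cball 0 (norm p + \<bar>r\<bar> + 1)) x)"
      proof (cases "x \<bullet> e \<in> {0..1} \<and> ?gp x \<in> ball p r")
        case True
        then have "dist p (?gp x) < r" by simp
        then have "norm (?gp x) \<le> norm p + \<bar>r\<bar>"
          using norm_triangle_ineq[of p "?gp x - p"] by (simp add: dist_norm norm_minus_commute)
        then have "norm x \<le> norm p + \<bar>r\<bar> + 1"
          using norm_slab_line[OF e, of x "\<Gamma> x - x \<bullet> e"] True by (simp add: graph_point_def)
        moreover have "\<bar>e \<bullet> v\<bar> \<le> 1" using Cauchy_Schwarz_ineq2[of e v] e v by simp
        then have "\<bar>e \<bullet> v - g x\<bar> \<le> 1 + L'" using gx by linarith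
        then have "\<bar>\<phi> (?gp x) * (e \<bullet> v - g x)\<bar> \<le> M * (1 + L')"
          unfolding abs_mult using bnd M by (intro mult_mono) auto
        ultimately show ?thesis using True by (simp add: indicator_def)
      next
        case False
        then have "indicator {0..1} (x \<bullet> e) * (\<phi> (?gp x) * (e \<bullet> v - g x)) = 0"
          using supp by (auto simp: indicator_def)
        then show ?thesis by (simp only: norm_zero norm_ge_zero)
      qed
    qed
  qed measurable
  have m1: "(\<lambda>x. (indicator {0..1} (x \<bullet> e) * w x) *\<^sub>R h (?gp x)) \<in> borel_measurable lborel"
    "(\<lambda>x. indicator {0..1} (x \<bullet> e) * (\<phi> (?gp x) * (e \<bullet> v - g x))) \<in> borel_measurable lborel"
    by measurable
  have nn: "AE x in lborel. 0 \<le> indicator {0..1} (x \<bullet> e) * w x"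
    using w by (auto simp: indicator_def intro: order_trans[OF zero_le_one])
  have "integrable lborel (\<lambda>x. (indicator {0..1} (x \<bullet> e) * w x) *\<^sub>R h (?gp x))"
    using int integrable_cong_AE[OF m1 AE_eq] by blast
  then have "integrable M1 (\<lambda>x. h (?gp x))"
    unfolding M1_def using nn by (subst integrable_density) auto
  then have "integrable M2 h"
    unfolding M2_def by (subst integrable_distr_eq) auto
  then have "integrable (density M2 (\<lambda>x. ennreal (indicator W x))) h"
    by (subst integrable_density) (auto simp: hW')
  then have "integrable \<sigma> (\<lambda>x. indicator W x *\<^sub>R h x)"
    unfolding dens[symmetric] by (subst (asm) integrable_density) auto
  then have "integrable \<sigma> h" by (simp only: hW[symmetric])
  then show "integrable \<sigma> (\<lambda>x. \<phi> x * (n x \<bullet> v))" by (simp only: h_def[abs_def])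
  have "(\<integral>x. h x \<partial>\<sigma>) = (\<integral>x. indicator W x *\<^sub>R h x \<partial>\<sigma>)" by (simp only: hW[symmetric])
  also have "\<dots> = (\<integral>x. h x \<partial>density \<sigma> (\<lambda>x. ennreal (indicator W x)))"
    by (rule integral_density[symmetric]) auto
  also have "\<dots> = (\<integral>x. indicator W x *\<^sub>R h x \<partial>M2)"
    unfolding dens by (rule integral_density) auto
  also have "\<dots> = (\<integral>x. h x \<partial>M2)" by (simp only: hW[symmetric])
  also have "\<dots> = (\<integral>x. h (?gp x) \<partial>M1)"
    unfolding M2_def by (rule integral_distr) auto
  also have "\<dots> = (\<integral>x. (indicator {0..1} (x \<bullet> e) * w x) *\<^sub>R h (?gp x) \<partial>lborel)"
    unfolding M1_def by (rule integral_density) (use nn in auto)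
  also have "\<dots> = (\<integral>x. indicator {0..1} (x \<bullet> e) * (\<phi> (?gp x) * (e \<bullet> v - g x)) \<partial>lborel)"
    by (rule integral_cong_AE[OF m1 AE_eq])
  finally show "(\<integral>x. \<phi> x * (n x \<bullet> v) \<partial>\<sigma>)
      = (\<integral>x. indicator {0..1} (x \<bullet> e) * (\<phi> (?gp x) * (e \<bullet> v - g x)) \<partial>lborel)"
    unfolding h_def .
qed

section \<open>The divergence theorem on Lipschitz domains\<close>

text \<open>
  A continuously differentiable function that is positive exactly on the ball; the outer square removes
  the kink of the maximum.
\<close>

definition bump :: "'a::euclidean_space \<Rightarrow> real \<Rightarrow> 'a \<Rightarrow> real" where
  "bump p r x = (max 0 (r\<^sup>2 - (norm (x - p))\<^sup>2))\<^sup>2"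

definition bump_grad :: "'a::euclidean_space \<Rightarrow> real \<Rightarrow> 'a \<Rightarrow> 'a" where
  "bump_grad p r x = (- 4 * max 0 (r\<^sup>2 - (norm (x - p))\<^sup>2)) *\<^sub>R (x - p)"

lemma has_real_derivative_max_squared:
  "((\<lambda>z. (max 0 z)\<^sup>2) has_real_derivative 2 * max 0 z) (at z)" for z :: real
proof -
  consider "0 < z" | "z < 0" | "z = 0" by linarith
  then show ?thesis
  proof cases
    case 1
    have "((\<lambda>z. z\<^sup>2) has_real_derivative 2 * max 0 z) (at z)"
      using 1 by (auto intro!: derivative_eq_intros)
    then show ?thesis
      by (rule has_field_derivative_transform_within_open[of _ _ _ "{0<..}"]) (use 1 in auto)
  next
    case 2
    have "((\<lambda>z. 0) has_real_derivative 2 * max 0 z) (at z)"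
      using 2 by (auto intro!: derivative_eq_intros)
    then show ?thesis
      by (rule has_field_derivative_transform_within_open[of _ _ _ "{..<0}"]) (use 2 in auto)
  next
    case 3
    have eq: "((max 0 (0 + h))\<^sup>2 - (max 0 0)\<^sup>2) / h = max 0 h" for h :: real
      by (auto simp: max_def power2_eq_square)
    have "((\<lambda>h. max 0 h) \<longlongrightarrow> max 0 (0::real)) (at 0)" by (intro tendsto_intros)
    then have "((\<lambda>h. ((max 0 (0 + h))\<^sup>2 - (max 0 0)\<^sup>2) / h) \<longlongrightarrow> (0::real)) (at 0)"
      unfolding eq by simp
    then show ?thesis unfolding DERIV_def 3 by simp
  qed
qed

lemma C1_gradient_bump: "C1_gradient \<Omega> (bump p r) (bump_grad p r)"
  unfolding C1_gradient_def
proof (intro conjI ballI)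
  fix x
  have "((\<lambda>x. (x - p) \<bullet> (x - p)) has_derivative (\<lambda>h. 2 * ((x - p) \<bullet> h))) (at x)"
    by (auto intro!: derivative_eq_intros simp: inner_commute)
  then have "((\<lambda>x. r\<^sup>2 - (norm (x - p))\<^sup>2) has_derivative (\<lambda>h. - 2 * ((x - p) \<bullet> h))) (at x)"
    unfolding power2_norm_eq_inner
    by (auto intro!: derivative_eq_intros simp: fun_eq_iff inner_commute)
  from has_derivative_compose[OF this has_real_derivative_max_squared[unfolded has_field_derivative_def]]
  show "(bump p r has_derivative (\<lambda>h. bump_grad p r x \<bullet> h)) (at x)"
    unfolding bump_def bump_grad_def by (simp add: mult.assoc mult.left_commute)
next
  show "continuous_on (closure \<Omega>) (bump p r)" "continuous_on (closure \<Omega>) (bump_grad p r)"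
    unfolding bump_def bump_grad_def by (intro continuous_intros)+
qed

lemma bump_nonneg: "0 \<le> bump p r x" by (simp add: bump_def)

lemma bump_pos: "x \<in> ball p r \<Longrightarrow> 0 < bump p r x"
  using power_strict_mono[of "norm (x - p)" r 2]
  by (simp add: bump_def dist_norm norm_minus_commute)

lemma bump_outside:
  assumes "x \<notin> ball p r" "0 < r" shows "bump p r x = 0" "bump_grad p r x = 0"
proof -
  have "r \<le> norm (x - p)" using assms by (simp add: dist_norm norm_minus_commute)
  then have "r\<^sup>2 \<le> (norm (x - p))\<^sup>2" using assms by (intro power_mono) auto
  then show "bump p r x = 0" "bump_grad p r x = 0" by (simp_all add: bump_def bump_grad_def)
qed

text \<open>
  The Gauss-Green formula for all functions supported in \<open>K\<close>. The gradient has to vanish off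
  \<open>K\<close> as well: that \<open>f\<close> is zero off \<open>K\<close> determines \<open>G\<close> only in the interior of the complement.
\<close>

definition gauss_green_in :: "'a::euclidean_space set \<Rightarrow> 'a measure \<Rightarrow> ('a \<Rightarrow> 'a) \<Rightarrow> 'a set \<Rightarrow> bool" where
  "gauss_green_in \<Omega> \<sigma> n K \<longleftrightarrow> (\<forall>f G. C1_gradient \<Omega> f G \<longrightarrow> (\<forall>x. x \<notin> K \<longrightarrow> f x = 0) \<longrightarrow>
     (\<forall>x\<in>\<Omega>. x \<notin> K \<longrightarrow> G x = 0) \<longrightarrow> (\<forall>v\<in>Basis.
       integrable \<sigma> (\<lambda>x. indicator (frontier \<Omega>) x * f x * (n x \<bullet> v)) \<and>
       (\<integral>x. indicator \<Omega> x * (G x \<bullet> v) \<partial>lborel) = (\<integral>x. indicator (frontier \<Omega>) x * f x * (n x \<bullet> v) \<partial>\<sigma>)))"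

lemma gauss_green_near_boundary:
  assumes \<sigma>: "is_surface_measure \<Omega> \<sigma>" and n: "is_outward_normal \<Omega> \<sigma> n"
    and \<Omega>: "open \<Omega>" "bounded \<Omega>" and chart: "boundary_chart \<Omega> U e \<Gamma>" and pr: "cball p r \<subseteq> U"
  shows "gauss_green_in \<Omega> \<sigma> n (ball p r)"
  unfolding gauss_green_in_def
proof (intro allI impI ballI)
  fix f :: "'a \<Rightarrow> real" and G :: "'a \<Rightarrow> 'a" and v :: 'a
  assume f: "C1_gradient \<Omega> f G" and f0: "\<forall>x. x \<notin> ball p r \<longrightarrow> f x = 0"
    and G0: "\<forall>x\<in>\<Omega>. x \<notin> ball p r \<longrightarrow> G x = 0" and v: "v \<in> Basis"
  obtain L where lip: "L-lipschitz_on UNIV \<Gamma>" and U: "open U"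
    using chart by (auto simp: boundary_chart_def)
  obtain g where g: "g \<in> borel_measurable borel"
    "AE x in lborel. ((\<lambda>h. \<Gamma> (x + h *\<^sub>R v)) has_real_derivative g x) (at 0)"
    "AE x in lborel. \<bar>g x\<bar> \<le> L"
    by (rule lipschitz_directional_derivative_borel[OF lip norm_Basis[OF v]])
  define \<phi> where "\<phi> x = indicator (U \<inter> frontier \<Omega>) x * f x" for x
  have \<phi>_eq: "\<phi> x = indicator (frontier \<Omega>) x * f x" for x
  proof (cases "x \<in> ball p r")
    case True
    then have "x \<in> U" using pr ball_subset_cball by blast
    then show ?thesis by (simp add: \<phi>_def indicator_def)
  next
    case False
    then show ?thesis using f0 by (simp add: \<phi>_def)
  qed
  have sub: "frontier \<Omega> \<subseteq> closure \<Omega>" by (simp add: frontier_def)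
  have contf: "continuous_on (frontier \<Omega>) f"
    using f sub by (auto simp: C1_gradient_def intro: continuous_on_subset)
  have "(\<lambda>x. indicator (frontier \<Omega>) x *\<^sub>R f x) \<in> borel_measurable borel"
    by (rule borel_measurable_continuous_on_indicator[OF _ contf]) simp
  then have \<phi>_meas: "\<phi> \<in> borel_measurable borel" by (simp add: \<phi>_eq[abs_def])
  have "compact (frontier \<Omega>)" using \<Omega> by (simp add: compact_frontier_bounded)
  then have "bounded (f ` frontier \<Omega>)" using contf by (intro compact_imp_bounded compact_continuous_image)
  then obtain M where M: "0 < M" "\<And>x. x \<in> frontier \<Omega> \<Longrightarrow> norm (f x) \<le> M"
    by (auto simp: bounded_pos)
  have bnd: "\<bar>\<phi> x\<bar> \<le> M" for x using M by (auto simp: \<phi>_eq indicator_def)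
  have supp: "\<phi> x = 0" if "x \<notin> ball p r" for x using f0 that by (simp add: \<phi>_def)
  have \<phi>W: "\<phi> x = 0" if "x \<notin> U \<inter> frontier \<Omega>" for x using that by (simp add: \<phi>_def)
  note surf = surface_integral_in_chart[OF \<sigma> n chart \<phi>_meas bnd supp \<phi>W v g]
  have vol: "(\<integral>x. indicator \<Omega> x * (G x \<bullet> v) \<partial>lborel) = (\<integral>x. indicator {0..1} (x \<bullet> e) *
      (indicator (U \<inter> frontier \<Omega>) (graph_point e \<Gamma> x) * f (graph_point e \<Gamma> x) * (e \<bullet> v - g x)) \<partial>lborel)"
    using f0 G0 by (intro volume_integral_in_chart[OF chart \<Omega> f pr _ _ norm_Basis[OF v] g(1,2)]) auto
  show "integrable \<sigma> (\<lambda>x. indicator (frontier \<Omega>) x * f x * (n x \<bullet> v)) \<and>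
       (\<integral>x. indicator \<Omega> x * (G x \<bullet> v) \<partial>lborel) = (\<integral>x. indicator (frontier \<Omega>) x * f x * (n x \<bullet> v) \<partial>\<sigma>)"
    using surf unfolding vol \<phi>_eq[symmetric] by (simp add: \<phi>_def[symmetric])
qed

lemma gauss_green_in_interior:
  assumes \<Omega>: "open \<Omega>" "bounded \<Omega>" and pr: "cball p r \<subseteq> \<Omega>"
  shows "gauss_green_in \<Omega> \<sigma> n (ball p r)"
  unfolding gauss_green_in_def
proof (intro allI impI ballI)
  fix f :: "'a \<Rightarrow> real" and G :: "'a \<Rightarrow> 'a" and v :: 'a
  assume f: "C1_gradient \<Omega> f G" and f0: "\<forall>x. x \<notin> ball p r \<longrightarrow> f x = 0"
    and G0: "\<forall>x\<in>\<Omega>. x \<notin> ball p r \<longrightarrow> G x = 0" and v: "v \<in> Basis"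
  define G' where "G' x = (if x \<in> \<Omega> then G x else 0)" for x
  have der: "(f has_derivative (\<lambda>h. G' x \<bullet> h)) (at x)" for x
  proof (cases "x \<in> \<Omega>")
    case True
    then show ?thesis using f by (simp add: C1_gradient_def G'_def)
  next
    case False
    have "((\<lambda>_. 0) has_derivative (\<lambda>h. G' x \<bullet> h)) (at x)"
      using False by (simp add: G'_def)
    then show ?thesis
      by (rule has_derivative_transform_within_open[of _ _ _ _ "- cball p r"])
        (use False pr f0 in auto)
  qed
  have "compact (closure \<Omega>)" using \<Omega> by simp
  then have "bounded (G ` closure \<Omega>)"
    using f by (intro compact_imp_bounded compact_continuous_image) (auto simp: C1_gradient_def)
  then obtain B where B: "0 < B" "\<And>x. x \<in> closure \<Omega> \<Longrightarrow> norm (G x) \<le> B"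
    by (auto simp: bounded_pos)
  have bnd: "norm (G' x) \<le> B" for x
    using B closure_subset[of \<Omega>] by (auto simp: G'_def)
  have lipf: "B-lipschitz_on UNIV f"
  proof (rule lipschitz_onI)
    fix x y
    have "norm (f x - f y) \<le> B * norm (x - y)"
    proof (rule differentiable_bound[of UNIV f "\<lambda>z h. G' z \<bullet> h"])
      fix z
      show "onorm (\<lambda>h. G' z \<bullet> h) \<le> B"
      proof (rule onorm_le)
        fix h
        have "norm (G' z \<bullet> h) \<le> norm (G' z) * norm h" by (simp add: Cauchy_Schwarz_ineq2)
        also have "\<dots> \<le> B * norm h" using bnd by (intro mult_right_mono) auto
        finally show "norm (G' z \<bullet> h) \<le> B * norm h" .
      qed
    qed (use der in auto)
    then show "dist (f x) (f y) \<le> B * dist x y" by (simp add: dist_norm)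
  qed (use B in simp)
  have supp: "f x = 0" if "norm p + \<bar>r\<bar> < norm x" for x
  proof -
    have "norm x \<le> norm p + dist p x" using norm_triangle_ineq[of p "x - p"]
      by (simp add: dist_norm norm_minus_commute)
    then show ?thesis using that f0 by auto
  qed
  have line: "((\<lambda>h. f (x + h *\<^sub>R v)) has_real_derivative G' x \<bullet> v) (at 0)" for x
  proof -
    have "(f has_derivative (\<lambda>h. G' x \<bullet> h)) (at (x + 0 *\<^sub>R v))" using der by simp
    moreover have "((\<lambda>h. x + h *\<^sub>R v) has_derivative (\<lambda>h. h *\<^sub>R v)) (at 0)"
      by (auto intro!: derivative_eq_intros)
    ultimately have "((\<lambda>h. f (x + h *\<^sub>R v)) has_derivative (\<lambda>h. G' x \<bullet> (h *\<^sub>R v))) (at 0)"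
      by (rule has_derivative_compose[rotated])
    then show ?thesis by (simp add: has_field_derivative_def mult_commute_abs)
  qed
  have "(\<integral>x. indicator \<Omega> x * (G x \<bullet> v) \<partial>lborel) = (\<integral>x. G' x \<bullet> v \<partial>lborel)"
    by (intro Bochner_Integration.integral_cong) (auto simp: G'_def indicator_def)
  also have "\<dots> = 0"
    by (rule integral_directional_derivative_eq_0[OF lipf supp norm_Basis[OF v] line])
  finally have vol: "(\<integral>x. indicator \<Omega> x * (G x \<bullet> v) \<partial>lborel) = 0" .
  have "frontier \<Omega> \<inter> \<Omega> = {}" using \<Omega> by (auto simp: frontier_def interior_open)
  then have front: "indicator (frontier \<Omega>) x * f x = 0" for x
  proof (cases "x \<in> ball p r")
    case True
    then have "x \<in> \<Omega>" using pr ball_subset_cball by blast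
    then show ?thesis using \<open>frontier \<Omega> \<inter> \<Omega> = {}\<close> by (auto simp: indicator_def)
  next
    case False
    then show ?thesis using f0 by simp
  qed
  then show "integrable \<sigma> (\<lambda>x. indicator (frontier \<Omega>) x * f x * (n x \<bullet> v)) \<and>
       (\<integral>x. indicator \<Omega> x * (G x \<bullet> v) \<partial>lborel) = (\<integral>x. indicator (frontier \<Omega>) x * f x * (n x \<bullet> v) \<partial>\<sigma>)"
    unfolding vol front by simp
qed

text \<open>
  Cover the compact closure by finitely many balls on which the formula is known, and write \<open>f\<close> as the
  sum of the functions \<open>bump p (r p) * (f / S)\<close>, where \<open>S\<close> is the sum of the bumps. Dividing \<open>f\<close>, rather
  than the bumps, by \<open>S\<close> has the effect that only the positivity of \<open>S\<close> on the closure matters.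
\<close>

theorem gauss_green:
  assumes dom: "bounded_lipschitz_domain \<Omega>"
    and \<sigma>: "is_surface_measure \<Omega> \<sigma>" and n: "is_outward_normal \<Omega> \<sigma> n"
    and f: "C1_gradient \<Omega> f G" and v: "v \<in> Basis"
  shows "integrable \<sigma> (\<lambda>x. indicator (frontier \<Omega>) x * f x * (n x \<bullet> v))"
    and "(\<integral>x. indicator \<Omega> x * (G x \<bullet> v) \<partial>lborel) = (\<integral>x. indicator (frontier \<Omega>) x * f x * (n x \<bullet> v) \<partial>\<sigma>)"
proof -
  have \<Omega>: "open \<Omega>" "bounded \<Omega>"
    and charts: "\<And>p. p \<in> frontier \<Omega> \<Longrightarrow> \<exists>U e \<Gamma>. p \<in> U \<and> boundary_chart \<Omega> U e \<Gamma>"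
    using dom by (auto simp: bounded_lipschitz_domain_def)
  have "\<exists>r>0. gauss_green_in \<Omega> \<sigma> n (ball p r)" if p: "p \<in> closure \<Omega>" for p
  proof (cases "p \<in> \<Omega>")
    case True
    then obtain r where "0 < r" "cball p r \<subseteq> \<Omega>" using \<Omega>(1) by (auto simp: open_contains_cball)
    then show ?thesis using gauss_green_in_interior[OF \<Omega>] by blast
  next
    case False
    then have "p \<in> frontier \<Omega>" using p \<Omega>(1) by (simp add: frontier_def interior_open)
    then obtain U e \<Gamma> where U: "p \<in> U" and chart: "boundary_chart \<Omega> U e \<Gamma>" using charts by blast
    then have "open U" by (simp add: boundary_chart_def)
    then obtain r where "0 < r" "cball p r \<subseteq> U" using U by (auto simp: open_contains_cball)
    then show ?thesis using gauss_green_near_boundary[OF \<sigma> n \<Omega> chart] by blast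
  qed
  then obtain r where r: "\<And>p. p \<in> closure \<Omega> \<Longrightarrow> 0 < r p"
    "\<And>p. p \<in> closure \<Omega> \<Longrightarrow> gauss_green_in \<Omega> \<sigma> n (ball p (r p))"
    by metis
  have "compact (closure \<Omega>)" using \<Omega> by simp
  moreover have "closure \<Omega> \<subseteq> (\<Union>p\<in>closure \<Omega>. ball p (r p))" using r(1) by force
  ultimately obtain P where P: "P \<subseteq> closure \<Omega>" "finite P" "closure \<Omega> \<subseteq> (\<Union>p\<in>P. ball p (r p))"
    using compactE_image[of "closure \<Omega>" "closure \<Omega>" "\<lambda>p. ball p (r p)"] by (metis open_ball)
  define S where "S x = (\<Sum>p\<in>P. bump p (r p) x)" for x
  define DS where "DS x = (\<Sum>p\<in>P. bump_grad p (r p) x)" for x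
  have S_C1: "C1_gradient \<Omega> S DS"
    unfolding S_def DS_def by (intro C1_gradient_sum C1_gradient_bump)
  have S_pos: "0 < S x" if x: "x \<in> closure \<Omega>" for x
  proof -
    obtain p where "p \<in> P" "x \<in> ball p (r p)" using P(3) x by blast
    then show ?thesis unfolding S_def using P(2) bump_nonneg bump_pos
      by (intro sum_pos2[of P p]) auto
  qed
  define q where "q x = f x * inverse (S x)" for x
  obtain Q where q: "C1_gradient \<Omega> q Q"
    using C1_gradient_mult[OF f C1_gradient_inverse[OF S_C1]] S_pos unfolding q_def by fastforce
  define fp where "fp p x = bump p (r p) x * q x" for p x
  define Gp where "Gp p x = bump p (r p) x *\<^sub>R Q x + q x *\<^sub>R bump_grad p (r p) x" for p x
  have fp_C1: "C1_gradient \<Omega> (fp p) (Gp p)" for p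
    unfolding fp_def Gp_def by (rule C1_gradient_mult[OF C1_gradient_bump q])
  have sum_fp: "(\<Sum>p\<in>P. fp p x) = f x" if "x \<in> closure \<Omega>" for x
  proof -
    have "(\<Sum>p\<in>P. fp p x) = S x * q x" by (simp add: fp_def S_def sum_distrib_right)
    then show ?thesis using S_pos[OF that] by (simp add: q_def)
  qed
  have sum_Gp: "(\<Sum>p\<in>P. Gp p x) = G x" if "x \<in> \<Omega>" for x
    by (rule C1_gradient_unique[OF \<Omega>(1) C1_gradient_sum[OF fp_C1] f _ that])
      (use sum_fp closure_subset in blast)
  have piece: "integrable \<sigma> (\<lambda>x. indicator (frontier \<Omega>) x * fp p x * (n x \<bullet> v)) \<and>
     (\<integral>x. indicator \<Omega> x * (Gp p x \<bullet> v) \<partial>lborel) = (\<integral>x. indicator (frontier \<Omega>) x * fp p x * (n x \<bullet> v) \<partial>\<sigma>)"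
    if "p \<in> P" for p
  proof -
    have p: "p \<in> closure \<Omega>" using that P(1) by blast
    have "fp p x = 0" "Gp p x = 0" if "x \<notin> ball p (r p)" for x
      unfolding fp_def Gp_def bump_outside[OF that r(1)[OF p]] by simp_all
    then have "\<forall>x. x \<notin> ball p (r p) \<longrightarrow> fp p x = 0" "\<forall>x\<in>\<Omega>. x \<notin> ball p (r p) \<longrightarrow> Gp p x = 0"
      by blast+
    then show ?thesis using r(2)[OF p] fp_C1[of p] v unfolding gauss_green_in_def by blast
  qed
  have sum_front: "indicator (frontier \<Omega>) x * f x * (n x \<bullet> v)
      = (\<Sum>p\<in>P. indicator (frontier \<Omega>) x * fp p x * (n x \<bullet> v))" for x
  proof (cases "x \<in> frontier \<Omega>")
    case True
    then have "x \<in> closure \<Omega>" by (simp add: frontier_def)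
    then show ?thesis using True by (simp add: sum_fp[symmetric] sum_distrib_right)
  qed simp
  show "integrable \<sigma> (\<lambda>x. indicator (frontier \<Omega>) x * f x * (n x \<bullet> v))"
    unfolding sum_front using piece by (intro Bochner_Integration.integrable_sum) blast
  have int_Gp: "integrable lborel (\<lambda>x. indicator \<Omega> x * (Gp p x \<bullet> v))" for p
    using fp_C1[of p] by (intro integrable_continuous_on_closure \<Omega>)
      (auto simp: C1_gradient_def intro!: continuous_intros)
  have "(\<integral>x. indicator \<Omega> x * (G x \<bullet> v) \<partial>lborel) = (\<integral>x. (\<Sum>p\<in>P. indicator \<Omega> x * (Gp p x \<bullet> v)) \<partial>lborel)"
    by (intro Bochner_Integration.integral_cong refl)
      (auto simp: indicator_def sum_Gp[symmetric] inner_sum_left)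
  also have "\<dots> = (\<Sum>p\<in>P. \<integral>x. indicator \<Omega> x * (Gp p x \<bullet> v) \<partial>lborel)"
    by (intro Bochner_Integration.integral_sum int_Gp)
  also have "\<dots> = (\<Sum>p\<in>P. \<integral>x. indicator (frontier \<Omega>) x * fp p x * (n x \<bullet> v) \<partial>\<sigma>)"
    using piece by (intro sum.cong) auto
  also have "\<dots> = (\<integral>x. (\<Sum>p\<in>P. indicator (frontier \<Omega>) x * fp p x * (n x \<bullet> v)) \<partial>\<sigma>)"
    using piece by (intro Bochner_Integration.integral_sum[symmetric]) blast
  finally show "(\<integral>x. indicator \<Omega> x * (G x \<bullet> v) \<partial>lborel) = (\<integral>x. indicator (frontier \<Omega>) x * f x * (n x \<bullet> v) \<partial>\<sigma>)"
    unfolding sum_front .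
qed

theorem divergence_theorem:
  assumes dom: "bounded_lipschitz_domain \<Omega>"
    and \<sigma>: "is_surface_measure \<Omega> \<sigma>" and n: "is_outward_normal \<Omega> \<sigma> n"
    and V: "\<And>i. i \<in> Basis \<Longrightarrow> C1_gradient \<Omega> (\<lambda>x. V x \<bullet> i) (G i)"
  shows "(\<integral>x. indicator \<Omega> x * (\<Sum>i\<in>Basis. G i x \<bullet> i) \<partial>lborel) = (\<integral>x. indicator (frontier \<Omega>) x * (V x \<bullet> n x) \<partial>\<sigma>)"
proof -
  have \<Omega>: "open \<Omega>" "bounded \<Omega>" using dom by (auto simp: bounded_lipschitz_domain_def)
  have int_G: "integrable lborel (\<lambda>x. indicator \<Omega> x * (G i x \<bullet> i))" if "i \<in> Basis" for i
    using V[OF that] by (intro integrable_continuous_on_closure \<Omega>)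
      (auto simp: C1_gradient_def intro!: continuous_intros)
  have "(\<integral>x. indicator \<Omega> x * (\<Sum>i\<in>Basis. G i x \<bullet> i) \<partial>lborel)
      = (\<Sum>i\<in>Basis. \<integral>x. indicator \<Omega> x * (G i x \<bullet> i) \<partial>lborel)"
    unfolding sum_distrib_left by (intro Bochner_Integration.integral_sum int_G)
  also have "\<dots> = (\<Sum>i\<in>Basis. \<integral>x. indicator (frontier \<Omega>) x * (V x \<bullet> i) * (n x \<bullet> i) \<partial>\<sigma>)"
    by (intro sum.cong refl gauss_green(2)[OF dom \<sigma> n V])
  also have "\<dots> = (\<integral>x. (\<Sum>i\<in>Basis. indicator (frontier \<Omega>) x * (V x \<bullet> i) * (n x \<bullet> i)) \<partial>\<sigma>)"
    by (intro Bochner_Integration.integral_sum[symmetric] gauss_green(1)[OF dom \<sigma> n V])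
  also have "\<dots> = (\<integral>x. indicator (frontier \<Omega>) x * (V x \<bullet> n x) \<partial>\<sigma>)"
    by (simp add: euclidean_inner[of "V _" "n _"] sum_distrib_left mult.assoc)
  finally show ?thesis .
qed

section \<open>Differentiation under the integral sign\<close>

text \<open>
  At a zero of \<open>f\<close> the derivative rule for powers of a positive base does not apply. There the difference quotient of \<open>f powr m\<close> is \<open>f powr (m - 1)\<close>, which tends to zero, times that of
  \<open>f\<close>.
\<close>

lemma DERIV_powr_nonneg:
  fixes f :: "real \<Rightarrow> real"
  assumes f: "(f has_real_derivative d) (at t)" and nn: "\<forall>\<^sub>F \<tau> in nhds t. 0 \<le> f \<tau>" and m: "1 < m"
  shows "((\<lambda>\<tau>. f \<tau> powr m) has_real_derivative m * f t powr (m - 1) * d) (at t)"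
proof (cases "0 < f t")
  case True
  then show ?thesis
    using DERIV_chain2[OF has_real_derivative_powr[OF True, of m] f] by simp
next
  case False
  then have f0: "f t = 0" using eventually_nhds_x_imp_x[OF nn] by simp
  have lim0: "filterlim (\<lambda>h. t + h) (nhds t) (at 0)"
    by (intro tendsto_eq_intros) auto
  have nn': "\<forall>\<^sub>F h in at 0. 0 \<le> f (t + h)"
    using nn lim0 by (rule eventually_compose_filterlim)
  have "isCont f t" using f by (rule DERIV_isCont)
  then have "((\<lambda>h. f (t + h)) \<longlongrightarrow> 0) (at 0)" using f0 by (simp add: isCont_iff)
  then have "((\<lambda>h. f (t + h) powr (m - 1)) \<longlongrightarrow> 0) (at 0)"
    using nn' m by (intro tendsto_zero_powrI[where b="m - 1"]) auto
  moreover have "((\<lambda>h. (f (t + h) - f t) / h) \<longlongrightarrow> d) (at 0)" using f by (simp add: DERIV_def)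
  ultimately have "((\<lambda>h. f (t + h) powr (m - 1) * ((f (t + h) - f t) / h)) \<longlongrightarrow> 0 * d) (at 0)"
    by (rule tendsto_mult)
  moreover have "\<forall>\<^sub>F h in at 0. f (t + h) powr (m - 1) * ((f (t + h) - f t) / h) = (f (t + h) powr m - f t powr m) / h"
    using nn'
  proof eventually_elim
    case (elim h)
    have "f (t + h) powr (m - 1) * f (t + h) = f (t + h) powr m"
      using elim by (cases "f (t + h) = 0") (simp_all add: powr_mult_base[symmetric] powr_diff)
    then show ?case using m by (simp add: f0)
  qed
  ultimately have "((\<lambda>h. (f (t + h) powr m - f t powr m) / h) \<longlongrightarrow> 0 * d) (at 0)"
    by (rule Lim_transform_eventually)
  then show ?thesis using m by (simp add: DERIV_def f0)
qed

lemma continuous_on_slice: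
  assumes "continuous_on (I \<times> K) (\<lambda>(\<tau>, x). w \<tau> x)" "t \<in> I"
  shows "continuous_on K (w t)"
proof -
  have "continuous_on K (\<lambda>x. (t, x))"
    by (intro continuous_on_Pair continuous_on_const continuous_on_id)
  from continuous_on_compose2[OF assms(1) this] assms(2) show ?thesis by auto
qed

text \<open>
  The time derivative is bounded on the compact set \<open>{a..c} \<times> closure \<Omega>\<close>, so by the mean value theorem
  the difference quotients in time are bounded by the same constant, and dominated convergence applies.
\<close>

lemma has_real_derivative_integral_over_closure:
  fixes W :: "real \<Rightarrow> 'a::euclidean_space \<Rightarrow> real"
  assumes \<Omega>: "open \<Omega>" "bounded \<Omega>" and t: "a < t" "t < c"
    and contW: "\<And>\<tau>. \<tau> \<in> {a..c} \<Longrightarrow> continuous_on (closure \<Omega>) (W \<tau>)"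
    and der: "\<And>\<tau> x. \<tau> \<in> {a..c} \<Longrightarrow> x \<in> closure \<Omega> \<Longrightarrow> ((\<lambda>\<tau>. W \<tau> x) has_real_derivative W' \<tau> x) (at \<tau>)"
    and contW': "continuous_on ({a..c} \<times> closure \<Omega>) (\<lambda>(\<tau>, x). W' \<tau> x)"
  shows "((\<lambda>\<tau>. \<integral>x. indicator \<Omega> x * W \<tau> x \<partial>lborel) has_real_derivative
    (\<integral>x. indicator \<Omega> x * W' t x \<partial>lborel)) (at t)"
proof -
  have "compact ({a..c} \<times> closure \<Omega>)" using \<Omega> by (intro compact_Times) auto
  then have "bounded ((\<lambda>(\<tau>, x). W' \<tau> x) ` ({a..c} \<times> closure \<Omega>))"
    using contW' by (intro compact_imp_bounded compact_continuous_image)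
  then obtain K where K: "0 < K" "\<And>\<tau> x. \<tau> \<in> {a..c} \<Longrightarrow> x \<in> closure \<Omega> \<Longrightarrow> \<bar>W' \<tau> x\<bar> \<le> K"
    by (force simp: bounded_pos)
  have lip: "\<bar>W \<tau> x - W t x\<bar> \<le> K * \<bar>\<tau> - t\<bar>" if \<tau>: "\<tau> \<in> {a..c}" and x: "x \<in> closure \<Omega>" for \<tau> x
  proof -
    have "norm (W \<tau> x - W t x) \<le> K * norm (\<tau> - t)"
      by (rule field_differentiable_bound[of "{a..c}" "\<lambda>\<tau>. W \<tau> x" "\<lambda>\<tau>. W' \<tau> x"])
        (use der K \<tau> x t in \<open>auto intro: has_field_derivative_at_within\<close>)
    then show ?thesis by simp
  qed
  have contW't: "continuous_on (closure \<Omega>) (W' t)"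
    using continuous_on_slice[OF contW', of t] t by simp
  have int: "integrable lborel (\<lambda>x. indicator \<Omega> x * W \<tau> x)" if "\<tau> \<in> {a..c}" for \<tau>
    by (intro integrable_continuous_on_closure \<Omega> contW that)
  let ?I = "\<lambda>\<tau>. \<integral>x. indicator \<Omega> x * W \<tau> x \<partial>lborel"
  have "((\<lambda>\<tau>. (?I \<tau> - ?I t) / (\<tau> - t)) \<longlongrightarrow> (\<integral>x. indicator \<Omega> x * W' t x \<partial>lborel)) (at t within {a..c})"
    unfolding tendsto_at_iff_sequentially
  proof (intro allI impI)
    fix X :: "nat \<Rightarrow> real" assume X: "\<forall>i. X i \<in> {a..c} - {t}" and Xt: "X \<longlonglongrightarrow> t"
    have "(\<lambda>i. \<integral>x. indicator \<Omega> x * ((W (X i) x - W t x) / (X i - t)) \<partial>lborel)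
        \<longlonglongrightarrow> (\<integral>x. indicator \<Omega> x * W' t x \<partial>lborel)"
    proof (rule integral_dominated_convergence)
      show "(\<lambda>x. indicator \<Omega> x * W' t x) \<in> borel_measurable lborel"
        using integrable_continuous_on_closure[OF \<Omega> contW't] by (rule borel_measurable_integrable)
      show "(\<lambda>x. indicator \<Omega> x * ((W (X i) x - W t x) / (X i - t))) \<in> borel_measurable lborel" for i
      proof -
        have "X i \<in> {a..c}" using X by blast
        then have "continuous_on (closure \<Omega>) (\<lambda>x. (W (X i) x - W t x) / (X i - t))"
          using X t by (intro continuous_intros contW) auto
        then show ?thesis
          using integrable_continuous_on_closure[OF \<Omega>] by (intro borel_measurable_integrable)
      qed
      show "integrable lborel (\<lambda>x. indicator \<Omega> x * K)"
        by (intro integrable_continuous_on_closure \<Omega> continuous_intros)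
      show "AE x in lborel. (\<lambda>i. indicator \<Omega> x * ((W (X i) x - W t x) / (X i - t))) \<longlonglongrightarrow> indicator \<Omega> x * W' t x"
      proof (intro AE_I2)
        fix x
        show "(\<lambda>i. indicator \<Omega> x * ((W (X i) x - W t x) / (X i - t))) \<longlonglongrightarrow> indicator \<Omega> x * W' t x"
        proof (cases "x \<in> \<Omega>")
          case True
          then have "x \<in> closure \<Omega>" using closure_subset by blast
          then have "((\<lambda>\<tau>. (W \<tau> x - W t x) / (\<tau> - t)) \<longlongrightarrow> W' t x) (at t)"
            using der[of t x] t by (simp add: has_field_derivative_iff)
          then have "((\<lambda>\<tau>. (W \<tau> x - W t x) / (\<tau> - t)) \<circ> X) \<longlonglongrightarrow> W' t x"
            unfolding tendsto_at_iff_sequentially using X Xt by blast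
          then show ?thesis using True by (simp add: comp_def)
        qed simp
      qed
      show "AE x in lborel. norm (indicator \<Omega> x * ((W (X i) x - W t x) / (X i - t))) \<le> indicator \<Omega> x * K" for i
      proof (intro AE_I2)
        fix x
        have Xi: "X i \<in> {a..c}" "X i \<noteq> t" using X by auto
        show "norm (indicator \<Omega> x * ((W (X i) x - W t x) / (X i - t))) \<le> indicator \<Omega> x * K"
        proof (cases "x \<in> \<Omega>")
          case True
          then have "x \<in> closure \<Omega>" using closure_subset by blast
          then show ?thesis
            using lip[OF Xi(1), of x] Xi(2) True by (simp add: divide_le_eq)
        qed simp
      qed
    qed
    moreover have quot: "(\<integral>x. indicator \<Omega> x * ((W (X i) x - W t x) / (X i - t)) \<partial>lborel) = (?I (X i) - ?I t) / (X i - t)" for i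
    proof -
      have Xi: "X i \<in> {a..c}" and tt: "t \<in> {a..c}" using X t by auto
      have eq: "indicator \<Omega> x * ((W (X i) x - W t x) / (X i - t))
          = (indicator \<Omega> x * W (X i) x - indicator \<Omega> x * W t x) / (X i - t)" for x
        by (simp add: right_diff_distrib)
      show ?thesis
        unfolding eq integral_divide_zero Bochner_Integration.integral_diff[OF int[OF Xi] int[OF tt]] ..
    qed
    ultimately show "((\<lambda>\<tau>. (?I \<tau> - ?I t) / (\<tau> - t)) \<circ> X) \<longlonglongrightarrow> (\<integral>x. indicator \<Omega> x * W' t x \<partial>lborel)"
      unfolding comp_def quot by blast
  qed
  then show ?thesis
    using t by (simp add: has_field_derivative_iff at_within_Icc_at)
qed

section \<open>The energy balance\<close>

text \<open>
  Where \<open>v > 0\<close>, the power \<open>v\<^sup>m\<close> is a smooth function of the pressure with derivative \<open>v\<close>. Where \<open>v = 0\<close>,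
  the power has an interior minimum, so its gradient is zero. At such points \<open>v\<close> itself may
  fail to be differentiable.
\<close>

lemma power_gradient_eq_pressure_gradient:
  fixes v :: "'a::euclidean_space \<Rightarrow> real"
  assumes m: "1 < m" and \<Omega>: "open \<Omega>" and nn: "\<And>x. x \<in> \<Omega> \<Longrightarrow> 0 \<le> v x"
    and Gm: "C1_gradient \<Omega> (\<lambda>x. v x powr m) Gm" and G\<mu>: "C1_gradient \<Omega> (pressure m v) G\<mu>"
    and x: "x \<in> \<Omega>"
  shows "Gm x = v x *\<^sub>R G\<mu> x"
proof (cases "v x = 0")
  case True
  have "((\<lambda>x. v x powr m) has_derivative (\<lambda>h. Gm x \<bullet> h)) (at x)"
    using Gm x by (simp add: C1_gradient_def)
  then have "(\<lambda>h. Gm x \<bullet> h) = (\<lambda>h. 0)"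
    by (rule differential_zero_maxmin[OF x \<Omega>]) (use True in simp)
  from fun_cong[OF this, of "Gm x"] have "Gm x = 0" by simp
  then show ?thesis using True by simp
next
  case False
  then have vx: "0 < v x" using nn[OF x] by simp
  define c where "c = (m - 1) / m"
  \<comment> \<open>The power is \<open>v powr m = (c * pressure m v) powr k\<close>.\<close>
  define k where "k = m / (m - 1)"
  have ck: "0 < c" "k * c = 1" "(m - 1) * k = m" "(m - 1) * (k - 1) = 1" using m
    by (simp_all add: c_def k_def field_simps)
  have cp: "c * pressure m v y = v y powr (m - 1)" for y
    using m by (simp add: c_def pressure_def field_simps)
  have "((\<lambda>z. (c * z) powr k) has_real_derivative v x) (at (pressure m v x))"
  proof -
    have pos: "0 < c * pressure m v x" unfolding cp using vx by simp
    have "((\<lambda>z. c * z) has_real_derivative c) (at (pressure m v x))"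
      by (auto intro!: derivative_eq_intros)
    from DERIV_chain2[OF has_real_derivative_powr[OF pos, of k] this]
    have "((\<lambda>z. (c * z) powr k) has_real_derivative k * (c * pressure m v x) powr (k - 1) * c) (at (pressure m v x))" .
    moreover have "(c * pressure m v x) powr (k - 1) = v x"
      unfolding cp powr_powr ck using vx by simp
    moreover have "k * v x * c = (k * c) * v x" by simp
    ultimately show ?thesis unfolding ck(2) by simp
  qed
  moreover have "(pressure m v has_derivative (\<lambda>h. G\<mu> x \<bullet> h)) (at x)"
    using G\<mu> x by (simp add: C1_gradient_def)
  ultimately have "((\<lambda>y. (c * pressure m v y) powr k) has_derivative (\<lambda>h. v x * (G\<mu> x \<bullet> h))) (at x)"
    unfolding has_field_derivative_def by (rule has_derivative_compose[rotated])
  then have "((\<lambda>y. v y powr m) has_derivative (\<lambda>h. v x * (G\<mu> x \<bullet> h))) (at x)"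
    unfolding cp powr_powr ck .
  moreover have "((\<lambda>x. v x powr m) has_derivative (\<lambda>h. Gm x \<bullet> h)) (at x)"
    using Gm x by (simp add: C1_gradient_def)
  ultimately have "(\<lambda>h. v x * (G\<mu> x \<bullet> h)) = (\<lambda>h. Gm x \<bullet> h)" by (rule has_derivative_unique)
  then have eq: "Gm x \<bullet> h = (v x *\<^sub>R G\<mu> x) \<bullet> h" for h by (simp add: fun_eq_iff)
  have "(Gm x - v x *\<^sub>R G\<mu> x) \<bullet> (Gm x - v x *\<^sub>R G\<mu> x) = 0"
    unfolding inner_diff_left eq by simp
  then show ?thesis by simp
qed

lemma continuous_eq_on_closure:
  fixes f g :: "'a::metric_space \<Rightarrow> 'b::real_normed_vector"
  assumes "continuous_on (closure \<Omega>) f" "continuous_on (closure \<Omega>) g"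
    and eq: "\<And>x. x \<in> \<Omega> \<Longrightarrow> f x = g x" and x: "x \<in> closure \<Omega>"
  shows "f x = g x"
proof -
  have "continuous_on (closure \<Omega>) (\<lambda>x. f x - g x)" using assms by (intro continuous_intros)
  then have "f x - g x = 0"
    by (rule continuous_constant_on_closure) (use eq x in auto)
  then show ?thesis by simp
qed

text \<open>
  The divergence theorem for \<open>V = \<mu> F - v\<^sup>m b\<close>, where \<open>F\<close> is the flux. Subtracting \<open>v\<^sup>m b\<close> removes the drift
  from \<open>div V\<close>: the term \<open>v b \<bullet> \<nabla>\<mu>\<close> of \<open>F \<bullet> \<nabla>\<mu>\<close> equals \<open>b \<bullet> \<nabla>(v\<^sup>m)\<close>. It also turns the coefficient
  \<open>\<mu> v = m / (m - 1) v\<^sup>m\<close> of \<open>b\<close> into \<open>v\<^sup>m / (m - 1)\<close>.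
\<close>

lemma pressure_flux_integral:
  fixes v :: "'a::euclidean_space \<Rightarrow> real" and b :: "'a \<Rightarrow> 'a"
  assumes dom: "bounded_lipschitz_domain \<Omega>"
    and \<sigma>: "is_surface_measure \<Omega> \<sigma>" and n: "is_outward_normal \<Omega> \<sigma> n"
    and m: "1 < m" and b: "C1_closure \<Omega> b" and div_b: "\<forall>x\<in>\<Omega>. divg b x = 0"
    and nn: "\<And>x. x \<in> \<Omega> \<Longrightarrow> 0 \<le> v x" and cont: "continuous_on (closure \<Omega>) v"
    and Gm: "C1_gradient \<Omega> (\<lambda>x. v x powr m) Gm" and G\<mu>: "C1_gradient \<Omega> (pressure m v) G\<mu>"
    and flux: "C1_closure \<Omega> (pm_flux \<Omega> m b v)"
  obtains divF where "continuous_on (closure \<Omega>) divF" "\<And>x. x \<in> \<Omega> \<Longrightarrow> divg (pm_flux \<Omega> m b v) x = divF x"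
    "(\<integral>x. indicator \<Omega> x * (pressure m v x * divF x) \<partial>lborel)
       = pm_dissipation \<Omega> 1 m v - pm_boundary \<Omega> \<sigma> n 1 m b v"
proof -
  have \<Omega>: "open \<Omega>" "bounded \<Omega>" using dom by (auto simp: bounded_lipschitz_domain_def)
  define F where "F = pm_flux \<Omega> m b v"
  have "\<forall>i. \<exists>G. C1_gradient \<Omega> (\<lambda>x. F x \<bullet> i) G" using C1_closure_inner[OF flux] unfolding F_def by metis
  then obtain GF where GF: "\<And>i. C1_gradient \<Omega> (\<lambda>x. F x \<bullet> i) (GF i)" by metis
  have "\<forall>i. \<exists>G. C1_gradient \<Omega> (\<lambda>x. b x \<bullet> i) G" using C1_closure_inner[OF b] by metis
  then obtain Gb where Gb: "\<And>i. C1_gradient \<Omega> (\<lambda>x. b x \<bullet> i) (Gb i)" by metis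
  have chain: "Gm x = v x *\<^sub>R G\<mu> x" if "x \<in> closure \<Omega>" for x
    by (rule continuous_eq_on_closure[OF _ _ power_gradient_eq_pressure_gradient[OF m \<Omega>(1) nn Gm G\<mu>] that])
      (use Gm G\<mu> cont in \<open>auto simp: C1_gradient_def intro!: continuous_intros\<close>)
  have nn': "0 \<le> v x" if "x \<in> closure \<Omega>" for x
    using continuous_ge_on_closure[OF cont that nn] .
  have F_eq: "F x = v x *\<^sub>R (b x - G\<mu> x)" if "x \<in> closure \<Omega>" for x
    unfolding F_def pm_flux_def grad_closure_eq[OF \<Omega>(1) Gm that] chain[OF that]
    by (simp add: scaleR_right_diff_distrib)
  have pv: "pressure m v x * v x = m / (m - 1) * v x powr m" if "x \<in> closure \<Omega>" for x
  proof -
    have "v x powr (m - 1) * v x = v x powr m"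
      using nn'[OF that] by (cases "v x = 0") (simp_all add: powr_diff)
    then show ?thesis by (simp add: pressure_def mult.assoc)
  qed
  define divF where "divF x = (\<Sum>i\<in>Basis. GF i x \<bullet> i)" for x
  have cont_div: "continuous_on (closure \<Omega>) divF"
    unfolding divF_def using GF by (auto simp: C1_gradient_def intro!: continuous_intros)
  have div_flux: "divg (pm_flux \<Omega> m b v) x = divF x" if "x \<in> \<Omega>" for x
    using divg_eq[OF GF that] by (simp add: F_def divF_def)
  define V where "V x = pressure m v x *\<^sub>R F x - (v x powr m) *\<^sub>R b x" for x
  define GV where "GV i x = (pressure m v x *\<^sub>R GF i x + (F x \<bullet> i) *\<^sub>R G\<mu> x)
      - ((v x powr m) *\<^sub>R Gb i x + (b x \<bullet> i) *\<^sub>R Gm x)" for i x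
  have V_C1: "C1_gradient \<Omega> (\<lambda>x. V x \<bullet> i) (GV i)" for i
    using C1_gradient_diff[OF C1_gradient_mult[OF G\<mu> GF[of i]] C1_gradient_mult[OF Gm Gb[of i]]]
    by (simp add: V_def GV_def[abs_def] inner_diff_left)
  have div_V: "(\<Sum>i\<in>Basis. GV i x \<bullet> i) = pressure m v x * divF x - v x * (norm (G\<mu> x))\<^sup>2"
    if x: "x \<in> \<Omega>" for x
  proof -
    have xc: "x \<in> closure \<Omega>" using x closure_subset by blast
    have "(\<Sum>i\<in>Basis. Gb i x \<bullet> i) = 0" using div_b x divg_eq[OF Gb x] by simp
    then have "(\<Sum>i\<in>Basis. GV i x \<bullet> i) = pressure m v x * divF x + (F x \<bullet> G\<mu> x - b x \<bullet> Gm x)"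
      unfolding GV_def divF_def
      by (simp add: inner_diff_left inner_add_left sum.distrib sum_subtractf sum_distrib_left[symmetric]
          euclidean_inner[of "F x" "G\<mu> x"] euclidean_inner[of "b x" "Gm x"])
    also have "F x \<bullet> G\<mu> x - b x \<bullet> Gm x = - (v x * (norm (G\<mu> x))\<^sup>2)"
      unfolding F_eq[OF xc] chain[OF xc]
      by (simp add: inner_diff_left power2_norm_eq_inner algebra_simps)
    finally show ?thesis by simp
  qed
  have V_eq: "V x = (v x powr m / (m - 1)) *\<^sub>R b x
      - (pressure m v x * 1 * v x) *\<^sub>R grad_closure \<Omega> (pressure m v) x" if x: "x \<in> closure \<Omega>" for x
  proof -
    have "V x = (pressure m v x * v x - v x powr m) *\<^sub>R b x - (pressure m v x * v x) *\<^sub>R G\<mu> x"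
      unfolding V_def F_eq[OF x] by (simp add: algebra_simps)
    moreover have "pressure m v x * v x - v x powr m = v x powr m / (m - 1)"
      unfolding pv[OF x] using m by (simp add: field_simps)
    ultimately show ?thesis by (simp add: grad_closure_eq[OF \<Omega>(1) G\<mu> x])
  qed
  have cont_d: "continuous_on (closure \<Omega>) (\<lambda>x. 1 * v x * (norm (G\<mu> x))\<^sup>2)"
    using cont G\<mu> by (auto simp: C1_gradient_def intro!: continuous_intros)
  have cont_p: "continuous_on (closure \<Omega>) (\<lambda>x. pressure m v x * divF x)"
    using G\<mu> cont_div by (auto simp: C1_gradient_def intro!: continuous_intros)
  have diss: "pm_dissipation \<Omega> 1 m v = (\<integral>x. indicator \<Omega> x * (1 * v x * (norm (G\<mu> x))\<^sup>2) \<partial>lborel)"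
  proof -
    have "pm_dissipation \<Omega> 1 m v = (LINT x:\<Omega>|lebesgue. 1 * v x * (norm (G\<mu> x))\<^sup>2)"
      unfolding pm_dissipation_def
      by (intro set_lebesgue_integral_cong) (use \<Omega>(1) grad_eq[OF G\<mu>] in auto)
    then show ?thesis using set_integral_lebesgue_eq_lborel[OF \<Omega> cont_d] by simp
  qed
  have bdry: "pm_boundary \<Omega> \<sigma> n 1 m b v = - (\<integral>x. indicator (frontier \<Omega>) x * (V x \<bullet> n x) \<partial>\<sigma>)"
  proof -
    have "indicator (frontier \<Omega>) x *\<^sub>R (((v x powr m / (m - 1)) *\<^sub>R b x
        - (pressure m v x * 1 * v x) *\<^sub>R grad_closure \<Omega> (pressure m v) x) \<bullet> n x)
      = indicator (frontier \<Omega>) x * (V x \<bullet> n x)" for x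
    proof (cases "x \<in> frontier \<Omega>")
      case True
      then have "x \<in> closure \<Omega>" by (simp add: frontier_def)
      then show ?thesis by (simp only: V_eq real_scaleR_def)
    qed simp
    then show ?thesis unfolding pm_boundary_def set_lebesgue_integral_def by (simp only:)
  qed
  have "(\<integral>x. indicator (frontier \<Omega>) x * (V x \<bullet> n x) \<partial>\<sigma>) = (\<integral>x. indicator \<Omega> x * (\<Sum>i\<in>Basis. GV i x \<bullet> i) \<partial>lborel)"
    by (rule divergence_theorem[OF dom \<sigma> n V_C1, symmetric])
  also have "\<dots> = (\<integral>x. indicator \<Omega> x * (pressure m v x * divF x) - indicator \<Omega> x * (1 * v x * (norm (G\<mu> x))\<^sup>2) \<partial>lborel)"
    by (intro Bochner_Integration.integral_cong refl) (auto simp: indicator_def div_V)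
  also have "\<dots> = (\<integral>x. indicator \<Omega> x * (pressure m v x * divF x) \<partial>lborel)
      - (\<integral>x. indicator \<Omega> x * (1 * v x * (norm (G\<mu> x))\<^sup>2) \<partial>lborel)"
    by (intro Bochner_Integration.integral_diff integrable_continuous_on_closure \<Omega> cont_p cont_d)
  finally have "(\<integral>x. indicator \<Omega> x * (pressure m v x * divF x) \<partial>lborel)
       = pm_dissipation \<Omega> 1 m v - pm_boundary \<Omega> \<sigma> n 1 m b v"
    unfolding diss bdry by simp
  with cont_div div_flux show thesis by (rule that)
qed

text \<open>
  The source is only known almost everywhere, through the equation, as a function equal to the
  continuous function \<open>\<partial>\<^sub>t u + div F\<close>. Completeness of the Lebesgue measure makes it measurable.
\<close>

lemma energy_balance:
  fixes u :: "real \<Rightarrow> 'a::euclidean_space \<Rightarrow> real" and b :: "'a \<Rightarrow> 'a"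
  assumes dom: "bounded_lipschitz_domain \<Omega>"
    and \<sigma>: "is_surface_measure \<Omega> \<sigma>" and n: "is_outward_normal \<Omega> \<sigma> n"
    and m: "1 < m" and b: "C1_closure \<Omega> b" and div_b: "\<forall>x\<in>\<Omega>. divg b x = 0"
    and sol: "pm_smooth_solution \<Omega> T m b s u" and t: "t \<in> {0<..<T}"
  shows "((\<lambda>\<tau>. LINT x:\<Omega>|lebesgue. u \<tau> x powr m / (m - 1)) has_real_derivative
            - pm_dissipation \<Omega> 1 m (u t)
            + pm_boundary \<Omega> \<sigma> n 1 m b (u t)
            + (LINT x:\<Omega>|lebesgue. pressure m (u t) x * s (u t x))) (at t)"
proof -
  have \<Omega>: "open \<Omega>" "bounded \<Omega>" using dom by (auto simp: bounded_lipschitz_domain_def)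
  define ut where "ut \<tau> x = deriv (\<lambda>\<tau>. u \<tau> x) \<tau>" for \<tau> x
  have nn: "\<And>\<tau> x. \<tau> \<in> {0<..<T} \<Longrightarrow> x \<in> \<Omega> \<Longrightarrow> 0 \<le> u \<tau> x"
    and cont_u: "continuous_on ({0<..<T} \<times> closure \<Omega>) (\<lambda>(t, x). u t x)"
    and diff_u: "\<And>\<tau> x. \<tau> \<in> {0<..<T} \<Longrightarrow> x \<in> closure \<Omega> \<Longrightarrow> (\<lambda>\<tau>. u \<tau> x) differentiable (at \<tau>)"
    and cont_ut: "continuous_on ({0<..<T} \<times> closure \<Omega>) (\<lambda>(t, x). ut t x)"
    and C1: "C1_closure \<Omega> (\<lambda>x. u t x powr m)" "C1_closure \<Omega> (pressure m (u t))"
      "C1_closure \<Omega> (pm_flux \<Omega> m b (u t))"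
    and eqn: "AE x in lebesgue. x \<in> \<Omega> \<longrightarrow> ut t x + divg (pm_flux \<Omega> m b (u t)) x = s (u t x)"
    using sol t unfolding pm_smooth_solution_def ut_def by blast+
  have cont_ux: "continuous_on (closure \<Omega>) (u \<tau>)" if "\<tau> \<in> {0<..<T}" for \<tau>
    using continuous_on_slice[OF cont_u that] .
  have cont_utx: "continuous_on (closure \<Omega>) (ut t)"
    using continuous_on_slice[OF cont_ut t] .
  have nn': "0 \<le> u \<tau> x" if "\<tau> \<in> {0<..<T}" "x \<in> closure \<Omega>" for \<tau> x
    using continuous_ge_on_closure[OF cont_ux[OF that(1)] that(2) nn[OF that(1)]] .
  obtain Gm where Gm: "C1_gradient \<Omega> (\<lambda>x. u t x powr m) Gm" by (rule C1_closure_real[OF C1(1)])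
  obtain G\<mu> where G\<mu>: "C1_gradient \<Omega> (pressure m (u t)) G\<mu>" by (rule C1_closure_real[OF C1(2)])
  obtain divF where divF: "continuous_on (closure \<Omega>) divF"
    "\<And>x. x \<in> \<Omega> \<Longrightarrow> divg (pm_flux \<Omega> m b (u t)) x = divF x"
    "(\<integral>x. indicator \<Omega> x * (pressure m (u t) x * divF x) \<partial>lborel)
       = pm_dissipation \<Omega> 1 m (u t) - pm_boundary \<Omega> \<sigma> n 1 m b (u t)"
    using pressure_flux_integral[OF dom \<sigma> n m b div_b nn[OF t] cont_ux[OF t] Gm G\<mu> C1(3)] by blast
  have cont_\<mu>: "continuous_on (closure \<Omega>) (pressure m (u t))" using G\<mu> by (simp add: C1_gradient_def)
  have source: "(LINT x:\<Omega>|lebesgue. pressure m (u t) x * s (u t x))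
      = (\<integral>x. indicator \<Omega> x * (pressure m (u t) x * ut t x) \<partial>lborel)
        + (\<integral>x. indicator \<Omega> x * (pressure m (u t) x * divF x) \<partial>lborel)"
  proof -
    let ?k = "\<lambda>x. pressure m (u t) x * (ut t x + divF x)"
    have cont_k: "continuous_on (closure \<Omega>) ?k"
      using cont_\<mu> cont_utx divF(1) by (intro continuous_intros)
    have meas: "(\<lambda>x. indicator \<Omega> x * ?k x) \<in> borel_measurable lebesgue"
      using borel_measurable_integrable[OF integrable_continuous_on_closure[OF \<Omega> cont_k]]
      by (rule measurable_completion)
    have AE_eq: "AE x in lebesgue. indicator \<Omega> x * ?k x = indicator \<Omega> x *\<^sub>R (pressure m (u t) x * s (u t x))"
      using eqn
    proof eventually_elim
      fix x assume "x \<in> \<Omega> \<longrightarrow> ut t x + divg (pm_flux \<Omega> m b (u t)) x = s (u t x)"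
      then show "indicator \<Omega> x * ?k x = indicator \<Omega> x *\<^sub>R (pressure m (u t) x * s (u t x))"
        using divF(2)[of x] by (cases "x \<in> \<Omega>") auto
    qed
    have "(LINT x:\<Omega>|lebesgue. pressure m (u t) x * s (u t x)) = (\<integral>x. indicator \<Omega> x * ?k x \<partial>lebesgue)"
      unfolding set_lebesgue_integral_def
      by (rule integral_cong_AE[symmetric, OF meas borel_measurable_AE[OF meas AE_eq] AE_eq])
    also have "\<dots> = (\<integral>x. indicator \<Omega> x * ?k x \<partial>lborel)"
      using borel_measurable_integrable[OF integrable_continuous_on_closure[OF \<Omega> cont_k]]
      by (rule integral_completion)
    also have "\<dots> = (\<integral>x. indicator \<Omega> x * (pressure m (u t) x * ut t x)
        + indicator \<Omega> x * (pressure m (u t) x * divF x) \<partial>lborel)"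
      by (simp add: distrib_left)
    also have "\<dots> = (\<integral>x. indicator \<Omega> x * (pressure m (u t) x * ut t x) \<partial>lborel)
        + (\<integral>x. indicator \<Omega> x * (pressure m (u t) x * divF x) \<partial>lborel)"
      using cont_\<mu> cont_utx divF(1)
      by (intro Bochner_Integration.integral_add integrable_continuous_on_closure \<Omega> continuous_intros)
    finally show ?thesis .
  qed
  obtain a c where ac: "0 < a" "a < t" "t < c" "c < T"
    using t dense[of 0 t] dense[of t T] by auto
  have sub: "{a..c} \<subseteq> {0<..<T}" using ac by auto
  have cont_uac: "continuous_on ({a..c} \<times> closure \<Omega>) (\<lambda>(t, x). u t x)"
    and cont_utac: "continuous_on ({a..c} \<times> closure \<Omega>) (\<lambda>(t, x). ut t x)"
    using sub by (auto intro: continuous_on_subset[OF cont_u] continuous_on_subset[OF cont_ut])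
  have "((\<lambda>\<tau>. \<integral>x. indicator \<Omega> x * (u \<tau> x powr m / (m - 1)) \<partial>lborel) has_real_derivative
    (\<integral>x. indicator \<Omega> x * (pressure m (u t) x * ut t x) \<partial>lborel)) (at t)"
  proof (rule has_real_derivative_integral_over_closure[OF \<Omega> ac(2,3)])
    show "continuous_on (closure \<Omega>) (\<lambda>x. u \<tau> x powr m / (m - 1))" if "\<tau> \<in> {a..c}" for \<tau>
      using cont_ux[of \<tau>] nn'[of \<tau>] sub that m
      by (intro continuous_on_divide continuous_on_powr' continuous_on_const) auto
    show "((\<lambda>\<tau>. u \<tau> x powr m / (m - 1)) has_real_derivative pressure m (u \<tau>) x * ut \<tau> x) (at \<tau>)"
      if \<tau>: "\<tau> \<in> {a..c}" and x: "x \<in> closure \<Omega>" for \<tau> x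
    proof -
      have \<tau>T: "\<tau> \<in> {0<..<T}" using sub \<tau> by blast
      have "((\<lambda>\<tau>. u \<tau> x) has_real_derivative ut \<tau> x) (at \<tau>)"
        using diff_u[OF \<tau>T x] unfolding ut_def by (simp add: DERIV_deriv_iff_real_differentiable)
      moreover have "\<forall>\<^sub>F \<tau>' in nhds \<tau>. 0 \<le> u \<tau>' x"
        using eventually_nhds_in_open[OF open_greaterThanLessThan \<tau>T] by eventually_elim (use nn' x in auto)
      ultimately have "((\<lambda>\<tau>. u \<tau> x powr m) has_real_derivative m * u \<tau> x powr (m - 1) * ut \<tau> x) (at \<tau>)"
        using m by (rule DERIV_powr_nonneg)
      from DERIV_cdivide[OF this, of "m - 1"] show ?thesis by (simp add: pressure_def)
    qed
    have "continuous_on ({a..c} \<times> closure \<Omega>) (\<lambda>z. (case z of (\<tau>, x) \<Rightarrow> u \<tau> x) powr (m - 1))"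
      using m nn' sub by (intro continuous_on_powr' cont_uac continuous_on_const) auto
    then have "continuous_on ({a..c} \<times> closure \<Omega>)
        (\<lambda>z. m / (m - 1) * (case z of (\<tau>, x) \<Rightarrow> u \<tau> x) powr (m - 1) * (case z of (\<tau>, x) \<Rightarrow> ut \<tau> x))"
      by (intro continuous_on_mult cont_utac continuous_on_const)
    then show "continuous_on ({a..c} \<times> closure \<Omega>) (\<lambda>(\<tau>, x). pressure m (u \<tau>) x * ut \<tau> x)"
      by (simp add: pressure_def case_prod_beta')
  qed
  moreover have "\<forall>\<^sub>F \<tau> in nhds t. (LINT x:\<Omega>|lebesgue. u \<tau> x powr m / (m - 1))
      = (\<integral>x. indicator \<Omega> x * (u \<tau> x powr m / (m - 1)) \<partial>lborel)"
    using eventually_nhds_in_open[OF open_greaterThanLessThan t]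
  proof eventually_elim
    fix \<tau> assume \<tau>: "\<tau> \<in> {0<..<T}"
    have "continuous_on (closure \<Omega>) (\<lambda>x. u \<tau> x powr m / (m - 1))"
      using cont_ux[OF \<tau>] nn'[OF \<tau>] m
      by (intro continuous_on_divide continuous_on_powr' continuous_on_const) auto
    then show "(LINT x:\<Omega>|lebesgue. u \<tau> x powr m / (m - 1))
      = (\<integral>x. indicator \<Omega> x * (u \<tau> x powr m / (m - 1)) \<partial>lborel)"
      by (rule set_integral_lebesgue_eq_lborel[OF \<Omega>])
  qed
  ultimately have "((\<lambda>\<tau>. LINT x:\<Omega>|lebesgue. u \<tau> x powr m / (m - 1)) has_real_derivative
    (\<integral>x. indicator \<Omega> x * (pressure m (u t) x * ut t x) \<partial>lborel)) (at t)"
    by (subst DERIV_cong_ev[OF refl _ refl]) auto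
  then show ?thesis unfolding source divF(3) by simp
qed

text \<open>
  Together with \<open>\<nabla>(v\<^sup>m) = v \<nabla>\<mu>\<close>, the relation with \<open>c \<noteq> 1\<close> forces \<open>v \<nabla>\<mu> = 0\<close>, on the closure by
  continuity. So the terms that contain \<open>c\<close> vanish.
\<close>

lemma pm_terms_eq_of_gradient_relation:
  fixes v :: "'a::euclidean_space \<Rightarrow> real"
  assumes \<Omega>: "open \<Omega>" and m: "1 < m"
    and nn: "\<And>x. x \<in> \<Omega> \<Longrightarrow> 0 \<le> v x" and cont: "continuous_on (closure \<Omega>) v"
    and C1: "C1_closure \<Omega> (\<lambda>x. v x powr m)" "C1_closure \<Omega> (pressure m v)"
    and rel: "\<And>x. x \<in> \<Omega> \<Longrightarrow> grad (\<lambda>y. v y powr m) x = (c * v x) *\<^sub>R grad (pressure m v) x"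
    and c: "c \<noteq> 1"
  shows "pm_dissipation \<Omega> c m v = pm_dissipation \<Omega> 1 m v"
    and "pm_boundary \<Omega> \<sigma> n c m b v = pm_boundary \<Omega> \<sigma> n 1 m b v"
proof -
  obtain Gm where Gm: "C1_gradient \<Omega> (\<lambda>x. v x powr m) Gm" by (rule C1_closure_real[OF C1(1)])
  obtain G\<mu> where G\<mu>: "C1_gradient \<Omega> (pressure m v) G\<mu>" by (rule C1_closure_real[OF C1(2)])
  have zero: "v x *\<^sub>R G\<mu> x = 0" if x: "x \<in> \<Omega>" for x
  proof -
    have "v x *\<^sub>R G\<mu> x = c *\<^sub>R (v x *\<^sub>R G\<mu> x)"
      using rel[OF x] power_gradient_eq_pressure_gradient[OF m \<Omega> nn Gm G\<mu> x]
      by (simp add: grad_eq[OF Gm x] grad_eq[OF G\<mu> x])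
    then have "(1 - c) *\<^sub>R (v x *\<^sub>R G\<mu> x) = 0" unfolding scaleR_left_diff_distrib by simp
    then show ?thesis using c by simp
  qed
  \<comment> \<open>The formula extends to the closure since both sides are continuous there.\<close>
  have zero': "v x *\<^sub>R G\<mu> x = 0" if "x \<in> closure \<Omega>" for x
    by (rule continuous_eq_on_closure[OF _ _ zero that])
      (use G\<mu> cont in \<open>auto simp: C1_gradient_def intro!: continuous_intros\<close>)
  have "k * v x * (norm (grad (pressure m v) x))\<^sup>2 = 0" if "x \<in> \<Omega>" for k x
    using zero[OF that] by (auto simp: grad_eq[OF G\<mu> that])
  then show "pm_dissipation \<Omega> c m v = pm_dissipation \<Omega> 1 m v"
    unfolding pm_dissipation_def set_lebesgue_integral_def
    by (intro Bochner_Integration.integral_cong refl) (auto simp: indicator_def)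
  have term0: "(pressure m v x * k * v x) *\<^sub>R grad_closure \<Omega> (pressure m v) x = 0"
    if "x \<in> closure \<Omega>" for k x
    using zero'[OF that] by (auto simp: grad_closure_eq[OF \<Omega> G\<mu> that])
  have "indicator (frontier \<Omega>) x *\<^sub>R (((v x powr m / (m - 1)) *\<^sub>R b x
        - (pressure m v x * k * v x) *\<^sub>R grad_closure \<Omega> (pressure m v) x) \<bullet> n x)
      = indicator (frontier \<Omega>) x *\<^sub>R (((v x powr m / (m - 1)) *\<^sub>R b x - 0) \<bullet> n x)" for k x
  proof (cases "x \<in> frontier \<Omega>")
    case True
    then have "x \<in> closure \<Omega>" by (simp add: frontier_def)
    then show ?thesis by (simp only: term0)
  qed simp
  then show "pm_boundary \<Omega> \<sigma> n c m b v = pm_boundary \<Omega> \<sigma> n 1 m b v"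
    unfolding pm_boundary_def set_lebesgue_integral_def by (simp only:)
qed

theorem proposition6p3:
  fixes \<Omega> :: "'a::euclidean_space set"
    and \<sigma> :: "'a measure"
    and n :: "'a \<Rightarrow> 'a"
    and b :: "'a \<Rightarrow> 'a"
    and s :: "real \<Rightarrow> real"
    and u :: "real \<Rightarrow> 'a \<Rightarrow> real"
    and m T :: real
  assumes "bounded_lipschitz_domain \<Omega>"
    and "is_surface_measure \<Omega> \<sigma>"
    and "is_outward_normal \<Omega> \<sigma> n"
    and "0 < T"
    and "1 < m"
    and "C1_closure \<Omega> b"
    and "\<forall>x\<in>\<Omega>. divg b x = 0"
    and "pm_smooth_solution \<Omega> T m b s u"
  shows
    "((\<forall>t\<in>{0<..<T}. \<forall>x\<in>\<Omega>.
          grad (\<lambda>y. u t y powr m) x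
            = ((m - 1) / m * u t x) *\<^sub>R grad (pressure m (u t)) x) \<longrightarrow>
      (\<forall>t\<in>{0<..<T}.
         ((\<lambda>\<tau>. LINT x:\<Omega>|lebesgue. u \<tau> x powr m / (m - 1)) has_real_derivative
            - pm_dissipation \<Omega> ((m - 1) / m) m (u t)
            + pm_boundary \<Omega> \<sigma> n ((m - 1) / m) m b (u t)
            + (LINT x:\<Omega>|lebesgue. pressure m (u t) x * s (u t x))) (at t)))
     \<and>
     (\<forall>t\<in>{0<..<T}.
         ((\<lambda>\<tau>. LINT x:\<Omega>|lebesgue. u \<tau> x powr m / (m - 1)) has_real_derivative
            - pm_dissipation \<Omega> 1 m (u t)
            + pm_boundary \<Omega> \<sigma> n 1 m b (u t)
            + (LINT x:\<Omega>|lebesgue. pressure m (u t) x * s (u t x))) (at t))"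
proof (intro conjI impI ballI)
  note dom = assms(1) and \<sigma> = assms(2) and n = assms(3) and m = assms(5) and sol = assms(8)
  fix t assume t: "t \<in> {0<..<T}"
  note balance = energy_balance[OF dom \<sigma> n m assms(6,7) sol t]
  then show "((\<lambda>\<tau>. LINT x:\<Omega>|lebesgue. u \<tau> x powr m / (m - 1)) has_real_derivative
            - pm_dissipation \<Omega> 1 m (u t)
            + pm_boundary \<Omega> \<sigma> n 1 m b (u t)
            + (LINT x:\<Omega>|lebesgue. pressure m (u t) x * s (u t x))) (at t)" .
  assume rel: "\<forall>t\<in>{0<..<T}. \<forall>x\<in>\<Omega>. grad (\<lambda>y. u t y powr m) x
            = ((m - 1) / m * u t x) *\<^sub>R grad (pressure m (u t)) x"
  have \<Omega>: "open \<Omega>" using dom by (simp add: bounded_lipschitz_domain_def)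
  have nn: "\<And>x. x \<in> \<Omega> \<Longrightarrow> 0 \<le> u t x"
    and cont_u: "continuous_on ({0<..<T} \<times> closure \<Omega>) (\<lambda>(t, x). u t x)"
    and C1: "C1_closure \<Omega> (\<lambda>x. u t x powr m)" "C1_closure \<Omega> (pressure m (u t))"
    using sol t unfolding pm_smooth_solution_def by blast+
  have cont: "continuous_on (closure \<Omega>) (u t)"
    using continuous_on_slice[OF cont_u t] .
  have "(m - 1) / m \<noteq> 1" using m by (simp add: field_simps)
  note same = pm_terms_eq_of_gradient_relation[OF \<Omega> m nn cont C1 _ this]
  show "((\<lambda>\<tau>. LINT x:\<Omega>|lebesgue. u \<tau> x powr m / (m - 1)) has_real_derivative
            - pm_dissipation \<Omega> ((m - 1) / m) m (u t)
            + pm_boundary \<Omega> \<sigma> n ((m - 1) / m) m b (u t)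
            + (LINT x:\<Omega>|lebesgue. pressure m (u t) x * s (u t x))) (at t)"
    using balance same rel t by simp
qed

end
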